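(* Assume $\rho>\mu-\lambda+\sqrt{\sigma^2+\lambda^2}$, and that $$\rho\le\mu+\sigma\quad\text{and}\quad\mu-\sigma>0.$$ Then $u_+=+\infty$ and $$u_-=a\frac{N}{D},$$ where $$N=\omega_+\Omega_+-\omega_-\Omega_--\frac{\lambda\,\omega_+\omega_-}{\lambda+\rho}(\Omega_+-\Omega_-),$$ $$D=\omega_+(\Omega_+-1)-\omega_-(\Omega_--1)-\frac{\lambda\,\omega_+\omega_-}{\lambda+\rho-\mu-\sigma}(\Omega_+-\Omega_-).$$ Moreover, with $$C_+=u_-^{-\Omega_+}\frac{u_-(\Omega_--1)-a\Omega_-}{\omega_+(\Omega_--\Omega_+)},\qquad C_-=u_-^{-\Omega_-}\frac{u_-(\Omega_+-1)-a\Omega_+}{\omega_-(\Omega_+-\Omega_-)},$$ the value function is given by $$g(y,-1)=\begin{cases}C_-\omega_-y^{\Omega_-}+C_+\omega_+y^{\Omega_+},&0\le y\le u_-,\\ y-a,&y\ge u_-,\end{cases}\qquad g(y,+1)=\begin{cases}C_-y^{\Omega_-}+C_+y^{\Omega_+},&0\le y\le u_-,\\ by-a\frac{\lambda}{\lambda+\rho},&y\ge u_-.\end{cases}$$ (That is, in the general representation of $g$ given in the context, $C=0$.)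
   Context: Fix real parameters $\lambda>0$, $\mu>0$, $\sigma>0$, $a>0$, $\rho>0$. Let $(\xi(t),t\ge 0)$ be the continuous-time Markov chain with (right-continuous) piecewise constant paths in $S=\{-1,+1\}$, which jumps from each state to the other at rate $\lambda$ (infinitesimal generator $\begin{pmatrix}-\lambda&\lambda\\ \lambda&-\lambda\end{pmatrix}$). For $Y_0\ge 0$, let $Y_t=Y_0\exp\left(\mu t+\sigma\int_0^t\xi(u)\,du\right)$, i.e. $dY_t/dt=(\mu+\sigma\xi(t))Y_t$. Let $(\mathcal F_t)$ be the completed natural filtration of $(\xi(t))$. $P_{y,s}$ and $E_{y,s}$ denote probability and expectation given $Y_0=y$, $\xi(0)=s$. The reward process is $X_t=e^{-\rho t}(Y_t-a)$ for $0\le t<\infty$, and $X_{+\infty}=0$. The value function is $g(y,s)=\sup_\tau E_{y,s}(X_\tau)$, the supremum being over all $(\mathcal F_t)$-stopping times $\tau$ with values in $[0,\infty]$. For $s=\pm1$, the set $\{y\in\mathbb R_+=[0,\infty): g(y,s)=y-a\}$ is an interval $[u_s,+\infty)$, which defines $u_\pm:=u_{\pm 1}\in[0,+\infty]$ (with $u_s=+\infty$ if the set is empty). Constants: $b=\lambda(\lambda+\rho-\mu-\sigma)^{-1}$, $\Omega=(\lambda+\rho)(\mu+\sigma)^{-1}$, $$\Omega_\pm=\frac{(\lambda+\rho)\mu\pm\sqrt{\lambda^2\mu^2+\sigma^2(\rho^2+2\lambda\rho)}}{\mu^2-\sigma^2},\qquad \omega_\pm=1+\frac{\rho}{\lambda}-\frac{\mu+\sigma}{\lambda}\Omega_\pm.$$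 General representation: there are constants $C_-,C_+,C$ such that $g(y,-1)=C_-\omega_-y^{\Omega_-}+C_+\omega_+y^{\Omega_+}$ and $g(y,+1)=C_-y^{\Omega_-}+C_+y^{\Omega_+}$ for $0\le y\le u_-$, and $g(y,+1)=by-a\frac{\lambda}{\lambda+\rho}+Cy^{\Omega}$ for all finite $y$ with $u_-\le y\le u_+$. *)

theory Defs
  imports "HOL-Probability.Probability"
begin

section \<open>Continuous-time Markov chains with finite state space\<close>

definition transition_semigroup ::
  "real set \<Rightarrow> (real \<Rightarrow> real \<Rightarrow> real \<Rightarrow> real) \<Rightarrow> bool" where
  "transition_semigroup S p \<longleftrightarrow>
     (\<forall>t\<ge>0. \<forall>i\<in>S. (\<forall>j\<in>S. 0 \<le> p t i j) \<and> (\<Sum>j\<in>S. p t i j) = 1) \<and>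
     (\<forall>i\<in>S. \<forall>j\<in>S. p 0 i j = (if i = j then 1 else 0)) \<and>
     (\<forall>t\<ge>0. \<forall>h\<ge>0. \<forall>i\<in>S. \<forall>j\<in>S. p (t + h) i j = (\<Sum>k\<in>S. p t i k * p h k j))"

definition has_generator ::
  "real set \<Rightarrow> (real \<Rightarrow> real \<Rightarrow> real \<Rightarrow> real) \<Rightarrow> (real \<Rightarrow> real \<Rightarrow> real) \<Rightarrow> bool" where
  "has_generator S p Q \<longleftrightarrow>
     (\<forall>i\<in>S. \<forall>j\<in>S. ((\<lambda>t. p t i j) has_real_derivative Q i j) (at_right 0))"

(* Time is indexed by ennreal, so that stopping times may take the value infinity;
   the process itself is indexed by real, and only its values at times >= 0 matter. *)

definition past_events ::
  "'w measure \<Rightarrow> (real \<Rightarrow> 'w \<Rightarrow> real) \<Rightarrow> ennreal \<Rightarrow> 'w set set" where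
  "past_events M \<xi> t =
     {\<xi> u -` B \<inter> space M | u B. 0 \<le> u \<and> ennreal u \<le> t \<and> B \<in> sets borel}"

definition natural_filtration ::
  "'w measure \<Rightarrow> (real \<Rightarrow> 'w \<Rightarrow> real) \<Rightarrow> ennreal \<Rightarrow> 'w measure" where
  "natural_filtration M \<xi> t = sigma (space M) (past_events M \<xi> t)"

(* The null sets of the completion of M are the subsets of M-null sets. *)
definition completed_filtration ::
  "'w measure \<Rightarrow> (real \<Rightarrow> 'w \<Rightarrow> real) \<Rightarrow> ennreal \<Rightarrow> 'w measure" where
  "completed_filtration M \<xi> t =
     sigma (space M) (past_events M \<xi> t \<union> null_sets (completion M))"

(* Since S is finite, right continuity and local finiteness of the set of
   discontinuities say that the path is piecewise constant. *)
definition piecewise_constant_path :: "(real \<Rightarrow> real) \<Rightarrow> bool" where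
  "piecewise_constant_path x \<longleftrightarrow>
     (\<forall>t\<ge>0. continuous (at_right t) x) \<and>
     (\<forall>T. finite {t \<in> {0<..T}. \<not> isCont x t})"

definition markov_chain ::
  "real set \<Rightarrow> (real \<Rightarrow> real \<Rightarrow> real) \<Rightarrow> real \<Rightarrow> 'w measure \<Rightarrow> (real \<Rightarrow> 'w \<Rightarrow> real) \<Rightarrow> bool" where
  "markov_chain S Q s M \<xi> \<longleftrightarrow>
     prob_space M \<and> finite S \<and>
     (\<forall>t\<ge>0. \<xi> t \<in> measurable M (count_space S)) \<and>
     (\<forall>\<omega>\<in>space M. piecewise_constant_path (\<lambda>t. \<xi> t \<omega>)) \<and>
     (AE \<omega> in M. \<xi> 0 \<omega> = s) \<and>
     (\<exists>p. transition_semigroup S p \<and> has_generator S p Q \<and>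
        (\<forall>t\<ge>0. \<forall>h\<ge>0. \<forall>j\<in>S. AE \<omega> in M.
           real_cond_exp M (natural_filtration M \<xi> (ennreal t))
             (indicator {\<omega> \<in> space M. \<xi> (t + h) \<omega> = j}) \<omega> = p h (\<xi> t \<omega>) j))"

definition flip_generator :: "real \<Rightarrow> real \<Rightarrow> real \<Rightarrow> real" where
  "flip_generator lam i j = (if i = j then - lam else lam)"

section \<open>The optimal stopping problem\<close>

definition price ::
  "(real \<Rightarrow> 'w \<Rightarrow> real) \<Rightarrow> real \<Rightarrow> real \<Rightarrow> real \<Rightarrow> real \<Rightarrow> 'w \<Rightarrow> real" where
  "price \<xi> \<mu> \<sigma> y t \<omega> = y * exp (\<mu> * t + \<sigma> * integral {0..t} (\<lambda>u. \<xi> u \<omega>))"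

definition reward ::
  "(real \<Rightarrow> 'w \<Rightarrow> real) \<Rightarrow> real \<Rightarrow> real \<Rightarrow> real \<Rightarrow> real \<Rightarrow> real \<Rightarrow> ennreal \<Rightarrow> 'w \<Rightarrow> real" where
  "reward \<xi> \<mu> \<sigma> a \<rho> y t \<omega> =
     (if t = \<infinity> then 0
      else exp (- \<rho> * enn2real t) * (price \<xi> \<mu> \<sigma> y (enn2real t) \<omega> - a))"

(* Extended-valued expectation. No infinity - infinity arises for the reward:
   with y, a and rho nonnegative it is bounded below by -a. *)
definition ext_expectation :: "'w measure \<Rightarrow> ('w \<Rightarrow> real) \<Rightarrow> ereal" where
  "ext_expectation M f =
     enn2ereal (\<integral>\<^sup>+ \<omega>. ennreal (f \<omega>) \<partial>M) - enn2ereal (\<integral>\<^sup>+ \<omega>. ennreal (- f \<omega>) \<partial>M)"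

(* Stopping times of the completed filtration are only measurable with respect to
   the completion of M, so the expectation is taken there. *)
definition value_function ::
  "'w measure \<Rightarrow> (real \<Rightarrow> 'w \<Rightarrow> real) \<Rightarrow> real \<Rightarrow> real \<Rightarrow> real \<Rightarrow> real \<Rightarrow> real \<Rightarrow> ereal" where
  "value_function M \<xi> \<mu> \<sigma> a \<rho> y =
     (SUP \<tau> \<in> {\<tau>. stopping_time (completed_filtration M \<xi>) \<tau>}.
        ext_expectation (completion M) (\<lambda>\<omega>. reward \<xi> \<mu> \<sigma> a \<rho> y (\<tau> \<omega>) \<omega>))"

(* The u in [0, infinity] for which the set of y >= 0 with g y = y - a is
   [u, infinity); it is infinity if that set is empty. *)
definition stopping_threshold :: "(real \<Rightarrow> ereal) \<Rightarrow> real \<Rightarrow> ereal" where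
  "stopping_threshold g a =
     (THE u. 0 \<le> u \<and> {y. 0 \<le> y \<and> g y = ereal (y - a)} = {y. 0 \<le> y \<and> u \<le> ereal y})"

end

theory Submission
  imports Defs
begin

text \<open>Since \<mu> > \<sigma>, the price only increases, and since \<rho> \<le> \<mu> + \<sigma>, stopping in state 1 never pays. In
  state -1 the problem is therefore monotone: it is optimal to stop as soon as the generator applied
  to the payoff is nonpositive, and \<open>u\<^sub>-\<close> is the zero of that affine function of the price. The
  resulting candidate \<open>v\<close> solves the generator equation below \<open>u\<^sub>-\<close> with smooth fit in state -1, so that
  \<open>Lv = 0\<close> except in state -1 above \<open>u\<^sub>-\<close>, where \<open>Lv < 0\<close>.

  Verification avoids stochastic calculus. Conditioning once over a short time \<open>h\<close>, the discounted
  process \<open>Z\<close> of \<open>v\<close> satisfies \<open>E (1\<^sub>A (Z (r + h) - Z r)) = h E (1\<^sub>A e\<^bsup>-\<rho>r\<^esup> Lv) + o(h)\<close>, uniformly in \<open>r \<le> T\<close>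
  and in events \<open>A\<close> of the past of \<open>r\<close>. Summing along a grid bounds the value of every discretised
  stopping time up to \<open>o(1)\<close>. Fatou's lemma then gives \<open>g \<le> v\<close>, and the first grid point at which
  the chain is in state -1 with price at least \<open>u\<^sub>-\<close> gives \<open>g \<ge> v\<close>, because the discounted \<open>v\<close> tends to 0
  in mean by the lower bound on \<rho>.\<close>

section \<open>Integrals of right-continuous paths\<close>

text \<open>The lower bound on \<rho> is the growth rate of the mean price: \<mu> - lam + sqrt
  (\<sigma>^2 + lam^2) is the larger eigenvalue of the matrix with diagonal entries \<mu> - \<sigma>
  - lam, \<mu> + \<sigma> - lam and off-diagonal entries lam. A rate strictly in between leaves room
  for exponential decay. The affine branch in the up state is the mean reward of waiting for the
  next switch and stopping there: for T exponential of rate lam, b is the mean of exp ((\<mu> +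
  \<sigma> - \<rho>) T) and lam / (lam + \<rho>) that of exp (- \<rho> T). The quotient N / D has
  another origin: value and slope in the down state fix the coefficients, and continuity in the up
  state then determines the threshold. Both descriptions have to be reconciled. Smooth fit in the up
  state follows from the equation there. The obstacle in one time step is that the Markov property
  speaks of the state at one later time, while the price depends on the path in between. The price
  is therefore replaced by its jump-free continuation; the mean error is O(h^2) per step and O(h)
  over a bounded horizon.\<close>

lemma step_function_has_integral:
  fixes x :: "real \<Rightarrow> real" and d r :: real
  assumes "d > 0"
  shows "((\<lambda>u. x (r + d * \<lceil>(u - r) / d\<rceil>)) has_integral (\<Sum>i<K. d * x (r + d * real (Suc i)))) {r..r + d * real K}"
proof (induction K)
  case 0
  show ?case using has_integral_refl(2) by simp
next
  case (Suc K)
  let ?a = "r + d * real K" and ?b = "r + d * real (Suc K)"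
  have ab: "?a \<le> ?b" using assms by simp
  have const: "((\<lambda>u. x ?b) has_integral (d * x ?b)) {?a..?b}"
    using has_integral_const_real[of "x ?b" ?a ?b] ab by (simp add: algebra_simps)
  \<comment> \<open>At \<open>?a\<close> the ceiling is still \<open>K\<close>, so the step function
    may differ from the constant at this single point.\<close>
  have "((\<lambda>u. x (r + d * \<lceil>(u - r) / d\<rceil>)) has_integral (d * x ?b)) {?a..?b}"
  proof (rule has_integral_spike_finite[OF _ _ const, of "{?a}"])
    fix u assume u: "u \<in> {?a..?b} - {?a}"
    have "\<lceil>(u - r) / d\<rceil> = int (Suc K)"
      using u assms by (intro ceiling_unique) (auto simp: field_simps)
    then show "x (r + d * \<lceil>(u - r) / d\<rceil>) = x ?b" by simp
  qed simp
  from has_integral_combine[OF _ _ Suc this] ab assms show ?case by simp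
qed

text \<open>Sampling at the right end of each cell makes right continuity suffice: the sampled point
  tends to the given time from above, and \<open>B\<close> permits dominated convergence. Path
  integrals become limits of finite sums of chain values.\<close>

lemma right_continuous_riemann_sum:
  fixes x :: "real \<Rightarrow> real"
  assumes "h \<ge> 0" and bd: "\<And>t. r \<le> t \<Longrightarrow> \<bar>x t\<bar> \<le> B"
    and rc: "\<And>t. r \<le> t \<Longrightarrow> continuous (at_right t) x"
  shows "x integrable_on {r..r + h}"
    and "(\<lambda>n. \<Sum>i<Suc n. h / real (Suc n) * x (r + h / real (Suc n) * real (Suc i)))
           \<longlonglongrightarrow> integral {r..r + h} x"
proof -
  have *: "x integrable_on {r..r + h} \<and> (\<lambda>n. \<Sum>i<Suc n. h / real (Suc n) * x (r + h / real (Suc n) * real (Suc i)))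
           \<longlonglongrightarrow> integral {r..r + h} x"
  proof (cases "h = 0")
    case True
    then show ?thesis using has_integral_refl(2)[of x r] by (auto simp: integrable_on_def)
  next
    case False
    with assms(1) have h: "h > 0" by simp
    define d where "d n = h / real (Suc n)" for n
    have d: "d n > 0" "d n * real (Suc n) = h" for n using h by (auto simp: d_def)
    define f where "f n u = x (r + d n * \<lceil>(u - r) / d n\<rceil>)" for n u
    have int: "(f n has_integral (\<Sum>i<Suc n. d n * x (r + d n * real (Suc i)))) {r..r+h}" for n
      using step_function_has_integral[OF d(1)[of n], of x r "Suc n"] unfolding d f_def .
    have up: "u \<le> r + d n * \<lceil>(u - r) / d n\<rceil>" for n u
    proof -
      have "(u - r) / d n \<le> \<lceil>(u - r) / d n\<rceil>" by simp
      from mult_left_mono[OF this, of "d n"] show ?thesis using d(1)[of n] by simp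
    qed
    have lo: "r + d n * \<lceil>(u - r) / d n\<rceil> \<le> u + d n" for n u
    proof -
      have "\<lceil>(u - r) / d n\<rceil> \<le> (u - r) / d n + 1" by linarith
      from mult_left_mono[OF this, of "d n"] show ?thesis using d(1)[of n] by (simp add: distrib_left)
    qed
    have d0: "d \<longlonglongrightarrow> 0" unfolding d_def[abs_def] using LIMSEQ_Suc[OF lim_const_over_n[of h]] .
    have le: "norm (f k u) \<le> B" if "u \<in> {r..r+h}" for k u
      unfolding f_def real_norm_def using that order_trans[OF _ up[of u k], of r] by (intro bd) simp
    have conv: "(\<lambda>k. f k u) \<longlonglongrightarrow> x u" if u: "u \<in> {r..r+h}" for u
    proof -
      have "(\<lambda>k. u + d k) \<longlonglongrightarrow> u + 0" by (intro tendsto_intros d0)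
      then have "(\<lambda>k. u + d k) \<longlonglongrightarrow> u" by simp
      from real_tendsto_sandwich[OF always_eventually[OF allI[OF up]] always_eventually[OF allI[OF lo]] tendsto_const this]
      have lim: "(\<lambda>k. r + d k * \<lceil>(u - r) / d k\<rceil>) \<longlonglongrightarrow> u" .
      have "continuous (at u within {u..}) x"
        using rc[of u] u by (simp add: continuous_within at_within_Ici_at_right)
      then show ?thesis unfolding f_def
        by (rule continuous_within_tendsto_compose') (simp_all only: atLeast_iff up lim)
    qed
    have int': "f n integrable_on {r..r+h}" for n
      using int by (rule has_integral_integrable)
    have cint: "(\<lambda>_. B) integrable_on {r..r+h}" by (rule integrable_const_ivl)
    have "x integrable_on {r..r+h}"
      by (rule dominated_convergence(1)[where f=f and h="\<lambda>_. B"]) (fact int' cint le conv)+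
    moreover have "(\<lambda>n. integral {r..r+h} (f n)) \<longlonglongrightarrow> integral {r..r+h} x"
      by (rule dominated_convergence(2)[where f=f and h="\<lambda>_. B"]) (fact int' cint le conv)+
    ultimately show ?thesis unfolding integral_unique[OF int] d_def by (rule conjI)
  qed
  show "x integrable_on {r..r + h}"
    and "(\<lambda>n. \<Sum>i<Suc n. h / real (Suc n) * x (r + h / real (Suc n) * real (Suc i)))
           \<longlonglongrightarrow> integral {r..r + h} x"
    using * by auto
qed

section \<open>The two-state chain\<close>

text \<open>The transition function, which \<open>markov_chain\<close> only asserts to exist,
  becomes a parameter; its row sums survive as the bound \<open>p t i j \<le> 1\<close>.\<close>

locale telegraph = prob_space M for M :: "'w measure" +
  fixes \<xi> :: "real \<Rightarrow> 'w \<Rightarrow> real" and lam s :: real and p :: "real \<Rightarrow> real \<Rightarrow> real \<Rightarrow> real"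
  assumes lam_pos: "lam > 0"
    and xi_meas: "t \<ge> 0 \<Longrightarrow> \<xi> t \<in> measurable M (count_space {-1, 1})"
    and rcont: "\<omega> \<in> space M \<Longrightarrow> t \<ge> 0 \<Longrightarrow> continuous (at_right t) (\<lambda>t. \<xi> t \<omega>)"
    and init: "AE \<omega> in M. \<xi> 0 \<omega> = s"
    and p_bounds: "t \<ge> 0 \<Longrightarrow> i \<in> {-1, 1} \<Longrightarrow> j \<in> {-1, 1} \<Longrightarrow> 0 \<le> p t i j \<and> p t i j \<le> 1"
    and p_0: "i \<in> {-1, 1} \<Longrightarrow> j \<in> {-1, 1} \<Longrightarrow> p 0 i j = (if i = j then 1 else 0)"
    and p_deriv: "i \<in> {-1, 1} \<Longrightarrow> j \<in> {-1, 1} \<Longrightarrow>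
          ((\<lambda>t. p t i j) has_real_derivative flip_generator lam i j) (at_right 0)"
    and markov: "t \<ge> 0 \<Longrightarrow> h \<ge> 0 \<Longrightarrow> j \<in> {-1, 1} \<Longrightarrow> AE \<omega> in M.
           real_cond_exp M (natural_filtration M \<xi> (ennreal t))
             (indicator {\<omega> \<in> space M. \<xi> (t + h) \<omega> = j}) \<omega> = p h (\<xi> t \<omega>) j"

lemma markov_chain_telegraph:
  assumes "lam > 0" and mc: "markov_chain {-1, 1} (flip_generator lam) s M \<xi>"
  shows "\<exists>p. telegraph M \<xi> lam s p"
proof -
  obtain p where p: "transition_semigroup {-1,1} p" "has_generator {-1,1} p (flip_generator lam)"
    "\<forall>t\<ge>0. \<forall>h\<ge>0. \<forall>j\<in>{-1,1}. AE \<omega> in M.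
           real_cond_exp M (natural_filtration M \<xi> (ennreal t))
             (indicator {\<omega> \<in> space M. \<xi> (t + h) \<omega> = j}) \<omega> = p h (\<xi> t \<omega>) j"
    using mc unfolding markov_chain_def by blast
  have le1: "0 \<le> p t i j \<and> p t i j \<le> 1" if t: "t \<ge> 0" and i: "i \<in> {-1,1}" and j: "j \<in> {-1,1}" for t i j
  proof -
    have "\<forall>j\<in>{-1,1}. 0 \<le> p t i j" "(\<Sum>j\<in>{-1,1}. p t i j) = 1"
      using p(1) t i unfolding transition_semigroup_def by blast+
    then have "0 \<le> p t i (-1)" "0 \<le> p t i 1" "p t i (-1) + p t i 1 = 1" by simp_all
    moreover have "j = -1 \<or> j = 1" using j by blast
    ultimately show ?thesis by (metis add_increasing add_increasing2 order_refl)
  qed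
  have "telegraph_axioms M \<xi> lam s p"
    unfolding telegraph_axioms_def
  proof (intro conjI allI impI)
    show "lam > 0" by (rule assms(1))
  next
    fix t :: real assume "t \<ge> 0"
    then show "\<xi> t \<in> M \<rightarrow>\<^sub>M count_space {-1, 1}"
      using mc unfolding markov_chain_def by blast
  next
    fix \<omega> and t :: real assume "\<omega> \<in> space M" "t \<ge> 0"
    then show "continuous (at_right t) (\<lambda>t. \<xi> t \<omega>)"
      using mc unfolding markov_chain_def piecewise_constant_path_def by blast
  next
    show "AE \<omega> in M. \<xi> 0 \<omega> = s"
      using mc unfolding markov_chain_def by blast
  next
    fix t i j :: real assume *: "t \<ge> 0" "i \<in> {-1,1}" "j \<in> {-1,1}"
    show "0 \<le> p t i j" "p t i j \<le> 1" using le1[OF *] by blast+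
  next
    fix i j :: real assume ij: "i \<in> {-1,1}" "j \<in> {-1,1}"
    show "p 0 i j = (if i = j then 1 else 0)"
      using p(1) ij unfolding transition_semigroup_def by blast
    show "((\<lambda>t. p t i j) has_real_derivative flip_generator lam i j) (at_right 0)"
      using p(2) ij unfolding has_generator_def by blast
  next
    fix t h j :: real assume "t \<ge> 0" "h \<ge> 0" "j \<in> {-1,1}"
    then show "AE \<omega> in M. real_cond_exp M (natural_filtration M \<xi> (ennreal t))
             (indicator {\<omega> \<in> space M. \<xi> (t + h) \<omega> = j}) \<omega> = p h (\<xi> t \<omega>) j"
      using p(3) by blast
  qed
  moreover have "prob_space M" using mc unfolding markov_chain_def by blast
  ultimately have "telegraph M \<xi> lam s p" by (intro telegraph.intro)
  then show ?thesis by blast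
qed

context telegraph
begin

lemma xi_state: "\<omega> \<in> space M \<Longrightarrow> t \<ge> 0 \<Longrightarrow> \<xi> t \<omega> \<in> {-1, 1}"
  using measurable_space[OF xi_meas] by auto

lemma xi_abs: "\<omega> \<in> space M \<Longrightarrow> t \<ge> 0 \<Longrightarrow> \<bar>\<xi> t \<omega>\<bar> \<le> 1"
  using xi_state by fastforce

lemma xi_borel: "t \<ge> 0 \<Longrightarrow> \<xi> t \<in> borel_measurable M"
  by (rule measurable_compose[OF xi_meas, of t "\<lambda>x. x" borel, simplified]) auto

abbreviation "F t \<equiv> natural_filtration M \<xi> (ennreal t)"

lemma past_events_sets: "past_events M \<xi> t \<subseteq> sets M"
  using xi_borel unfolding past_events_def by (auto intro!: measurable_sets)

lemma space_F [simp]: "space (natural_filtration M \<xi> t) = space M"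
  unfolding natural_filtration_def using past_events_sets sets.space_closed
  by (intro space_measure_of) blast

lemma sets_F: "sets (natural_filtration M \<xi> t) = sigma_sets (space M) (past_events M \<xi> t)"
  unfolding natural_filtration_def using past_events_sets sets.space_closed
  by (intro sets_measure_of) blast

lemma subalgebra_F: "subalgebra M (natural_filtration M \<xi> t)"
  unfolding subalgebra_def using sets.sigma_sets_subset[OF past_events_sets]
  by (simp add: sets_F)

lemma xi_F: assumes "0 \<le> u" "u \<le> t" shows "\<xi> u \<in> borel_measurable (F t)"
  unfolding measurable_def using assms
  by (auto simp: sets_F past_events_def intro!: sigma_sets.Basic exI[of _ u])

lemma xi_integrable: "\<omega> \<in> space M \<Longrightarrow> 0 \<le> r \<Longrightarrow> 0 \<le> h \<Longrightarrow> (\<lambda>u. \<xi> u \<omega>) integrable_on {r..r+h}"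
  by (rule right_continuous_riemann_sum(1)[where B=1]) (simp_all only: xi_abs rcont order_trans)

lemma xi_riemann: "\<omega> \<in> space M \<Longrightarrow> 0 \<le> r \<Longrightarrow> 0 \<le> h \<Longrightarrow>
   (\<lambda>n. \<Sum>i<Suc n. h / real (Suc n) * \<xi> (r + h / real (Suc n) * real (Suc i)) \<omega>)
           \<longlonglongrightarrow> integral {r..r + h} (\<lambda>u. \<xi> u \<omega>)"
  by (rule right_continuous_riemann_sum(2)[where B=1]) (simp_all only: xi_abs rcont order_trans)

text \<open>A limit of finite sums of chain values at times in \<open>{r..r + h}\<close>, each of
  which belongs to the past of \<open>r + h\<close>.\<close>

lemma integral_xi_F:
  assumes "0 \<le> r" "0 \<le> h"
  shows "(\<lambda>\<omega>. integral {r..r + h} (\<lambda>u. \<xi> u \<omega>)) \<in> borel_measurable (F (r + h))"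
proof (rule borel_measurable_LIMSEQ_real)
  fix \<omega> assume "\<omega> \<in> space (F (r + h))"
  then show "(\<lambda>n. \<Sum>i<Suc n. h / real (Suc n) * \<xi> (r + h / real (Suc n) * real (Suc i)) \<omega>)
           \<longlonglongrightarrow> integral {r..r + h} (\<lambda>u. \<xi> u \<omega>)"
    using assms by (intro xi_riemann) auto
next
  fix n
  show "(\<lambda>\<omega>. \<Sum>i<Suc n. h / real (Suc n) * \<xi> (r + h / real (Suc n) * real (Suc i)) \<omega>)
     \<in> borel_measurable (F (r + h))"
  proof (intro borel_measurable_sum borel_measurable_times borel_measurable_const xi_F)
    fix i assume "i \<in> {..<Suc n}"
    then have "h * real (Suc i) \<le> h * real (Suc n)" using assms by (intro mult_left_mono) auto
    then show "r + h / real (Suc n) * real (Suc i) \<le> r + h" by (simp add: field_simps)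
  qed (use assms in auto)
qed

lemma integral_xi_abs:
  assumes "\<omega> \<in> space M" "0 \<le> r" "0 \<le> h"
  shows "\<bar>integral {r..r + h} (\<lambda>u. \<xi> u \<omega>)\<bar> \<le> h"
  proof -
  have "norm (integral {r..r + h} (\<lambda>u. \<xi> u \<omega>)) \<le> 1 * measure lborel (cbox r (r + h))"
    using integrable_integral[OF xi_integrable[OF assms]] xi_abs assms
    by (intro has_integral_bound[where f="\<lambda>u. \<xi> u \<omega>"]) auto
  then show ?thesis using assms by simp
qed

text \<open>The only use of the Markov property.\<close>
lemma markov_expectation:
  assumes t: "0 \<le> t" and h: "0 \<le> h" and j: "j \<in> {-1, 1}"
    and f: "f \<in> borel_measurable (F t)" and bd: "\<And>\<omega>. \<omega> \<in> space M \<Longrightarrow> \<bar>f \<omega>\<bar> \<le> B"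
  shows "(\<integral>\<omega>. f \<omega> * indicator {\<omega> \<in> space M. \<xi> (t + h) \<omega> = j} \<omega> \<partial>M) = (\<integral>\<omega>. f \<omega> * p h (\<xi> t \<omega>) j \<partial>M)"
proof -
  interpret fs: finite_measure_subalgebra M "F t"
    by standard (rule subalgebra_F)
  have [measurable]: "\<xi> (t + h) \<in> borel_measurable M" using t h by (intro xi_borel) auto
  have [measurable]: "f \<in> borel_measurable M" by (rule measurable_from_subalg[OF subalgebra_F f])
  have S: "{\<omega> \<in> space M. \<xi> (t + h) \<omega> = j} \<in> sets M" by measurable
  have B: "0 \<le> B" using bd order_trans[OF abs_ge_zero] not_empty by blast
  have int: "integrable M (\<lambda>\<omega>. f \<omega> * indicator {\<omega> \<in> space M. \<xi> (t + h) \<omega> = j} \<omega>)"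
    using S B by (intro integrable_const_bound[where B=B]) (auto simp: indicator_def bd)
  have "(\<lambda>\<omega>. p h (\<xi> t \<omega>) j) \<in> borel_measurable M"
    by (rule measurable_compose[OF xi_meas[OF t]]) auto
  moreover have "AE \<omega> in M. f \<omega> * real_cond_exp M (F t) (indicator {\<omega> \<in> space M. \<xi> (t + h) \<omega> = j}) \<omega> = f \<omega> * p h (\<xi> t \<omega>) j"
    using markov[OF t h j] by auto
  ultimately have "(\<integral>\<omega>. f \<omega> * real_cond_exp M (F t) (indicator {\<omega> \<in> space M. \<xi> (t + h) \<omega> = j}) \<omega> \<partial>M) = (\<integral>\<omega>. f \<omega> * p h (\<xi> t \<omega>) j \<partial>M)"
    by (intro integral_cong_AE) auto
  then show ?thesis using fs.real_cond_exp_intg(2)[OF int f] S by simp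
qed

end

text \<open>From \<open>1 + z \<le> exp z\<close>. It converts an error in the exponent of the price
  into a relative error of the price.\<close>

lemma abs_exp_diff_le: "\<bar>exp a - exp b\<bar> \<le> exp c * \<bar>a - b\<bar>" if "a \<le> c" "b \<le> c" for a b c :: real
proof -
  have *: "exp x - exp y \<le> exp x * (x - y)" for x y :: real
    using mult_left_mono[OF exp_ge_add_one_self[of "y - x"], of "exp x"] by (simp add: exp_diff algebra_simps)
  show ?thesis
  proof (cases "b \<le> a")
    case True
    then have "\<bar>exp a - exp b\<bar> \<le> exp a * (a - b)" using *[of a b] by simp
    also have "\<dots> \<le> exp c * (a - b)" using True that by (intro mult_right_mono) auto
    finally show ?thesis using True by simp
  next
    case False
    then have "\<bar>exp a - exp b\<bar> \<le> exp b * (b - a)" using *[of b a] by simp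
    also have "\<dots> \<le> exp c * (b - a)" using False that by (intro mult_right_mono) auto
    finally show ?thesis using False by simp
  qed
qed

context telegraph
begin

text \<open>Only the states at the two times matter, so repeated flips in between do no harm: the
  difference is 2 on the two events of opposite states and 0 elsewhere, and conditioning on the past
  of \<open>r\<close> bounds each event by a transition probability. The bound does not depend on
  \<open>r\<close>.\<close>

lemma expected_switch:
  assumes r: "0 \<le> r" and u: "0 \<le> u"
  shows "(\<integral>\<omega>. \<bar>\<xi> (r + u) \<omega> - \<xi> r \<omega>\<bar> \<partial>M) \<le> 2 * (p u (-1) 1 + p u 1 (-1))"
proof -
  define I where "I t i = (indicator {\<omega> \<in> space M. \<xi> t \<omega> = i} :: _ \<Rightarrow> real)" for t i
  have [measurable]: "\<xi> r \<in> borel_measurable (F r)" "\<xi> r \<in> borel_measurable M" "\<xi> (r + u) \<in> borel_measurable M"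
    using r u by (auto intro: xi_F xi_borel)
  have IF: "I r i \<in> borel_measurable (F r)" for i
    unfolding I_def space_F[of "ennreal r", symmetric] by measurable
  have IM[measurable]: "I r i \<in> borel_measurable M" "I (r + u) i \<in> borel_measurable M" for i
    unfolding I_def by measurable
  have int: "integrable M (\<lambda>\<omega>. I r i \<omega> * I (r + u) j \<omega>)" for i j
    by (rule integrable_const_bound[where B=1]) (auto simp: I_def indicator_def)
  have bound: "(\<integral>\<omega>. I r i \<omega> * I (r + u) j \<omega> \<partial>M) \<le> p u i j" if i: "i \<in> {-1,1}" and j: "j \<in> {-1,1}" for i j
  proof -
    have pb: "0 \<le> p u i j" using p_bounds[OF u i j] by blast
    have "(\<integral>\<omega>. I r i \<omega> * I (r + u) j \<omega> \<partial>M) = (\<integral>\<omega>. I r i \<omega> * p u (\<xi> r \<omega>) j \<partial>M)"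
      using markov_expectation[OF r u j IF, of i 1] unfolding I_def by (simp add: indicator_def)
    also have "\<dots> = (\<integral>\<omega>. I r i \<omega> * p u i j \<partial>M)"
      by (rule Bochner_Integration.integral_cong) (auto simp: I_def indicator_def)
    also have "\<dots> \<le> (\<integral>\<omega>. p u i j \<partial>M)"
      using pb by (intro integral_mono integrable_const integrable_const_bound[where B="p u i j"])
        (auto simp: I_def indicator_def)
    finally show ?thesis by (simp add: prob_space)
  qed
  have "(\<integral>\<omega>. \<bar>\<xi> (r + u) \<omega> - \<xi> r \<omega>\<bar> \<partial>M) =
        (\<integral>\<omega>. 2 * (I r (-1) \<omega> * I (r + u) 1 \<omega>) + 2 * (I r 1 \<omega> * I (r + u) (-1) \<omega>) \<partial>M)"
  proof (rule Bochner_Integration.integral_cong)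
    fix \<omega> assume \<omega>: "\<omega> \<in> space M"
    have "\<xi> (r + u) \<omega> = -1 \<or> \<xi> (r + u) \<omega> = 1" "\<xi> r \<omega> = -1 \<or> \<xi> r \<omega> = 1"
      using xi_state[OF \<omega>, of "r + u"] xi_state[OF \<omega>, of r] r u by simp_all
    then show "\<bar>\<xi> (r + u) \<omega> - \<xi> r \<omega>\<bar> = 2 * (I r (-1) \<omega> * I (r + u) 1 \<omega>) + 2 * (I r 1 \<omega> * I (r + u) (-1) \<omega>)"
      using \<omega> by (auto simp: I_def)
  qed simp
  also have "\<dots> = 2 * (\<integral>\<omega>. I r (-1) \<omega> * I (r + u) 1 \<omega> \<partial>M) + 2 * (\<integral>\<omega>. I r 1 \<omega> * I (r + u) (-1) \<omega> \<partial>M)"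
    using int by simp
  also have "\<dots> \<le> 2 * p u (-1) 1 + 2 * p u 1 (-1)"
    using bound[of "-1" 1] bound[of 1 "-1"] by simp
  finally show ?thesis by simp
qed

text \<open>The sum has right derivative \<open>2 * lam\<close> at 0; the larger rate
  \<open>4 * lam\<close> leaves the slack needed for a bound valid on an interval.\<close>

lemma switch_rate:
  "\<exists>h0>0. \<forall>u. 0 \<le> u \<and> u < h0 \<longrightarrow> p u (-1) 1 + p u 1 (-1) \<le> 4 * lam * u"
proof -
  have "((\<lambda>t. p t (-1) 1 + p t 1 (-1)) has_real_derivative lam + lam) (at_right 0)"
    using DERIV_add[OF p_deriv[of "-1" 1] p_deriv[of 1 "-1"]] by (simp add: flip_generator_def)
  then have "((\<lambda>t. (p t (-1) 1 + p t 1 (-1)) / t) \<longlongrightarrow> 2 * lam) (at_right 0)"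
    unfolding has_field_derivative_iff using p_0[of "-1" 1] p_0[of 1 "-1"] by simp
  then have "\<forall>\<^sub>F t in at_right 0. (p t (-1) 1 + p t 1 (-1)) / t < 4 * lam"
    using lam_pos by (intro order_tendstoD) auto
  then obtain h0 where h0: "h0 > 0" "\<And>t. 0 < t \<Longrightarrow> t < h0 \<Longrightarrow> (p t (-1) 1 + p t 1 (-1)) / t < 4 * lam"
    unfolding eventually_at_right_field by auto
  have "p u (-1) 1 + p u 1 (-1) \<le> 4 * lam * u" if "0 \<le> u" "u < h0" for u
  proof (cases "u = 0")
    case True then show ?thesis using p_0[of "-1" 1] p_0[of 1 "-1"] by simp
  next
    case False
    with that h0(2)[of u] show ?thesis by (simp add: field_simps)
  qed
  with h0(1) show ?thesis by blast
qed

text \<open>At any time within the step the mean displacement is at most \<open>8 * lam * h\<close>;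
  averaging over a step of length \<open>h\<close> gives the order \<open>h\<^sup>2\<close>, which
  makes the effect of a switch on the price negligible. Riemann sums do the averaging, so that joint
  measurability in time and outcome never enters.\<close>

lemma expected_integral_deviation:
  "\<exists>h0>0. \<forall>h r. 0 \<le> h \<and> h < h0 \<and> 0 \<le> r \<longrightarrow>
     (\<integral>\<omega>. \<bar>integral {r..r + h} (\<lambda>u. \<xi> u \<omega>) - h * \<xi> r \<omega>\<bar> \<partial>M) \<le> 8 * lam * h\<^sup>2"
proof -
  obtain h0 where h0: "h0 > 0" "\<And>u. 0 \<le> u \<Longrightarrow> u < h0 \<Longrightarrow> p u (-1) 1 + p u 1 (-1) \<le> 4 * lam * u"
    using switch_rate by blast
  have "(\<integral>\<omega>. \<bar>integral {r..r + h} (\<lambda>u. \<xi> u \<omega>) - h * \<xi> r \<omega>\<bar> \<partial>M) \<le> 8 * lam * h\<^sup>2"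
    if h: "0 \<le> h" "h < h0" and r: "0 \<le> r" for h r
  proof -
    define t where "t n i = h / real (Suc n) * real (Suc i)" for n i :: nat
    have t: "0 \<le> t n i" "t n i \<le> h" if "i < Suc n" for n i
    proof -
      show "0 \<le> t n i" using h by (simp add: t_def)
      have "h * real (Suc i) \<le> h * real (Suc n)" using h that by (intro mult_left_mono) auto
      then show "t n i \<le> h" by (simp add: t_def field_simps)
    qed
    define S where "S n \<omega> = (\<Sum>i<Suc n. h / real (Suc n) * \<xi> (r + t n i) \<omega>)" for n \<omega>
    have S: "(\<lambda>n. S n \<omega>) \<longlonglongrightarrow> integral {r..r + h} (\<lambda>u. \<xi> u \<omega>)" if "\<omega> \<in> space M" for \<omega>
      unfolding S_def t_def by (rule xi_riemann[OF that r h(1)])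
    have [measurable]: "\<xi> r \<in> borel_measurable M" using r by (rule xi_borel)
    have xm: "\<xi> (r + t n i) \<in> borel_measurable M" if "i < Suc n" for n i
      using t(1)[OF that] r by (intro xi_borel) auto
    have [measurable]: "S n \<in> borel_measurable M" for n
      unfolding S_def[abs_def] using xm by (intro borel_measurable_sum borel_measurable_times) auto
    have [measurable]: "(\<lambda>\<omega>. integral {r..r + h} (\<lambda>u. \<xi> u \<omega>)) \<in> borel_measurable M"
      by (rule measurable_from_subalg[OF subalgebra_F integral_xi_F[OF r h(1)]])
    have diff: "\<bar>S n \<omega> - h * \<xi> r \<omega>\<bar> \<le> (\<Sum>i<Suc n. h / real (Suc n) * \<bar>\<xi> (r + t n i) \<omega> - \<xi> r \<omega>\<bar>)" for n \<omega>
    proof -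
      have "h * \<xi> r \<omega> = (\<Sum>i<Suc n. h / real (Suc n) * \<xi> r \<omega>)" by simp
      then have "S n \<omega> - h * \<xi> r \<omega> = (\<Sum>i<Suc n. h / real (Suc n) * (\<xi> (r + t n i) \<omega> - \<xi> r \<omega>))"
        unfolding S_def by (simp only: right_diff_distrib sum_subtractf)
      also have "\<bar>\<dots>\<bar> \<le> (\<Sum>i<Suc n. \<bar>h / real (Suc n) * (\<xi> (r + t n i) \<omega> - \<xi> r \<omega>)\<bar>)" by (rule sum_abs)
      finally show ?thesis using h by (simp add: abs_mult)
    qed
    have xd: "\<bar>\<xi> (r + t n i) \<omega> - \<xi> r \<omega>\<bar> \<le> 2" if "i < Suc n" "\<omega> \<in> space M" for n i \<omega>
      using xi_abs[of \<omega> r] xi_abs[of \<omega> "r + t n i"] t(1)[OF that(1)] r that by linarith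
    have intd: "integrable M (\<lambda>\<omega>. \<bar>\<xi> (r + t n i) \<omega> - \<xi> r \<omega>\<bar>)" if "i < Suc n" for n i
      using xd[OF that] xm[OF that] by (intro integrable_const_bound[where B=2]) auto
    have sb: "\<bar>S n \<omega> - h * \<xi> r \<omega>\<bar> \<le> 2 * h" if "\<omega> \<in> space M" for n \<omega>
    proof -
      have "(\<Sum>i<Suc n. h / real (Suc n) * \<bar>\<xi> (r + t n i) \<omega> - \<xi> r \<omega>\<bar>) \<le> (\<Sum>i<Suc n. h / real (Suc n) * 2)"
        using h xd that by (intro sum_mono mult_left_mono) auto
      also have "\<dots> = 2 * h" by simp
      finally show ?thesis using diff[of n \<omega>] by linarith
    qed
    \<comment> \<open>The paths are bounded by 1, so \<open>2 * h\<close> dominates and the bound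
      for the Riemann sums passes to the integral.\<close>
    have lim: "(\<lambda>n. \<integral>\<omega>. \<bar>S n \<omega> - h * \<xi> r \<omega>\<bar> \<partial>M) \<longlonglongrightarrow> (\<integral>\<omega>. \<bar>integral {r..r + h} (\<lambda>u. \<xi> u \<omega>) - h * \<xi> r \<omega>\<bar> \<partial>M)"
    proof (rule integral_dominated_convergence[where w="\<lambda>_. 2 * h"])
      show "AE \<omega> in M. (\<lambda>n. \<bar>S n \<omega> - h * \<xi> r \<omega>\<bar>) \<longlonglongrightarrow> \<bar>integral {r..r + h} (\<lambda>u. \<xi> u \<omega>) - h * \<xi> r \<omega>\<bar>"
        using S by (intro AE_I2 tendsto_intros)
    qed (use sb in auto)
    have "(\<integral>\<omega>. \<bar>S n \<omega> - h * \<xi> r \<omega>\<bar> \<partial>M) \<le> 8 * lam * h\<^sup>2" for n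
    proof -
      have "(\<integral>\<omega>. \<bar>S n \<omega> - h * \<xi> r \<omega>\<bar> \<partial>M) \<le> (\<integral>\<omega>. (\<Sum>i<Suc n. h / real (Suc n) * \<bar>\<xi> (r + t n i) \<omega> - \<xi> r \<omega>\<bar>) \<partial>M)"
      proof (rule integral_mono)
        show "integrable M (\<lambda>\<omega>. \<bar>S n \<omega> - h * \<xi> r \<omega>\<bar>)"
          using sb by (intro integrable_const_bound[where B="2 * h"]) auto
        show "integrable M (\<lambda>\<omega>. \<Sum>i<Suc n. h / real (Suc n) * \<bar>\<xi> (r + t n i) \<omega> - \<xi> r \<omega>\<bar>)"
          using intd by (intro Bochner_Integration.integrable_sum integrable_mult_right) simp
      qed (rule diff)
      also have "\<dots> = (\<Sum>i<Suc n. h / real (Suc n) * (\<integral>\<omega>. \<bar>\<xi> (r + t n i) \<omega> - \<xi> r \<omega>\<bar> \<partial>M))"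
        using intd by (subst Bochner_Integration.integral_sum) auto
      also have "\<dots> \<le> (\<Sum>i<Suc n. h / real (Suc n) * (8 * lam * h))"
      proof (intro sum_mono mult_left_mono)
        fix i assume "i \<in> {..<Suc n}"
        then have i: "i < Suc n" by simp
        have "(\<integral>\<omega>. \<bar>\<xi> (r + t n i) \<omega> - \<xi> r \<omega>\<bar> \<partial>M) \<le> 2 * (4 * lam * t n i)"
          by (rule order_trans[OF expected_switch[OF r t(1)[OF i]] mult_left_mono[OF h0(2)[OF t(1)[OF i] le_less_trans[OF t(2)[OF i] h(2)]]]]) simp
        also have "\<dots> \<le> 2 * (4 * lam * h)" using t[OF i] lam_pos by simp
        finally show "(\<integral>\<omega>. \<bar>\<xi> (r + t n i) \<omega> - \<xi> r \<omega>\<bar> \<partial>M) \<le> 8 * lam * h" by simp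
      qed (use h in simp)
      also have "\<dots> = 8 * lam * h\<^sup>2" by (simp add: power2_eq_square)
      finally show ?thesis .
    qed
    then show ?thesis by (intro LIMSEQ_le_const2[OF lim]) blast
  qed
  with h0(1) show ?thesis by blast
qed

end

section \<open>Infinitesimal expansion\<close>

text \<open>The intended instance is \<^term>\<open>d i y = (\<mu> + \<sigma> * i) * y * deriv (v i) y\<close>, the derivative of
  \<^term>\<open>v i\<close> along the flow of state \<^term>\<open>i\<close>; its Lipschitz continuity replaces a second derivative
  of \<^term>\<open>v i\<close>, which may fail to exist at the stopping threshold.\<close>
definition flow_smooth :: "real \<Rightarrow> real \<Rightarrow> real \<Rightarrow> (real \<Rightarrow> real \<Rightarrow> real) \<Rightarrow> (real \<Rightarrow> real \<Rightarrow> real) \<Rightarrow> bool" where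
  "flow_smooth \<mu> \<sigma> L v d \<longleftrightarrow> 0 \<le> L \<and> (\<forall>i\<in>{-1,1}. v i 0 = 0 \<and> d i 0 = 0 \<and>
     (\<forall>x\<ge>0. \<forall>y\<ge>0. \<bar>v i x - v i y\<bar> \<le> L * \<bar>x - y\<bar> \<and> \<bar>d i x - d i y\<bar> \<le> L * \<bar>x - y\<bar>) \<and>
     (\<forall>y>0. (v i has_real_derivative d i y / ((\<mu> + \<sigma> * i) * y)) (at y)))"

lemma flow_smooth_abs:
  assumes "flow_smooth \<mu> \<sigma> L v d" "i \<in> {-1,1}" "0 \<le> w"
  shows "\<bar>v i w\<bar> \<le> L * w" "\<bar>d i w\<bar> \<le> L * w"
proof -
  have "\<bar>v i w - v i 0\<bar> \<le> L * \<bar>w - 0\<bar>" "\<bar>d i w - d i 0\<bar> \<le> L * \<bar>w - 0\<bar>" "v i 0 = 0" "d i 0 = 0"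
    using assms unfolding flow_smooth_def by blast+
  then show "\<bar>v i w\<bar> \<le> L * w" "\<bar>d i w\<bar> \<le> L * w" using assms(3) by simp_all
qed

lemma flow_smooth_lipschitz:
  assumes "flow_smooth \<mu> \<sigma> L v d" "i \<in> {-1,1}" "0 \<le> x" "0 \<le> y"
  shows "\<bar>v i x - v i y\<bar> \<le> L * \<bar>x - y\<bar>" "\<bar>d i x - d i y\<bar> \<le> L * \<bar>x - y\<bar>"
  using assms unfolding flow_smooth_def by blast+

text \<open>Along \<open>w * exp ((\<mu> + \<sigma> * i) * t)\<close> the chain rule cancels the
  denominator in \<open>flow_smooth\<close>, so the derivative of \<open>v i\<close> is exactly
  \<open>d i\<close>. The mean value theorem and the Lipschitz bound for \<open>d i\<close> then do
  the work of a second-order term.\<close>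

lemma flow_smooth_taylor:
  assumes fs: "flow_smooth \<mu> \<sigma> L v d" and i: "i \<in> {-1,1}" and w: "0 \<le> w" and h: "0 < h" and m: "0 < \<mu> + \<sigma> * i"
  shows "\<bar>v i (w * exp ((\<mu> + \<sigma> * i) * h)) - v i w - h * d i w\<bar> \<le> h * (L * w * (exp ((\<mu> + \<sigma> * i) * h) - 1))"
proof (cases "w = 0")
  case True
  then show ?thesis using fs i unfolding flow_smooth_def by auto
next
  case False
  with w have w: "0 < w" by simp
  let ?m = "\<mu> + \<sigma> * i"
  have D: "((\<lambda>t. v i (w * exp (?m * t))) has_real_derivative d i (w * exp (?m * t))) (at t)" for t
  proof -
    have "0 < w * exp (?m * t)" using w by simp
    then have "(v i has_real_derivative d i (w * exp (?m * t)) / (?m * (w * exp (?m * t)))) (at (w * exp (?m * t)))"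
      using fs i unfolding flow_smooth_def by blast
    moreover have "((\<lambda>t. w * exp (?m * t)) has_real_derivative ?m * (w * exp (?m * t))) (at t)"
      by (auto intro!: derivative_eq_intros)
    ultimately have "((\<lambda>t. v i (w * exp (?m * t))) has_real_derivative
        d i (w * exp (?m * t)) / (?m * (w * exp (?m * t))) * (?m * (w * exp (?m * t)))) (at t)"
      by (rule DERIV_chain2)
    then show ?thesis using m w by simp
  qed
  obtain t where t: "0 < t" "t < h" "v i (w * exp (?m * h)) - v i (w * exp (?m * 0)) = (h - 0) * d i (w * exp (?m * t))"
    using MVT2[OF h, of "\<lambda>t. v i (w * exp (?m * t))" "\<lambda>t. d i (w * exp (?m * t))"] D by auto
  have "\<bar>d i (w * exp (?m * t)) - d i w\<bar> \<le> L * \<bar>w * exp (?m * t) - w\<bar>"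
    using w by (intro flow_smooth_lipschitz(2)[OF fs i]) auto
  also have "w * exp (?m * t) - w = w * (exp (?m * t) - 1)" by (simp add: algebra_simps)
  also have "L * \<bar>w * (exp (?m * t) - 1)\<bar> = L * w * (exp (?m * t) - 1)"
    using m t w by (simp add: abs_mult)
  also have "\<dots> \<le> L * w * (exp (?m * h) - 1)"
    using m t w fs unfolding flow_smooth_def by (intro mult_left_mono) auto
  finally have "h * \<bar>d i (w * exp (?m * t)) - d i w\<bar> \<le> h * (L * w * (exp (?m * h) - 1))"
    using h by (intro mult_left_mono) auto
  moreover have "v i (w * exp (?m * h)) - v i w - h * d i w = h * (d i (w * exp (?m * t)) - d i w)"
    using t(3) by (simp add: algebra_simps)
  ultimately show ?thesis using h by (simp add: abs_mult)
qed

text \<open>The generator of the pair of price and chain, killed at rate \<open>\<rho>\<close>: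
  drift, switching, discounting. The drift term is passed as the argument \<open>d\<close>, so that
  no derivative operator appears.\<close>

definition generator :: "real \<Rightarrow> real \<Rightarrow> (real \<Rightarrow> real \<Rightarrow> real) \<Rightarrow> (real \<Rightarrow> real \<Rightarrow> real) \<Rightarrow> real \<Rightarrow> real \<Rightarrow> real" where
  "generator lam \<rho> v d i y = d i y + lam * (v (- i) y - v i y) - \<rho> * v i y"

context telegraph
begin

text \<open>The price follows the flow of the starting state for the whole step and only the final
  state is random. The discounted probabilities of staying and of switching are
  \<open>1 - (lam + \<rho>) * h\<close> and \<open>lam * h\<close> up to \<open>o(h)\<close>; linear
  growth of \<open>v\<close> and \<open>d\<close> controls everything else uniformly in
  \<open>w \<le> W\<close>.\<close>

lemma one_step_expansion_state:
  assumes fs: "flow_smooth \<mu> \<sigma> L v d" and i: "i \<in> {-1,1}" and m: "0 < \<mu> + \<sigma> * i"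
  shows "\<exists>\<epsilon>. (\<epsilon> \<longlongrightarrow> 0) (at_right 0) \<and> (\<forall>h>0. 0 \<le> \<epsilon> h \<and> (\<forall>w. 0 \<le> w \<and> w \<le> W \<longrightarrow>
     \<bar>exp (- \<rho> * h) * (\<Sum>j\<in>{-1,1}. p h i j * v j (w * exp ((\<mu> + \<sigma> * i) * h))) - v i w - h * generator lam \<rho> v d i w\<bar>
       \<le> h * \<epsilon> h))"
proof -
  let ?m = "\<mu> + \<sigma> * i"
  have L: "0 \<le> L" using fs unfolding flow_smooth_def by blast
  have i': "- i \<in> {-1,1}" "- i \<noteq> i" using i by auto
  define E where "E h = exp (- \<rho> * h) * p h i i" for h
  define G where "G h = exp (- \<rho> * h) * p h i (-i)" for h
  define k where "k h = exp (?m * h) - 1" for h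
  \<comment> \<open>The summands match the decomposition of the error divided by \<open>h\<close>:
    the coefficients of \<open>v i w\<close>, \<open>d i w\<close> and \<open>v (- i) w\<close>,
    then the flow remainders \<open>r1\<close> and \<open>r2\<close>. The absolute value keeps this
    nonnegative when \<open>W\<close> is negative.\<close>
  define \<epsilon> where "\<epsilon> h = L * \<bar>W\<bar> * (\<bar>(E h - 1) / h + lam + \<rho>\<bar> + \<bar>E h - 1\<bar> + \<bar>G h / h - lam\<bar> + k h * (\<bar>E h\<bar> + \<bar>G h / h\<bar>))" for h
  have dexp: "((\<lambda>h. exp (- \<rho> * h)) has_real_derivative - \<rho>) (at_right 0)"
    by (auto intro!: derivative_eq_intros)
  have "(E has_real_derivative exp (- \<rho> * 0) * (- lam) + (- \<rho>) * p 0 i i) (at_right 0)"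
    unfolding E_def[abs_def] using DERIV_mult'[OF dexp p_deriv[OF i i]] by (simp add: flip_generator_def)
  then have dE: "(E has_real_derivative - lam - \<rho>) (at_right 0)" using p_0[OF i i] by simp
  have "(G has_real_derivative exp (- \<rho> * 0) * lam + (- \<rho>) * p 0 i (-i)) (at_right 0)"
    unfolding G_def[abs_def] using DERIV_mult'[OF dexp p_deriv[OF i i'(1)]] i' by (simp add: flip_generator_def)
  then have dG: "(G has_real_derivative lam) (at_right 0)" using p_0[OF i i'(1)] i' by simp
  have E0: "E 0 = 1" "G 0 = 0" using p_0[OF i i] p_0[OF i i'(1)] i' by (auto simp: E_def G_def)
  have l1: "((\<lambda>h. (E h - 1) / h) \<longlongrightarrow> - lam - \<rho>) (at_right 0)"
    using dE E0 by (simp add: has_field_derivative_iff)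
  have l2: "((\<lambda>h. G h / h) \<longlongrightarrow> lam) (at_right 0)"
    using dG E0 by (simp add: has_field_derivative_iff)
  have l3: "(E \<longlongrightarrow> 1) (at_right 0)"
    using DERIV_continuous[OF dE] E0 by (simp add: continuous_within)
  have l4: "(k \<longlongrightarrow> exp (?m * 0) - 1) (at_right 0)"
    unfolding k_def[abs_def] by (intro tendsto_intros)
  have "(\<epsilon> \<longlongrightarrow> L * \<bar>W\<bar> * (\<bar>(- lam - \<rho>) + lam + \<rho>\<bar> + \<bar>1 - 1\<bar> + \<bar>lam - lam\<bar> + (exp (?m * 0) - 1) * (\<bar>1\<bar> + \<bar>lam\<bar>))) (at_right 0)"
    unfolding \<epsilon>_def[abs_def] by (intro tendsto_intros l1 l2 l3 l4)
  then have lim: "(\<epsilon> \<longlongrightarrow> 0) (at_right 0)" by simp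
  have "0 \<le> \<epsilon> h" if "h > 0" for h
    using L that m unfolding \<epsilon>_def k_def by (intro mult_nonneg_nonneg add_nonneg_nonneg) auto
  moreover have "\<bar>exp (- \<rho> * h) * (\<Sum>j\<in>{-1,1}. p h i j * v j (w * exp (?m * h))) - v i w - h * generator lam \<rho> v d i w\<bar> \<le> h * \<epsilon> h"
    if h: "h > 0" and w: "0 \<le> w" "w \<le> W" for h w
  proof -
    define r1 where "r1 = (v i (w * exp (?m * h)) - v i w - h * d i w) / h"
    define r2 where "r2 = v (-i) (w * exp (?m * h)) - v (-i) w"
    have LW: "L * w \<le> L * \<bar>W\<bar>" using L w by (intro mult_left_mono) auto
    have k: "0 \<le> k h" using h m by (simp add: k_def)
    have Lk: "L * w * k h \<le> L * \<bar>W\<bar> * k h" using LW k by (rule mult_right_mono)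
    have "\<bar>r1\<bar> \<le> L * w * k h"
      using flow_smooth_taylor[OF fs i w(1) h m] h unfolding r1_def k_def by (simp add: divide_simps mult.commute)
    then have r1: "\<bar>r1\<bar> \<le> L * \<bar>W\<bar> * k h" using Lk by linarith
    have "\<bar>r2\<bar> \<le> L * \<bar>w * exp (?m * h) - w\<bar>"
      unfolding r2_def using w by (intro flow_smooth_lipschitz(1)[OF fs i'(1)]) auto
    also have "\<dots> = L * w * k h" using w k unfolding k_def by (simp add: algebra_simps abs_of_nonneg mult_le_cancel_left1)
    finally have r2: "\<bar>r2\<bar> \<le> L * \<bar>W\<bar> * k h" using Lk by linarith
    have V: "\<bar>v i w\<bar> \<le> L * \<bar>W\<bar>" "\<bar>d i w\<bar> \<le> L * \<bar>W\<bar>" "\<bar>v (-i) w\<bar> \<le> L * \<bar>W\<bar>"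
      using flow_smooth_abs[OF fs i w(1)] flow_smooth_abs(1)[OF fs i'(1) w(1)] LW by linarith+
    have vi: "v i (w * exp (?m * h)) = v i w + h * d i w + h * r1"
      using h by (simp add: r1_def)
    have vi': "v (-i) (w * exp (?m * h)) = v (-i) w + r2" by (simp add: r2_def)
    have sum: "(\<Sum>j\<in>{-1,1}. f j) = f i + f (-i)" for f :: "real \<Rightarrow> real"
      using i by auto
    have "exp (- \<rho> * h) * (\<Sum>j\<in>{-1,1}. p h i j * v j (w * exp (?m * h)))
          = E h * (v i w + h * d i w + h * r1) + G h * (v (-i) w + r2)"
      unfolding sum vi vi' E_def G_def by (simp add: algebra_simps)
    then have "exp (- \<rho> * h) * (\<Sum>j\<in>{-1,1}. p h i j * v j (w * exp (?m * h))) - v i w - h * generator lam \<rho> v d i w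
          = h * (((E h - 1) / h + lam + \<rho>) * v i w + (E h - 1) * d i w + (G h / h - lam) * v (-i) w
             + (E h * r1 + G h / h * r2))"
      using h unfolding generator_def by (simp add: field_simps)
    also have "\<bar>\<dots>\<bar> \<le> h * \<epsilon> h"
    proof -
      have "\<bar>((E h - 1) / h + lam + \<rho>) * v i w + (E h - 1) * d i w + (G h / h - lam) * v (-i) w + (E h * r1 + G h / h * r2)\<bar>
        \<le> \<bar>(E h - 1) / h + lam + \<rho>\<bar> * \<bar>v i w\<bar> + \<bar>E h - 1\<bar> * \<bar>d i w\<bar> + \<bar>G h / h - lam\<bar> * \<bar>v (-i) w\<bar>
           + (\<bar>E h\<bar> * \<bar>r1\<bar> + \<bar>G h / h\<bar> * \<bar>r2\<bar>)"
        unfolding abs_mult[symmetric] by linarith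
      also have "\<dots> \<le> \<bar>(E h - 1) / h + lam + \<rho>\<bar> * (L * \<bar>W\<bar>) + \<bar>E h - 1\<bar> * (L * \<bar>W\<bar>) + \<bar>G h / h - lam\<bar> * (L * \<bar>W\<bar>)
           + (\<bar>E h\<bar> * (L * \<bar>W\<bar> * k h) + \<bar>G h / h\<bar> * (L * \<bar>W\<bar> * k h))"
        by (intro add_mono mult_left_mono V r1 r2 abs_ge_zero)
      also have "\<dots> = \<epsilon> h" unfolding \<epsilon>_def by (simp add: algebra_simps)
      finally show ?thesis using h by (simp add: abs_mult)
    qed
    finally show ?thesis .
  qed
  ultimately show ?thesis using lim by blast
qed

lemma one_step_expansion:
  assumes fs: "flow_smooth \<mu> \<sigma> L v d" and m: "0 < \<mu> - \<sigma>" "0 < \<mu> + \<sigma>"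
  shows "\<exists>\<epsilon>. (\<epsilon> \<longlongrightarrow> 0) (at_right 0) \<and> (\<forall>h>0. \<forall>i\<in>{-1,1}. \<forall>w. 0 \<le> w \<and> w \<le> W \<longrightarrow>
     \<bar>exp (- \<rho> * h) * (\<Sum>j\<in>{-1,1}. p h i j * v j (w * exp ((\<mu> + \<sigma> * i) * h))) - v i w - h * generator lam \<rho> v d i w\<bar>
       \<le> h * \<epsilon> h)"
proof -
  obtain e1 where e1: "(e1 \<longlongrightarrow> 0) (at_right 0)" "\<And>h w. h > 0 \<Longrightarrow> 0 \<le> w \<Longrightarrow> w \<le> W \<Longrightarrow> 
     \<bar>exp (- \<rho> * h) * (\<Sum>j\<in>{-1,1}. p h (-1) j * v j (w * exp ((\<mu> + \<sigma> * (-1)) * h))) - v (-1) w - h * generator lam \<rho> v d (-1) w\<bar>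
       \<le> h * e1 h" "\<And>h. h > 0 \<Longrightarrow> 0 \<le> e1 h"
    using one_step_expansion_state[OF fs, of "-1" W \<rho>] m by auto
  obtain e2 where e2: "(e2 \<longlongrightarrow> 0) (at_right 0)" "\<And>h w. h > 0 \<Longrightarrow> 0 \<le> w \<Longrightarrow> w \<le> W \<Longrightarrow> 
     \<bar>exp (- \<rho> * h) * (\<Sum>j\<in>{-1,1}. p h 1 j * v j (w * exp ((\<mu> + \<sigma> * 1) * h))) - v 1 w - h * generator lam \<rho> v d 1 w\<bar>
       \<le> h * e2 h" "\<And>h. h > 0 \<Longrightarrow> 0 \<le> e2 h"
    using one_step_expansion_state[OF fs, of "1" W \<rho>] m by auto
  have "((\<lambda>h. e1 h + e2 h) \<longlongrightarrow> 0) (at_right 0)"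
    using tendsto_add[OF e1(1) e2(1)] by simp
  moreover have "\<bar>exp (- \<rho> * h) * (\<Sum>j\<in>{-1,1}. p h i j * v j (w * exp ((\<mu> + \<sigma> * i) * h))) - v i w - h * generator lam \<rho> v d i w\<bar>
       \<le> h * (e1 h + e2 h)" if h: "h > 0" and w: "0 \<le> w" "w \<le> W" and i: "i \<in> {-1,1}" for h w i
  proof -
    have "h * e1 h \<le> h * (e1 h + e2 h)" "h * e2 h \<le> h * (e1 h + e2 h)"
      using e1(3)[OF h] e2(3)[OF h] h by simp_all
    moreover have "i = -1 \<or> i = 1" using i by blast
    ultimately show ?thesis using e1(2)[OF h w] e2(2)[OF h w] by (elim disjE; simp only:; linarith)
  qed
  ultimately show ?thesis by (intro exI[of _ "\<lambda>h. e1 h + e2 h"]) blast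
qed

end

text \<open>\<open>flow_smooth\<close> constrains nonnegative arguments only. Composing with
  \<open>max 0\<close> gives Lipschitz functions on the whole line, and the price, being
  nonnegative, does not see the change; Borel measurability follows.\<close>

lemma flow_smooth_continuous:
  assumes "flow_smooth \<mu> \<sigma> L v d" "i \<in> {-1,1}"
  shows "continuous_on UNIV (\<lambda>x. v i (max 0 x))" "continuous_on UNIV (\<lambda>x. d i (max 0 x))"
proof -
  have L: "0 \<le> L" using assms(1) unfolding flow_smooth_def by blast
  have m: "L * \<bar>max 0 x - max 0 z\<bar> \<le> L * \<bar>x - z\<bar>" for x z :: real
    using L by (intro mult_left_mono) auto
  have "L-lipschitz_on UNIV (\<lambda>x. v i (max 0 x))" "L-lipschitz_on UNIV (\<lambda>x. d i (max 0 x))"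
    using L order_trans[OF flow_smooth_lipschitz(1)[OF assms] m]
      order_trans[OF flow_smooth_lipschitz(2)[OF assms] m]
    by (auto intro!: lipschitz_onI simp: dist_real_def)
  then show "continuous_on UNIV (\<lambda>x. v i (max 0 x))" "continuous_on UNIV (\<lambda>x. d i (max 0 x))"
    by (auto intro: lipschitz_on_continuous_on)
qed

section \<open>The price driven by the chain, and its expansion over one step\<close>

locale telegraph_price = telegraph M \<xi> lam s p
  for M :: "'w measure" and \<xi> lam s p +
  fixes \<mu> \<sigma> y :: real
  assumes sigma_nonneg: "0 \<le> \<sigma>" and sigma_less: "\<sigma> < \<mu>" and y_nonneg: "0 \<le> y"
begin

abbreviation "Y \<equiv> price \<xi> \<mu> \<sigma> y"

lemma Y_0: "Y 0 \<omega> = y"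
  by (simp add: price_def)

lemma Y_nonneg: "0 \<le> Y t \<omega>"
  using y_nonneg by (simp add: price_def)

lemma Y_add:
  assumes "\<omega> \<in> space M" "0 \<le> r" "0 \<le> h"
  shows "Y (r + h) \<omega> = Y r \<omega> * exp (\<mu> * h + \<sigma> * integral {r..r + h} (\<lambda>u. \<xi> u \<omega>))"
proof -
  have "integral {0..r} (\<lambda>u. \<xi> u \<omega>) + integral {r..r + h} (\<lambda>u. \<xi> u \<omega>) = integral {0..r + h} (\<lambda>u. \<xi> u \<omega>)"
    using assms xi_integrable[of \<omega> 0 "r + h"] by (intro Henstock_Kurzweil_Integration.integral_combine) auto
  then have "\<mu> * (r + h) + \<sigma> * integral {0..r + h} (\<lambda>u. \<xi> u \<omega>)
    = (\<mu> * r + \<sigma> * integral {0..r} (\<lambda>u. \<xi> u \<omega>)) + (\<mu> * h + \<sigma> * integral {r..r + h} (\<lambda>u. \<xi> u \<omega>))"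
    by (metis (no_types, lifting) add.assoc add.left_commute distrib_left)
  then show ?thesis unfolding price_def by (simp only: exp_add mult.assoc)
qed

lemma exponent_bounds:
  assumes "\<omega> \<in> space M" "0 \<le> r" "0 \<le> h"
  shows "\<mu> * h + \<sigma> * integral {r..r + h} (\<lambda>u. \<xi> u \<omega>) \<le> (\<mu> + \<sigma>) * h"
    "0 \<le> \<mu> * h + \<sigma> * integral {r..r + h} (\<lambda>u. \<xi> u \<omega>)"
proof -
  let ?I = "integral {r..r + h} (\<lambda>u. \<xi> u \<omega>)"
  have "\<bar>?I\<bar> \<le> h" by (rule integral_xi_abs[OF assms])
  then have "\<sigma> * ?I \<le> \<sigma> * h" "\<sigma> * (-h) \<le> \<sigma> * ?I" using sigma_nonneg by (intro mult_left_mono; linarith)+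
  moreover have "\<sigma> * h \<le> \<mu> * h" using sigma_less assms by (intro mult_right_mono) auto
  ultimately show "\<mu> * h + \<sigma> * ?I \<le> (\<mu> + \<sigma>) * h" "0 \<le> \<mu> * h + \<sigma> * ?I"
    by (simp_all add: algebra_simps)
qed

lemma Y_le: "\<omega> \<in> space M \<Longrightarrow> 0 \<le> t \<Longrightarrow> t \<le> T \<Longrightarrow> Y t \<omega> \<le> y * exp ((\<mu> + \<sigma>) * T)"
proof -
  assume \<omega>: "\<omega> \<in> space M" and t: "0 \<le> t" "t \<le> T"
  have "(\<mu> + \<sigma>) * t \<le> (\<mu> + \<sigma>) * T" using t sigma_nonneg sigma_less by (intro mult_left_mono) auto
  then show ?thesis unfolding price_def
    using exponent_bounds(1)[OF \<omega>, of 0 t] t y_nonneg by (intro mult_left_mono) auto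
qed

text \<open>Compares the price with its continuation at the growth rate of the state at time
  \<open>r\<close>. The exponents differ by \<open>\<sigma>\<close> times the integral deviation,
  whose mean is of order \<open>h\<^sup>2\<close>.\<close>

lemma Y_deviation:
  assumes "\<omega> \<in> space M" "0 \<le> r" "0 \<le> h"
  shows "\<bar>Y (r + h) \<omega> - Y r \<omega> * exp ((\<mu> + \<sigma> * \<xi> r \<omega>) * h)\<bar>
     \<le> Y r \<omega> * exp ((\<mu> + \<sigma>) * h) * \<sigma> * \<bar>integral {r..r + h} (\<lambda>u. \<xi> u \<omega>) - h * \<xi> r \<omega>\<bar>"
proof -
  let ?I = "integral {r..r + h} (\<lambda>u. \<xi> u \<omega>)"
  have "\<sigma> * \<xi> r \<omega> \<le> \<sigma> * 1" using xi_abs[OF assms(1,2)] sigma_nonneg by (intro mult_left_mono) auto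
  then have 1: "(\<mu> + \<sigma> * \<xi> r \<omega>) * h \<le> (\<mu> + \<sigma>) * h" using assms by (intro mult_right_mono) auto
  have "Y (r + h) \<omega> - Y r \<omega> * exp ((\<mu> + \<sigma> * \<xi> r \<omega>) * h) = Y r \<omega> * (exp (\<mu> * h + \<sigma> * ?I) - exp ((\<mu> + \<sigma> * \<xi> r \<omega>) * h))"
    unfolding Y_add[OF assms] by (simp add: algebra_simps)
  also have "\<bar>\<dots>\<bar> \<le> Y r \<omega> * (exp ((\<mu> + \<sigma>) * h) * \<bar>(\<mu> * h + \<sigma> * ?I) - (\<mu> + \<sigma> * \<xi> r \<omega>) * h\<bar>)"
    unfolding abs_mult using Y_nonneg abs_exp_diff_le[OF exponent_bounds(1)[OF assms] 1]
    by (simp add: mult_left_mono)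
  also have "(\<mu> * h + \<sigma> * ?I) - (\<mu> + \<sigma> * \<xi> r \<omega>) * h = \<sigma> * (?I - h * \<xi> r \<omega>)"
    by (simp add: algebra_simps)
  also have "\<bar>\<sigma> * (?I - h * \<xi> r \<omega>)\<bar> = \<sigma> * \<bar>?I - h * \<xi> r \<omega>\<bar>"
    using sigma_nonneg by (simp add: abs_mult)
  finally show ?thesis by (simp only: mult.assoc)
qed

lemma Y_F: "0 \<le> t \<Longrightarrow> Y t \<in> borel_measurable (F t)"
  using integral_xi_F[of 0 t] unfolding price_def[abs_def] by simp

text \<open>As the chain takes two values, \<open>g\<close> splits into two functions of the price,
  and joint measurability in state and price reduces to that of each.\<close>

lemma state_function_F:
  assumes t: "0 \<le> t" and g: "\<And>i. i \<in> {-1,1} \<Longrightarrow> (\<lambda>x. g i (max 0 x)) \<in> borel_measurable borel"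
  shows "(\<lambda>\<omega>. g (\<xi> t \<omega>) (Y t \<omega>)) \<in> borel_measurable (F t)"
proof -
  have [measurable]: "\<xi> t \<in> borel_measurable (F t)" "Y t \<in> borel_measurable (F t)"
    using t by (auto intro: xi_F Y_F)
  have [measurable]: "(\<lambda>x. g 1 (max 0 x)) \<in> borel_measurable borel" "(\<lambda>x. g (-1) (max 0 x)) \<in> borel_measurable borel"
    using g by auto
  have "(\<lambda>\<omega>. if \<xi> t \<omega> = 1 then g 1 (max 0 (Y t \<omega>)) else g (-1) (max 0 (Y t \<omega>))) \<in> borel_measurable (F t)"
    by measurable
  moreover have "g (\<xi> t \<omega>) (Y t \<omega>) = (if \<xi> t \<omega> = 1 then g 1 (max 0 (Y t \<omega>)) else g (-1) (max 0 (Y t \<omega>)))"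
    if "\<omega> \<in> space (F t)" for \<omega>
    using that xi_state[of \<omega> t] t Y_nonneg by (auto simp: max_absorb2)
  ultimately show ?thesis by (subst measurable_cong)
qed

definition discounted :: "real \<Rightarrow> (real \<Rightarrow> real \<Rightarrow> real) \<Rightarrow> real \<Rightarrow> 'w \<Rightarrow> real" where
  "discounted \<rho> v t \<omega> = exp (- \<rho> * t) * v (\<xi> t \<omega>) (Y t \<omega>)"

lemma discounted_F:
  assumes "flow_smooth \<mu> \<sigma> L v d" "0 \<le> t"
  shows "discounted \<rho> v t \<in> borel_measurable (F t)"
  unfolding discounted_def[abs_def] using assms
  by (intro borel_measurable_times borel_measurable_const state_function_F
      borel_measurable_continuous_onI flow_smooth_continuous)

lemma generator_F:
  assumes fs: "flow_smooth \<mu> \<sigma> L v d" and t: "0 \<le> t"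
  shows "(\<lambda>\<omega>. exp (- \<rho> * t) * generator lam \<rho> v d (\<xi> t \<omega>) (Y t \<omega>)) \<in> borel_measurable (F t)"
  unfolding generator_def
proof (intro borel_measurable_times borel_measurable_const state_function_F[OF t] borel_measurable_continuous_onI)
  fix i :: real assume i: "i \<in> {-1,1}"
  then have i': "-i \<in> {-1,1}" by auto
  show "continuous_on UNIV (\<lambda>x. d i (max 0 x) + lam * (v (- i) (max 0 x) - v i (max 0 x)) - \<rho> * v i (max 0 x))"
    by (intro continuous_intros flow_smooth_continuous[OF fs i] flow_smooth_continuous[OF fs i'])
qed

lemma discounted_abs:
  assumes fs: "flow_smooth \<mu> \<sigma> L v d" and "\<omega> \<in> space M" "0 \<le> t" "t \<le> T" "0 \<le> \<rho>"
  shows "\<bar>discounted \<rho> v t \<omega>\<bar> \<le> L * (y * exp ((\<mu> + \<sigma>) * T))"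
proof -
  have L: "0 \<le> L" using fs unfolding flow_smooth_def by blast
  have "\<bar>v (\<xi> t \<omega>) (Y t \<omega>)\<bar> \<le> L * Y t \<omega>"
    using assms by (intro flow_smooth_abs[OF fs] xi_state Y_nonneg)
  also have "\<dots> \<le> L * (y * exp ((\<mu> + \<sigma>) * T))" using assms L by (intro mult_left_mono Y_le)
  finally have "\<bar>v (\<xi> t \<omega>) (Y t \<omega>)\<bar> \<le> L * (y * exp ((\<mu> + \<sigma>) * T))" .
  then have "exp (- \<rho> * t) * \<bar>v (\<xi> t \<omega>) (Y t \<omega>)\<bar> \<le> 1 * (L * (y * exp ((\<mu> + \<sigma>) * T)))"
    using assms by (intro mult_mono) auto
  then show ?thesis unfolding discounted_def abs_mult by simp
qed

lemma discounted_integrable: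
  assumes fs: "flow_smooth \<mu> \<sigma> L v d" and "0 \<le> t" "0 \<le> \<rho>"
  shows "integrable M (discounted \<rho> v t)"
  using discounted_abs[OF fs _ assms(2) order_refl assms(3)]
    measurable_from_subalg[OF subalgebra_F discounted_F[OF fs assms(2)]]
  by (intro integrable_const_bound[where B="L * (y * exp ((\<mu> + \<sigma>) * t))"]) auto

text \<open>The price at \<open>r + h\<close> depends on the path inside the step, so the Markov
  property does not apply to \<open>discounted\<close> directly. With the jump-free price instead,
  the value becomes a function of the past of \<open>r\<close> and of \<open>\<xi> (r + h)\<close>,
  at a mean cost of order \<open>h\<^sup>2\<close>; conditioning and the one-step expansion finish.
  One \<open>h0\<close> serves all \<open>r\<close> and \<open>A\<close>, because
  \<open>r \<le> T\<close> confines the price to \<open>{0..W}\<close> and \<open>A\<close> enters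
  through an indicator only.\<close>

lemma one_step:
  assumes fs: "flow_smooth \<mu> \<sigma> L v d" and \<rho>: "0 \<le> \<rho>" and e: "0 < e"
  shows "\<exists>h0>0. \<forall>h r A. 0 < h \<and> h < h0 \<and> 0 \<le> r \<and> r \<le> T \<and> A \<in> sets (F r) \<longrightarrow>
     \<bar>(\<integral>\<omega>. indicator A \<omega> * (discounted \<rho> v (r + h) \<omega> - discounted \<rho> v r \<omega>) \<partial>M)
       - h * (\<integral>\<omega>. indicator A \<omega> * (exp (- \<rho> * r) * generator lam \<rho> v d (\<xi> r \<omega>) (Y r \<omega>)) \<partial>M)\<bar> \<le> e * h"
proof -
  have L: "0 \<le> L" using fs unfolding flow_smooth_def by blast
  have pos: "0 < \<mu> - \<sigma>" "0 < \<mu> + \<sigma>" using sigma_nonneg sigma_less by auto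
  define W where "W = y * exp ((\<mu> + \<sigma>) * T)"
  have W: "0 \<le> W" using y_nonneg by (simp add: W_def)
  obtain \<epsilon> where \<epsilon>: "(\<epsilon> \<longlongrightarrow> 0) (at_right 0)" and exp_\<epsilon>: "\<And>h i w. h > 0 \<Longrightarrow> i \<in> {-1,1} \<Longrightarrow> 0 \<le> w \<Longrightarrow> w \<le> W \<Longrightarrow>
     \<bar>exp (- \<rho> * h) * (\<Sum>j\<in>{-1,1}. p h i j * v j (w * exp ((\<mu> + \<sigma> * i) * h))) - v i w - h * generator lam \<rho> v d i w\<bar>
       \<le> h * \<epsilon> h"
    using one_step_expansion[OF fs pos, of W \<rho>] by blast
  obtain h1 where h1: "h1 > 0" and dev: "\<And>h r. 0 \<le> h \<Longrightarrow> h < h1 \<Longrightarrow> 0 \<le> r \<Longrightarrow>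
     (\<integral>\<omega>. \<bar>integral {r..r + h} (\<lambda>u. \<xi> u \<omega>) - h * \<xi> r \<omega>\<bar> \<partial>M) \<le> 8 * lam * h\<^sup>2"
    using expected_integral_deviation by blast
  define C where "C = L * (W * exp (\<mu> + \<sigma>) * \<sigma>)"
  have C: "0 \<le> C" using L W sigma_nonneg by (simp add: C_def)
  have "((\<lambda>h. \<bar>\<epsilon> h\<bar> + C * (8 * lam * h)) \<longlongrightarrow> \<bar>0\<bar> + C * (8 * lam * 0)) (at_right 0)"
    by (intro tendsto_intros \<epsilon>)
  then have "\<forall>\<^sub>F h in at_right 0. \<bar>\<epsilon> h\<bar> + C * (8 * lam * h) < e"
    using e by (intro order_tendstoD) auto
  then obtain h2 where h2: "h2 > 0" "\<And>h. 0 < h \<Longrightarrow> h < h2 \<Longrightarrow> \<bar>\<epsilon> h\<bar> + C * (8 * lam * h) < e"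
    unfolding eventually_at_right_field by auto
  \<comment> \<open>The cap at 1 bounds \<open>exp ((\<mu> + \<sigma>) * h)\<close> by a
    constant.\<close>
  define h0 where "h0 = min 1 (min h1 h2)"
  have "\<bar>(\<integral>\<omega>. indicator A \<omega> * (discounted \<rho> v (r + h) \<omega> - discounted \<rho> v r \<omega>) \<partial>M)
       - h * (\<integral>\<omega>. indicator A \<omega> * (exp (- \<rho> * r) * generator lam \<rho> v d (\<xi> r \<omega>) (Y r \<omega>)) \<partial>M)\<bar> \<le> e * h"
    if h: "0 < h" "h < h0" and r: "0 \<le> r" "r \<le> T" and A: "A \<in> sets (F r)" for h r A
  proof -
    have hh: "h < 1" "h < h1" "h < h2" "0 \<le> h" "0 \<le> r + h" using h r by (auto simp: h0_def)
    define w where "w i \<omega> = Y r \<omega> * exp ((\<mu> + \<sigma> * i) * h)" for i \<omega>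
    define I where "I j = (indicator {\<omega> \<in> space M. \<xi> (r + h) \<omega> = j} :: _ \<Rightarrow> real)" for j
    \<comment> \<open>The discounted value at \<open>r + h\<close> for the jump-free price. Writing
      it as a sum over final states isolates the indicators to be conditioned.\<close>
    define Zs where "Zs \<omega> = exp (- \<rho> * (r + h)) * (\<Sum>j\<in>{-1,1}. v j (w (\<xi> r \<omega>) \<omega>) * I j \<omega>)" for \<omega>
    define a where "a = (indicator A :: _ \<Rightarrow> real)"
    define X where "X \<omega> = integral {r..r + h} (\<lambda>u. \<xi> u \<omega>) - h * \<xi> r \<omega>" for \<omega>
    define G where "G \<omega> = exp (- \<rho> * r) * generator lam \<rho> v d (\<xi> r \<omega>) (Y r \<omega>)" for \<omega>
    define B where "B = L * (W * exp (\<mu> + \<sigma>))"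
    have AM: "A \<in> sets M" using A subalgebra_F unfolding subalgebra_def by blast
    have [measurable]: "a \<in> borel_measurable M" "a \<in> borel_measurable (F r)" using A AM by (auto simp: a_def)
    have a: "0 \<le> a \<omega>" "a \<omega> \<le> 1" for \<omega> by (auto simp: a_def indicator_def)
    have [measurable]: "\<xi> r \<in> borel_measurable M" "\<xi> (r + h) \<in> borel_measurable M"
      using r h by (auto intro: xi_borel)
    have I[measurable]: "I j \<in> borel_measurable M" for j unfolding I_def by measurable
    have vF: "(\<lambda>\<omega>. v j (w (\<xi> r \<omega>) \<omega>)) \<in> borel_measurable (F r)" if j: "j \<in> {-1,1}" for j
    proof -
      have "(\<lambda>x. v j (max 0 (max 0 x * exp ((\<mu> + \<sigma> * i) * h)))) \<in> borel_measurable borel" for i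
        by (rule measurable_compose[OF _ borel_measurable_continuous_onI[OF flow_smooth_continuous(1)[OF fs j]]]) measurable
      then have "(\<lambda>\<omega>. (\<lambda>i x. v j (max 0 (x * exp ((\<mu> + \<sigma> * i) * h)))) (\<xi> r \<omega>) (Y r \<omega>)) \<in> borel_measurable (F r)"
        by (intro state_function_F[OF r(1)])
      then show ?thesis unfolding w_def using Y_nonneg by simp
    qed
    have [measurable]: "(\<lambda>\<omega>. v j (w (\<xi> r \<omega>) \<omega>)) \<in> borel_measurable M" if "j \<in> {-1,1}" for j
      by (rule measurable_from_subalg[OF subalgebra_F vF[OF that]])
    have pM: "(\<lambda>\<omega>. p h (\<xi> r \<omega>) j) \<in> borel_measurable M" for j
      by (rule measurable_compose[OF xi_meas[OF r(1)]]) auto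
    have [measurable]: "Zs \<in> borel_measurable M" unfolding Zs_def[abs_def] by measurable
    have [measurable]: "G \<in> borel_measurable M"
      unfolding G_def[abs_def] by (rule measurable_from_subalg[OF subalgebra_F generator_F[OF fs r(1)]])
    have [measurable]: "discounted \<rho> v t \<in> borel_measurable M" if "0 \<le> t" for t
      by (rule measurable_from_subalg[OF subalgebra_F discounted_F[OF fs that]])
    have [measurable]: "X \<in> borel_measurable M"
      unfolding X_def[abs_def] using measurable_from_subalg[OF subalgebra_F integral_xi_F[OF r(1) hh(4)]] by measurable
    have Yr: "0 \<le> Y r \<omega>" "Y r \<omega> \<le> W" if "\<omega> \<in> space M" for \<omega>
      using Y_nonneg Y_le[OF that r] by (auto simp: W_def)
    have w0: "0 \<le> w i \<omega>" for i \<omega> unfolding w_def using Y_nonneg by simp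
    have wB: "w (\<xi> r \<omega>) \<omega> \<le> W * exp (\<mu> + \<sigma>)" if "\<omega> \<in> space M" for \<omega>
    proof -
      have "\<sigma> * \<xi> r \<omega> \<le> \<sigma> * 1" using xi_abs[OF that r(1)] sigma_nonneg by (intro mult_left_mono) auto
      then have "(\<mu> + \<sigma> * \<xi> r \<omega>) * h \<le> (\<mu> + \<sigma>) * h" using hh by (intro mult_right_mono) auto
      also have "\<dots> \<le> (\<mu> + \<sigma>) * 1" using hh pos by (intro mult_left_mono) auto
      finally show ?thesis unfolding w_def using Yr[OF that] W by (intro mult_mono) auto
    qed
    have vB: "\<bar>v j (w (\<xi> r \<omega>) \<omega>)\<bar> \<le> B" if "\<omega> \<in> space M" "j \<in> {-1,1}" for j \<omega>
      using flow_smooth_abs(1)[OF fs that(2) w0] mult_left_mono[OF wB[OF that(1)] L] unfolding B_def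
      by (rule order_trans)
    have B0: "0 \<le> B" using L W by (simp add: B_def)
    have er: "exp (- \<rho> * r) \<le> 1" "exp (- \<rho> * (r + h)) \<le> 1" using \<rho> r h by auto
    have Zs_alt: "Zs \<omega> = exp (- \<rho> * (r + h)) * v (\<xi> (r + h) \<omega>) (w (\<xi> r \<omega>) \<omega>)" if "\<omega> \<in> space M" for \<omega>
    proof -
      have two: "(\<Sum>j\<in>{-1,1}. f j) = f (-1) + f 1" for f :: "real \<Rightarrow> real" by simp
      have "\<xi> (r + h) \<omega> = -1 \<or> \<xi> (r + h) \<omega> = 1" using xi_state[OF that hh(5)] by blast
      then show ?thesis
        unfolding Zs_def two I_def using that by (elim disjE) (simp_all add: indicator_def)
    qed
    have ZsB: "\<bar>Zs \<omega>\<bar> \<le> B" if "\<omega> \<in> space M" for \<omega>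
      unfolding Zs_alt[OF that] abs_mult
      using mult_mono[OF er(2) vB[OF that xi_state[OF that hh(5)]]] B0 by simp
    have dZ: "\<bar>discounted \<rho> v (r + h) \<omega> - Zs \<omega>\<bar> \<le> C * \<bar>X \<omega>\<bar>" if \<omega>: "\<omega> \<in> space M" for \<omega>
    proof -
      have "\<bar>discounted \<rho> v (r + h) \<omega> - Zs \<omega>\<bar> = exp (- \<rho> * (r + h)) * \<bar>v (\<xi> (r + h) \<omega>) (Y (r + h) \<omega>) - v (\<xi> (r + h) \<omega>) (w (\<xi> r \<omega>) \<omega>)\<bar>"
        unfolding Zs_alt[OF \<omega>] discounted_def by (simp add: right_diff_distrib[symmetric] abs_mult del: exp_le_one_iff)
      also have "\<dots> \<le> 1 * \<bar>v (\<xi> (r + h) \<omega>) (Y (r + h) \<omega>) - v (\<xi> (r + h) \<omega>) (w (\<xi> r \<omega>) \<omega>)\<bar>"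
        by (intro mult_right_mono er abs_ge_zero)
      also have "\<dots> \<le> L * \<bar>Y (r + h) \<omega> - w (\<xi> r \<omega>) \<omega>\<bar>"
        using flow_smooth_lipschitz(1)[OF fs xi_state[OF \<omega> hh(5)] Y_nonneg w0] by simp
      also have "\<dots> \<le> L * (Y r \<omega> * exp ((\<mu> + \<sigma>) * h) * \<sigma> * \<bar>X \<omega>\<bar>)"
        unfolding w_def X_def by (intro mult_left_mono Y_deviation \<omega> r hh L)
      also have "\<dots> \<le> L * (W * exp (\<mu> + \<sigma>) * \<sigma> * \<bar>X \<omega>\<bar>)"
      proof (intro mult_left_mono mult_right_mono mult_mono L sigma_nonneg Yr \<omega> W abs_ge_zero)
        have "(\<mu> + \<sigma>) * h \<le> (\<mu> + \<sigma>) * 1" using hh pos by (intro mult_left_mono) auto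
        then show "exp ((\<mu> + \<sigma>) * h) \<le> exp (\<mu> + \<sigma>)" by simp
      qed simp
      finally show ?thesis by (simp add: C_def mult.assoc)
    qed
    have XB: "\<bar>X \<omega>\<bar> \<le> 2 * h" if "\<omega> \<in> space M" for \<omega>
    proof -
      have "\<bar>h * \<xi> r \<omega>\<bar> \<le> h * 1" unfolding abs_mult using xi_abs[OF that r(1)] hh by (intro mult_mono) auto
      then show ?thesis using integral_xi_abs[OF that r(1) hh(4)] unfolding X_def by linarith
    qed
    have intX: "integrable M (\<lambda>\<omega>. \<bar>X \<omega>\<bar>)" using XB by (intro integrable_const_bound[where B="2 * h"]) auto
    have intD: "integrable M (discounted \<rho> v r)" "integrable M (discounted \<rho> v (r + h))"
      using r hh by (auto intro: discounted_integrable[OF fs _ \<rho>])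
    have intZs: "integrable M Zs" using ZsB by (intro integrable_const_bound[where B=B]) auto
    have GB: "\<bar>G \<omega>\<bar> \<le> L * W + lam * (L * W + L * W) + \<rho> * (L * W)" if \<omega>: "\<omega> \<in> space M" for \<omega>
    proof -
      have st: "\<xi> r \<omega> \<in> {-1,1}" by (rule xi_state[OF \<omega> r(1)])
      then have st': "- \<xi> r \<omega> \<in> {-1,1}" by auto
      have b: "\<bar>d (\<xi> r \<omega>) (Y r \<omega>)\<bar> \<le> L * W" "\<bar>v (\<xi> r \<omega>) (Y r \<omega>)\<bar> \<le> L * W" "\<bar>v (- \<xi> r \<omega>) (Y r \<omega>)\<bar> \<le> L * W"
        using flow_smooth_abs[OF fs st Yr(1)[OF \<omega>]] flow_smooth_abs(1)[OF fs st' Yr(1)[OF \<omega>]]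
          mult_left_mono[OF Yr(2)[OF \<omega>] L] by linarith+
      have "\<bar>generator lam \<rho> v d (\<xi> r \<omega>) (Y r \<omega>)\<bar> \<le> \<bar>d (\<xi> r \<omega>) (Y r \<omega>)\<bar> + lam * (\<bar>v (- \<xi> r \<omega>) (Y r \<omega>)\<bar> + \<bar>v (\<xi> r \<omega>) (Y r \<omega>)\<bar>) + \<rho> * \<bar>v (\<xi> r \<omega>) (Y r \<omega>)\<bar>"
      proof -
        have "\<bar>lam * (v (- \<xi> r \<omega>) (Y r \<omega>) - v (\<xi> r \<omega>) (Y r \<omega>))\<bar> \<le> lam * (\<bar>v (- \<xi> r \<omega>) (Y r \<omega>)\<bar> + \<bar>v (\<xi> r \<omega>) (Y r \<omega>)\<bar>)"
          unfolding abs_mult using lam_pos by (simp add: mult_left_mono)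
        moreover have "\<bar>\<rho> * v (\<xi> r \<omega>) (Y r \<omega>)\<bar> = \<rho> * \<bar>v (\<xi> r \<omega>) (Y r \<omega>)\<bar>" using \<rho> by (simp add: abs_mult)
        ultimately show ?thesis unfolding generator_def by linarith
      qed
      also have "\<dots> \<le> L * W + lam * (L * W + L * W) + \<rho> * (L * W)"
        using lam_pos \<rho> by (intro add_mono mult_left_mono b) auto
      finally have "exp (- \<rho> * r) * \<bar>generator lam \<rho> v d (\<xi> r \<omega>) (Y r \<omega>)\<bar> \<le> 1 * (L * W + lam * (L * W + L * W) + \<rho> * (L * W))"
        by (intro mult_mono er) auto
      then show ?thesis unfolding G_def abs_mult by simp
    qed
    have intG: "integrable M G"
      using GB by (intro integrable_const_bound[where B="L * W + lam * (L * W + L * W) + \<rho> * (L * W)"]) auto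
    have aint: "integrable M (\<lambda>\<omega>. a \<omega> * f \<omega>)" if "integrable M f" for f
      using integrable_real_mult_indicator[OF AM that] by (simp add: a_def mult.commute)
    have 1: "\<bar>(\<integral>\<omega>. a \<omega> * (discounted \<rho> v (r + h) \<omega> - Zs \<omega>) \<partial>M)\<bar> \<le> C * (8 * lam * h\<^sup>2)"
    proof -
      have "\<bar>(\<integral>\<omega>. a \<omega> * (discounted \<rho> v (r + h) \<omega> - Zs \<omega>) \<partial>M)\<bar> \<le> (\<integral>\<omega>. \<bar>a \<omega> * (discounted \<rho> v (r + h) \<omega> - Zs \<omega>)\<bar> \<partial>M)"
        by (rule integral_abs_bound)
      also have "\<dots> \<le> (\<integral>\<omega>. C * \<bar>X \<omega>\<bar> \<partial>M)"
      proof (rule integral_mono)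
        fix \<omega> assume \<omega>: "\<omega> \<in> space M"
        have "a \<omega> * \<bar>discounted \<rho> v (r + h) \<omega> - Zs \<omega>\<bar> \<le> 1 * (C * \<bar>X \<omega>\<bar>)"
          using a dZ[OF \<omega>] by (intro mult_mono) auto
        then show "\<bar>a \<omega> * (discounted \<rho> v (r + h) \<omega> - Zs \<omega>)\<bar> \<le> C * \<bar>X \<omega>\<bar>"
          using a[of \<omega>] by (simp add: abs_mult)
      qed (use intX intD intZs in \<open>auto intro!: integrable_abs aint Bochner_Integration.integrable_diff\<close>)
      also have "\<dots> = C * (\<integral>\<omega>. \<bar>X \<omega>\<bar> \<partial>M)" by simp
      also have "\<dots> \<le> C * (8 * lam * h\<^sup>2)"
        unfolding X_def by (intro mult_left_mono dev C hh r)
      finally show ?thesis .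
    qed
    \<comment> \<open>\<open>exp (- \<rho> * r) * S\<close> plays the role of the conditional
      expectation of \<open>Zs\<close> given the past of \<open>r\<close>.\<close>
    define S where "S \<omega> = exp (- \<rho> * h) * (\<Sum>j\<in>{-1,1}. p h (\<xi> r \<omega>) j * v j (w (\<xi> r \<omega>) \<omega>))" for \<omega>
    define Q where "Q j \<omega> = a \<omega> * (exp (- \<rho> * (r + h)) * v j (w (\<xi> r \<omega>) \<omega>))" for j \<omega>
    have QB: "\<bar>Q j \<omega>\<bar> \<le> B" if "\<omega> \<in> space M" "j \<in> {-1,1}" for j \<omega>
    proof -
      have "a \<omega> * (exp (- \<rho> * (r + h)) * \<bar>v j (w (\<xi> r \<omega>) \<omega>)\<bar>) \<le> 1 * (1 * B)"
        using a er vB[OF that] by (intro mult_mono mult_nonneg_nonneg) auto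
      then show ?thesis unfolding Q_def abs_mult using a[of \<omega>] by simp
    qed
    have QF: "Q j \<in> borel_measurable (F r)" if "j \<in> {-1,1}" for j
      unfolding Q_def[abs_def] using vF[OF that] by measurable
    have QM: "Q j \<in> borel_measurable M" if "j \<in> {-1,1}" for j
      by (rule measurable_from_subalg[OF subalgebra_F QF[OF that]])
    have QI: "integrable M (\<lambda>\<omega>. Q j \<omega> * I j \<omega>)" if "j \<in> {-1,1}" for j
    proof (rule integrable_const_bound[where B=B])
      show "AE \<omega> in M. norm (Q j \<omega> * I j \<omega>) \<le> B"
        using QB[OF _ that] B0 by (auto simp: I_def indicator_def)
    qed (use QM[OF that] in measurable)
    have Qp: "integrable M (\<lambda>\<omega>. Q j \<omega> * p h (\<xi> r \<omega>) j)" if j: "j \<in> {-1,1}" for j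
    proof (rule integrable_const_bound[where B=B])
      show "AE \<omega> in M. norm (Q j \<omega> * p h (\<xi> r \<omega>) j) \<le> B"
      proof (rule AE_I2)
        fix \<omega> assume \<omega>: "\<omega> \<in> space M"
        have "0 \<le> p h (\<xi> r \<omega>) j" "p h (\<xi> r \<omega>) j \<le> 1"
          using p_bounds[OF hh(4) xi_state[OF \<omega> r(1)] j] by auto
        then have "\<bar>Q j \<omega>\<bar> * \<bar>p h (\<xi> r \<omega>) j\<bar> \<le> B * 1" using QB[OF \<omega> j] B0 by (intro mult_mono) auto
        then show "norm (Q j \<omega> * p h (\<xi> r \<omega>) j) \<le> B" by (simp add: abs_mult)
      qed
    qed (use QM[OF j] pM in measurable)
    have "(\<integral>\<omega>. a \<omega> * Zs \<omega> \<partial>M) = (\<integral>\<omega>. (\<Sum>j\<in>{-1,1}. Q j \<omega> * I j \<omega>) \<partial>M)"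
      by (intro Bochner_Integration.integral_cong) (auto simp: Zs_def Q_def algebra_simps)
    also have "\<dots> = (\<Sum>j\<in>{-1,1}. (\<integral>\<omega>. Q j \<omega> * I j \<omega> \<partial>M))"
      using QI by (intro Bochner_Integration.integral_sum)
    also have "\<dots> = (\<Sum>j\<in>{-1,1}. (\<integral>\<omega>. Q j \<omega> * p h (\<xi> r \<omega>) j \<partial>M))"
      unfolding I_def using QF QB by (intro sum.cong markov_expectation[OF r(1) hh(4), where B=B]) auto
    also have "\<dots> = (\<integral>\<omega>. (\<Sum>j\<in>{-1,1}. Q j \<omega> * p h (\<xi> r \<omega>) j) \<partial>M)"
      using Qp by (intro Bochner_Integration.integral_sum[symmetric])
    also have "\<dots> = (\<integral>\<omega>. a \<omega> * (exp (- \<rho> * r) * S \<omega>) \<partial>M)"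
    proof -
      have "exp (- \<rho> * (r + h)) = exp (- \<rho> * r) * exp (- \<rho> * h)" by (simp add: distrib_left flip: exp_add)
      then have "(\<Sum>j\<in>{-1,1}. Q j \<omega> * p h (\<xi> r \<omega>) j) = a \<omega> * (exp (- \<rho> * r) * S \<omega>)" for \<omega>
        unfolding S_def Q_def sum_distrib_left by (simp only: mult_ac)
      then show ?thesis by simp
    qed
    finally have 2: "(\<integral>\<omega>. a \<omega> * Zs \<omega> \<partial>M) = (\<integral>\<omega>. a \<omega> * (exp (- \<rho> * r) * S \<omega>) \<partial>M)" .
    have S3: "\<bar>S \<omega> - v (\<xi> r \<omega>) (Y r \<omega>) - h * generator lam \<rho> v d (\<xi> r \<omega>) (Y r \<omega>)\<bar> \<le> h * \<bar>\<epsilon> h\<bar>" if \<omega>: "\<omega> \<in> space M" for \<omega>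
    proof -
      have "h * \<epsilon> h \<le> h * \<bar>\<epsilon> h\<bar>" using h by (intro mult_left_mono) auto
      then show ?thesis
        unfolding S_def w_def using exp_\<epsilon>[OF h(1) xi_state[OF \<omega> r(1)] Yr[OF \<omega>]] by linarith
    qed
    have S3': "\<bar>exp (- \<rho> * r) * S \<omega> - discounted \<rho> v r \<omega> - h * G \<omega>\<bar> \<le> h * \<bar>\<epsilon> h\<bar>" if \<omega>: "\<omega> \<in> space M" for \<omega>
    proof -
      have "exp (- \<rho> * r) * S \<omega> - discounted \<rho> v r \<omega> - h * G \<omega> = exp (- \<rho> * r) * (S \<omega> - v (\<xi> r \<omega>) (Y r \<omega>) - h * generator lam \<rho> v d (\<xi> r \<omega>) (Y r \<omega>))"
        unfolding discounted_def G_def by (simp add: algebra_simps)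
      also have "\<bar>\<dots>\<bar> \<le> 1 * (h * \<bar>\<epsilon> h\<bar>)" unfolding abs_mult using S3[OF \<omega>] er by (intro mult_mono) auto
      finally show ?thesis by simp
    qed
    have SM[measurable]: "S \<in> borel_measurable M" unfolding S_def[abs_def] using pM by measurable
    have intS: "integrable M (\<lambda>\<omega>. exp (- \<rho> * r) * S \<omega> - discounted \<rho> v r \<omega> - h * G \<omega>)"
    proof (rule integrable_const_bound[where B="h * \<bar>\<epsilon> h\<bar>"])
      show "(\<lambda>\<omega>. exp (- \<rho> * r) * S \<omega> - discounted \<rho> v r \<omega> - h * G \<omega>) \<in> borel_measurable M"
        using r by measurable
    qed (use S3' in auto)
    have 3: "\<bar>(\<integral>\<omega>. a \<omega> * (exp (- \<rho> * r) * S \<omega> - discounted \<rho> v r \<omega> - h * G \<omega>) \<partial>M)\<bar> \<le> h * \<bar>\<epsilon> h\<bar>"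
    proof -
      have "\<bar>(\<integral>\<omega>. a \<omega> * (exp (- \<rho> * r) * S \<omega> - discounted \<rho> v r \<omega> - h * G \<omega>) \<partial>M)\<bar>
          \<le> (\<integral>\<omega>. \<bar>a \<omega> * (exp (- \<rho> * r) * S \<omega> - discounted \<rho> v r \<omega> - h * G \<omega>)\<bar> \<partial>M)"
        by (rule integral_abs_bound)
      also have "\<dots> \<le> (\<integral>\<omega>. h * \<bar>\<epsilon> h\<bar> \<partial>M)"
      proof (rule integral_mono)
        fix \<omega> assume \<omega>: "\<omega> \<in> space M"
        have "a \<omega> * \<bar>exp (- \<rho> * r) * S \<omega> - discounted \<rho> v r \<omega> - h * G \<omega>\<bar> \<le> 1 * (h * \<bar>\<epsilon> h\<bar>)"
          using a S3'[OF \<omega>] by (intro mult_mono) auto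
        then show "\<bar>a \<omega> * (exp (- \<rho> * r) * S \<omega> - discounted \<rho> v r \<omega> - h * G \<omega>)\<bar> \<le> h * \<bar>\<epsilon> h\<bar>"
          using a[of \<omega>] by (simp add: abs_mult)
      qed (use aint[OF intS] in auto)
      finally show ?thesis by (simp add: prob_space)
    qed
    have intS': "integrable M (\<lambda>\<omega>. exp (- \<rho> * r) * S \<omega>)"
    proof -
      have "integrable M (\<lambda>\<omega>. (exp (- \<rho> * r) * S \<omega> - discounted \<rho> v r \<omega> - h * G \<omega>) + (discounted \<rho> v r \<omega> + h * G \<omega>))"
        by (intro Bochner_Integration.integrable_add intS intD integrable_mult_right intG)
      then show ?thesis by simp
    qed
    have ints: "integrable M (\<lambda>\<omega>. a \<omega> * discounted \<rho> v (r + h) \<omega>)" "integrable M (\<lambda>\<omega>. a \<omega> * discounted \<rho> v r \<omega>)"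
      "integrable M (\<lambda>\<omega>. a \<omega> * Zs \<omega>)" "integrable M (\<lambda>\<omega>. a \<omega> * G \<omega>)" "integrable M (\<lambda>\<omega>. a \<omega> * (exp (- \<rho> * r) * S \<omega>))"
      by (intro aint intD intZs intG intS')+
    have e1: "(\<integral>\<omega>. a \<omega> * (discounted \<rho> v (r + h) \<omega> - discounted \<rho> v r \<omega>) \<partial>M)
        = (\<integral>\<omega>. a \<omega> * discounted \<rho> v (r + h) \<omega> \<partial>M) - (\<integral>\<omega>. a \<omega> * discounted \<rho> v r \<omega> \<partial>M)"
      using ints by (simp add: right_diff_distrib)
    have e2: "(\<integral>\<omega>. a \<omega> * (discounted \<rho> v (r + h) \<omega> - Zs \<omega>) \<partial>M)
        = (\<integral>\<omega>. a \<omega> * discounted \<rho> v (r + h) \<omega> \<partial>M) - (\<integral>\<omega>. a \<omega> * Zs \<omega> \<partial>M)"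
      using ints by (simp add: right_diff_distrib)
    have e3: "(\<integral>\<omega>. a \<omega> * (exp (- \<rho> * r) * S \<omega> - discounted \<rho> v r \<omega> - h * G \<omega>) \<partial>M)
        = (\<integral>\<omega>. a \<omega> * (exp (- \<rho> * r) * S \<omega>) \<partial>M) - (\<integral>\<omega>. a \<omega> * discounted \<rho> v r \<omega> \<partial>M) - h * (\<integral>\<omega>. a \<omega> * G \<omega> \<partial>M)"
    proof -
      have "(\<integral>\<omega>. a \<omega> * (exp (- \<rho> * r) * S \<omega> - discounted \<rho> v r \<omega> - h * G \<omega>) \<partial>M)
         = (\<integral>\<omega>. a \<omega> * (exp (- \<rho> * r) * S \<omega>) - a \<omega> * discounted \<rho> v r \<omega> - h * (a \<omega> * G \<omega>) \<partial>M)"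
        by (intro Bochner_Integration.integral_cong) (auto simp: algebra_simps)
      then show ?thesis using ints by simp
    qed
    have "h * \<bar>\<epsilon> h\<bar> + C * (8 * lam * h\<^sup>2) = h * (\<bar>\<epsilon> h\<bar> + C * (8 * lam * h))"
      by (simp add: power2_eq_square algebra_simps)
    also have "\<dots> \<le> h * e" using h2(2)[OF h(1) hh(3)] h by (intro mult_left_mono) auto
    finally have "h * \<bar>\<epsilon> h\<bar> + C * (8 * lam * h\<^sup>2) \<le> e * h" by (simp add: mult.commute)
    then have "\<bar>(\<integral>\<omega>. a \<omega> * (discounted \<rho> v (r + h) \<omega> - discounted \<rho> v r \<omega>) \<partial>M) - h * (\<integral>\<omega>. a \<omega> * G \<omega> \<partial>M)\<bar> \<le> e * h"
      using 1 3 unfolding e1 e2 e3 2 by linarith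
    then show ?thesis unfolding a_def G_def .
  qed
  moreover have "h0 > 0" using h1 h2 by (simp add: h0_def)
  ultimately show ?thesis by blast
qed

end

section \<open>Optional stopping along a grid\<close>

context telegraph
begin

abbreviation "FC t \<equiv> completed_filtration M \<xi> t"

lemma past_events_Pow: "past_events M \<xi> t \<union> null_sets (completion M) \<subseteq> Pow (space M)"
  using past_events_sets[of t] sets.space_closed[of M] sets.space_closed[of "completion M"] by (auto simp: null_sets_def)

lemma space_FC [simp]: "space (FC t) = space M"
  unfolding completed_filtration_def using past_events_Pow by (rule space_measure_of)

lemma sets_FC: "sets (FC t) = sigma_sets (space M) (past_events M \<xi> t \<union> null_sets (completion M))"
  unfolding completed_filtration_def using past_events_Pow by (rule sets_measure_of)

lemma sets_FC_completion: "sets (FC t) \<subseteq> sets (completion M)"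
proof -
  have "past_events M \<xi> t \<union> null_sets (completion M) \<subseteq> sets (completion M)"
    using past_events_sets[of t] by (auto simp: null_sets_def)
  from sets.sigma_sets_subset[OF this] show ?thesis by (simp add: sets_FC)
qed

lemma sets_FC_mono: "t \<le> t' \<Longrightarrow> sets (FC t) \<subseteq> sets (FC t')"
  unfolding sets_FC by (rule sigma_sets_subseteq) (auto simp: past_events_def intro: order_trans)

lemma sets_F_FC: "sets (natural_filtration M \<xi> t) \<subseteq> sets (FC t)"
  unfolding sets_FC sets_F by (rule sigma_sets_subseteq) auto

text \<open>The sets that agree almost everywhere with a natural event form a \<sigma>-algebra. It
  contains the past events and, matched with the empty set, the null sets.\<close>

lemma completed_filtration_approx:
  assumes "A \<in> sets (FC t)"
  shows "\<exists>B \<in> sets (natural_filtration M \<xi> t). AE \<omega> in completion M. \<omega> \<in> A \<longleftrightarrow> \<omega> \<in> B"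
  using assms[unfolded sets_FC]
proof (induction rule: sigma_sets.induct)
  case (Basic a)
  then show ?case
  proof
    assume "a \<in> past_events M \<xi> t"
    then show ?thesis unfolding sets_F by (intro bexI[of _ a]) (auto intro: sigma_sets.Basic)
  next
    assume "a \<in> null_sets (completion M)"
    then have "AE \<omega> in completion M. \<omega> \<notin> a" by (rule AE_not_in)
    then show ?thesis by (intro bexI[of _ "{}"]) auto
  qed
next
  case Empty
  show ?case by (intro bexI[of _ "{}"]) auto
next
  case (Compl a)
  then obtain B where B: "B \<in> sets (natural_filtration M \<xi> t)" "AE \<omega> in completion M. \<omega> \<in> a \<longleftrightarrow> \<omega> \<in> B" by blast
  have "space M - B \<in> sets (natural_filtration M \<xi> t)"
    using sets.compl_sets[OF B(1)] by simp
  moreover have "AE \<omega> in completion M. \<omega> \<in> space M - a \<longleftrightarrow> \<omega> \<in> space M - B" using B(2) by auto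
  ultimately show ?case by blast
next
  case (Union a)
  then obtain B where B: "\<And>i::nat. B i \<in> sets (natural_filtration M \<xi> t)" "\<And>i. AE \<omega> in completion M. \<omega> \<in> a i \<longleftrightarrow> \<omega> \<in> B i"
    by metis
  have "AE \<omega> in completion M. \<forall>i. \<omega> \<in> a i \<longleftrightarrow> \<omega> \<in> B i" using B(2) by (simp add: AE_all_countable)
  then have "AE \<omega> in completion M. \<omega> \<in> (\<Union>i. a i) \<longleftrightarrow> \<omega> \<in> (\<Union>i. B i)" by auto
  moreover have "(\<Union>i. B i) \<in> sets (natural_filtration M \<xi> t)" using B(1) by blast
  ultimately show ?case by blast
qed

text \<open>Moves an estimate for natural events under \<open>M\<close> to completed events under
  \<open>completion M\<close>, where stopping times are measurable.\<close>

lemma integral_indicator_completion: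
  assumes A: "A \<in> sets (completion M)" and B: "B \<in> sets M" and AB: "AE \<omega> in completion M. \<omega> \<in> A \<longleftrightarrow> \<omega> \<in> B"
    and [measurable]: "f \<in> borel_measurable M"
  shows "(\<integral>\<omega>. indicator A \<omega> * f \<omega> \<partial>completion M) = (\<integral>\<omega>. indicator B \<omega> * f \<omega> \<partial>M :: real)"
proof -
  have fC: "f \<in> borel_measurable (completion M)" by (rule measurable_completion) fact
  have "(\<integral>\<omega>. indicator A \<omega> * f \<omega> \<partial>completion M) = (\<integral>\<omega>. indicator B \<omega> * f \<omega> \<partial>completion M)"
    using AB A B by (intro integral_cong_AE borel_measurable_times fC borel_measurable_indicator) (auto simp: indicator_def)
  also have "\<dots> = (\<integral>\<omega>. indicator B \<omega> * f \<omega> \<partial>M)" by (intro integral_completion borel_measurable_times borel_measurable_indicator B assms(4))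
  finally show ?thesis .
qed

end

context telegraph_price
begin

lemma discounted_M:
  assumes "flow_smooth \<mu> \<sigma> L v d" "0 \<le> t"
  shows "discounted \<rho> v t \<in> borel_measurable M"
  by (rule measurable_from_subalg[OF subalgebra_F discounted_F[OF assms]])

lemma one_step_completed:
  assumes fs: "flow_smooth \<mu> \<sigma> L v d" and \<rho>: "0 \<le> \<rho>" and e: "0 < e"
  shows "\<exists>h0>0. \<forall>h r A. 0 < h \<and> h < h0 \<and> 0 \<le> r \<and> r \<le> T \<and> A \<in> sets (FC (ennreal r)) \<longrightarrow>
     \<bar>(\<integral>\<omega>. indicator A \<omega> * (discounted \<rho> v (r + h) \<omega> - discounted \<rho> v r \<omega>) \<partial>completion M)
       - h * (\<integral>\<omega>. indicator A \<omega> * (exp (- \<rho> * r) * generator lam \<rho> v d (\<xi> r \<omega>) (Y r \<omega>)) \<partial>completion M)\<bar> \<le> e * h"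
proof -
  obtain h0 where h0: "h0 > 0" and os: "\<And>h r A. 0 < h \<Longrightarrow> h < h0 \<Longrightarrow> 0 \<le> r \<Longrightarrow> r \<le> T \<Longrightarrow> A \<in> sets (F r) \<Longrightarrow>
     \<bar>(\<integral>\<omega>. indicator A \<omega> * (discounted \<rho> v (r + h) \<omega> - discounted \<rho> v r \<omega>) \<partial>M)
       - h * (\<integral>\<omega>. indicator A \<omega> * (exp (- \<rho> * r) * generator lam \<rho> v d (\<xi> r \<omega>) (Y r \<omega>)) \<partial>M)\<bar> \<le> e * h"
    using one_step[OF fs \<rho> e, of T] by blast
  have "\<bar>(\<integral>\<omega>. indicator A \<omega> * (discounted \<rho> v (r + h) \<omega> - discounted \<rho> v r \<omega>) \<partial>completion M)
       - h * (\<integral>\<omega>. indicator A \<omega> * (exp (- \<rho> * r) * generator lam \<rho> v d (\<xi> r \<omega>) (Y r \<omega>)) \<partial>completion M)\<bar> \<le> e * h"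
    if h: "0 < h" "h < h0" and r: "0 \<le> r" "r \<le> T" and A: "A \<in> sets (FC (ennreal r))" for h r A
  proof -
    obtain B where B: "B \<in> sets (F r)" "AE \<omega> in completion M. \<omega> \<in> A \<longleftrightarrow> \<omega> \<in> B"
      using completed_filtration_approx[OF A] by blast
    have BM: "B \<in> sets M" using B(1) subalgebra_F unfolding subalgebra_def by blast
    have AC: "A \<in> sets (completion M)" using A sets_FC_completion by blast
    note ic = integral_indicator_completion[OF AC BM B(2)]
    have m1: "(\<lambda>\<omega>. discounted \<rho> v (r + h) \<omega> - discounted \<rho> v r \<omega>) \<in> borel_measurable M"
      using h r by (intro borel_measurable_diff discounted_M[OF fs]) auto
    have m2: "(\<lambda>\<omega>. exp (- \<rho> * r) * generator lam \<rho> v d (\<xi> r \<omega>) (Y r \<omega>)) \<in> borel_measurable M"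
      by (rule measurable_from_subalg[OF subalgebra_F generator_F[OF fs r(1)]])
    show ?thesis unfolding ic[OF m1] ic[OF m2] by (rule os[OF h r B(1)])
  qed
  with h0 show ?thesis by blast
qed

lemma expectation_initial:
  assumes fs: "flow_smooth \<mu> \<sigma> L v d"
  shows "(\<integral>\<omega>. discounted \<rho> v 0 \<omega> \<partial>completion M) = v s y"
proof -
  interpret C: prob_space "completion M"
    by (rule prob_space_completion)
  have "AE \<omega> in completion M. discounted \<rho> v 0 \<omega> = v s y"
    using AE_completion[OF init] by eventually_elim (simp add: discounted_def Y_0)
  then have "(\<integral>\<omega>. discounted \<rho> v 0 \<omega> \<partial>completion M) = (\<integral>\<omega>. v s y \<partial>completion M)"
    by (intro integral_cong_AE measurable_completion discounted_M[OF fs]) auto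
  then show ?thesis using C.prob_space by simp
qed

text \<open>\<open>A k\<close> is meant as the event that no stop has occurred by time
  \<open>h * k\<close>. In this increment form, a discrete stochastic integral, the mean is a sum of
  one-step terms for arbitrary events of the past; for decreasing events it is the value at a
  stopping time.\<close>

definition stopped :: "real \<Rightarrow> (real \<Rightarrow> real \<Rightarrow> real) \<Rightarrow> real \<Rightarrow> (nat \<Rightarrow> 'w set) \<Rightarrow> nat \<Rightarrow> 'w \<Rightarrow> real" where
  "stopped \<rho> v h A K \<omega> = discounted \<rho> v 0 \<omega> +
     (\<Sum>k<K. indicator (A k) \<omega> * (discounted \<rho> v (h * real (Suc k)) \<omega> - discounted \<rho> v (h * real k) \<omega>))"

lemma stopped_eq:
  assumes "\<And>k. k < K \<Longrightarrow> \<omega> \<in> A k \<longleftrightarrow> k < n"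
  shows "stopped \<rho> v h A K \<omega> = discounted \<rho> v (h * real (min n K)) \<omega>"
proof -
  let ?z = "\<lambda>k. discounted \<rho> v (h * real k) \<omega>"
  have "(\<Sum>k<K. indicator (A k) \<omega> * (?z (Suc k) - ?z k)) = (\<Sum>k<K. if k < n then ?z (Suc k) - ?z k else 0)"
    using assms by (intro sum.cong) (auto simp: indicator_def)
  also have "\<dots> = (\<Sum>k\<in>{..<K} \<inter> {k. k < n}. ?z (Suc k) - ?z k)"
    by (simp add: sum.If_cases)
  also have "{..<K} \<inter> {k. k < n} = {..<min n K}" by auto
  also have "(\<Sum>k<min n K. ?z (Suc k) - ?z k) = ?z (min n K) - ?z 0" by (rule sum_lessThan_telescope)
  finally show ?thesis unfolding stopped_def by simp
qed

lemma stopped_completion: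
  assumes fs: "flow_smooth \<mu> \<sigma> L v d" and "0 \<le> \<rho>" "0 \<le> h" and A: "\<And>k. k < K \<Longrightarrow> A k \<in> sets (FC (ennreal (h * real k)))"
  shows "integrable (completion M) (stopped \<rho> v h A K)"
    and "(\<integral>\<omega>. stopped \<rho> v h A K \<omega> \<partial>completion M) = v s y + (\<Sum>k<K. \<integral>\<omega>. indicator (A k) \<omega> *
      (discounted \<rho> v (h * real k + h) \<omega> - discounted \<rho> v (h * real k) \<omega>) \<partial>completion M)"
proof -
  have Z: "integrable (completion M) (discounted \<rho> v t)" if "0 \<le> t" for t
    using discounted_integrable[OF fs that assms(2)] discounted_M[OF fs that] by (simp add: integrable_completion)
  have I: "integrable (completion M) (\<lambda>\<omega>. indicator (A k) \<omega> * (discounted \<rho> v (h * real (Suc k)) \<omega> - discounted \<rho> v (h * real k) \<omega>))"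
    if "k < K" for k
  proof -
    have "A k \<in> sets (completion M)" using A[OF that] sets_FC_completion by blast
    from integrable_real_mult_indicator[OF this] show ?thesis
      using Z assms(3) by (simp add: mult.commute[of "indicator _ _"])
  qed
  show "integrable (completion M) (stopped \<rho> v h A K)"
    unfolding stopped_def[abs_def] using I Z by (intro Bochner_Integration.integrable_add Bochner_Integration.integrable_sum) auto
  show "(\<integral>\<omega>. stopped \<rho> v h A K \<omega> \<partial>completion M) = v s y + (\<Sum>k<K. \<integral>\<omega>. indicator (A k) \<omega> *
      (discounted \<rho> v (h * real k + h) \<omega> - discounted \<rho> v (h * real k) \<omega>) \<partial>completion M)"
  proof -
    let ?D = "\<lambda>k \<omega>. indicator (A k) \<omega> * (discounted \<rho> v (h * real (Suc k)) \<omega> - discounted \<rho> v (h * real k) \<omega>)"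
    have "(\<integral>\<omega>. stopped \<rho> v h A K \<omega> \<partial>completion M)
        = (\<integral>\<omega>. discounted \<rho> v 0 \<omega> \<partial>completion M) + (\<integral>\<omega>. (\<Sum>k<K. ?D k \<omega>) \<partial>completion M)"
      unfolding stopped_def 
    proof (rule Bochner_Integration.integral_add)
      show "integrable (completion M) (\<lambda>\<omega>. \<Sum>k<K. ?D k \<omega>)"
        using I by (intro Bochner_Integration.integrable_sum) (simp only: lessThan_iff)
    qed (use Z in simp)
    also have "(\<integral>\<omega>. (\<Sum>k<K. ?D k \<omega>) \<partial>completion M) = (\<Sum>k<K. \<integral>\<omega>. ?D k \<omega> \<partial>completion M)"
      using I by (intro Bochner_Integration.integral_sum) auto
    finally show ?thesis by (simp add: expectation_initial[OF fs] distrib_left add.commute)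
  qed
qed

text \<open>A horizon \<open>T\<close> holds at most \<open>T / h\<close> steps, each with error at
  most \<open>e' * h\<close>, so the total stays below \<open>e' * T\<close> whatever the mesh. The
  drift part is nonpositive, and zero if the generator vanishes before stopping; this gives the two
  inequalities.\<close>

lemma stopped_expectation:
  assumes fs: "flow_smooth \<mu> \<sigma> L v d" and \<rho>: "0 \<le> \<rho>" and e: "0 < e" and T: "0 \<le> T"
    and gen: "\<And>i x. i \<in> {-1,1} \<Longrightarrow> 0 \<le> x \<Longrightarrow> generator lam \<rho> v d i x \<le> 0"
  shows "\<exists>h0>0. \<forall>h K A. 0 < h \<and> h < h0 \<and> h * real K \<le> T \<and> (\<forall>k<K. A k \<in> sets (FC (ennreal (h * real k)))) \<longrightarrow>
     (\<integral>\<omega>. stopped \<rho> v h A K \<omega> \<partial>completion M) \<le> v s y + e \<and>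
     ((\<forall>k<K. \<forall>\<omega>\<in>A k. generator lam \<rho> v d (\<xi> (h * real k) \<omega>) (Y (h * real k) \<omega>) = 0) \<longrightarrow>
        v s y - e \<le> (\<integral>\<omega>. stopped \<rho> v h A K \<omega> \<partial>completion M))"
proof -
  \<comment> \<open>Dividing by \<open>T + 1\<close> covers \<open>T = 0\<close>.\<close>
  define e' where "e' = e / (T + 1)"
  have e': "0 < e'" "e' * T \<le> e" using e T by (auto simp: e'_def field_simps)
  obtain h0 where h0: "h0 > 0" and os: "\<And>h r A. 0 < h \<Longrightarrow> h < h0 \<Longrightarrow> 0 \<le> r \<Longrightarrow> r \<le> T \<Longrightarrow> A \<in> sets (FC (ennreal r)) \<Longrightarrow>
     \<bar>(\<integral>\<omega>. indicator A \<omega> * (discounted \<rho> v (r + h) \<omega> - discounted \<rho> v r \<omega>) \<partial>completion M)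
       - h * (\<integral>\<omega>. indicator A \<omega> * (exp (- \<rho> * r) * generator lam \<rho> v d (\<xi> r \<omega>) (Y r \<omega>)) \<partial>completion M)\<bar> \<le> e' * h"
    using one_step_completed[OF fs \<rho> e'(1), of T] by blast
  have "(\<integral>\<omega>. stopped \<rho> v h A K \<omega> \<partial>completion M) \<le> v s y + e \<and>
     ((\<forall>k<K. \<forall>\<omega>\<in>A k. generator lam \<rho> v d (\<xi> (h * real k) \<omega>) (Y (h * real k) \<omega>) = 0) \<longrightarrow>
        v s y - e \<le> (\<integral>\<omega>. stopped \<rho> v h A K \<omega> \<partial>completion M))"
    if h: "0 < h" "h < h0" and K: "h * real K \<le> T" and A: "\<And>k. k < K \<Longrightarrow> A k \<in> sets (FC (ennreal (h * real k)))" for h K A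
  proof -
    let ?J = "\<lambda>k. \<integral>\<omega>. indicator (A k) \<omega> * (discounted \<rho> v (h * real k + h) \<omega> - discounted \<rho> v (h * real k) \<omega>) \<partial>completion M"
    let ?g = "\<lambda>k \<omega>. indicator (A k) \<omega> * (exp (- \<rho> * (h * real k)) * generator lam \<rho> v d (\<xi> (h * real k) \<omega>) (Y (h * real k) \<omega>))"
    have hk: "0 \<le> h * real k" "h * real k \<le> T" if "k < K" for k
    proof -
      have "h * real k \<le> h * real K" using that h by (intro mult_left_mono) auto
      then show "h * real k \<le> T" using K by linarith
    qed (use h in simp)
    have J: "\<bar>?J k - h * (\<integral>\<omega>. ?g k \<omega> \<partial>completion M)\<bar> \<le> e' * h" if "k < K" for k
      by (rule os[OF h hk[OF that] A[OF that]])
    have g: "(\<integral>\<omega>. ?g k \<omega> \<partial>completion M) \<le> 0" if "k < K" for k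
    proof -
      have "0 \<le> (\<integral>\<omega>. - ?g k \<omega> \<partial>completion M)"
      proof (rule Bochner_Integration.integral_nonneg)
        fix \<omega> assume "\<omega> \<in> space (completion M)"
        then have "generator lam \<rho> v d (\<xi> (h * real k) \<omega>) (Y (h * real k) \<omega>) \<le> 0"
          using hk[OF that] by (intro gen xi_state Y_nonneg) auto
        then show "0 \<le> - ?g k \<omega>" by (simp add: indicator_def mult_nonneg_nonpos)
      qed
      then show ?thesis by simp
    qed
    have tot: "(\<Sum>k<K. e' * h) \<le> e"
    proof -
      have "(\<Sum>k<K. e' * h) = e' * (h * real K)" by simp
      also have "\<dots> \<le> e' * T" using K e' by (intro mult_left_mono) auto
      also have "\<dots> \<le> e" by (rule e'(2))
      finally show ?thesis .
    qed
    have eq: "(\<integral>\<omega>. stopped \<rho> v h A K \<omega> \<partial>completion M) = v s y + (\<Sum>k<K. ?J k)"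
      by (rule stopped_completion(2)[OF fs \<rho> less_imp_le[OF h(1)] A])
    have "(\<Sum>k<K. ?J k) \<le> (\<Sum>k<K. e' * h)"
    proof (rule sum_mono)
      fix k assume "k \<in> {..<K}"
      then have k: "k < K" by simp
      have "h * (\<integral>\<omega>. ?g k \<omega> \<partial>completion M) \<le> 0" using g[OF k] h by (simp add: mult_nonneg_nonpos)
      then show "?J k \<le> e' * h" using J[OF k] by linarith
    qed
    then have "(\<integral>\<omega>. stopped \<rho> v h A K \<omega> \<partial>completion M) \<le> v s y + e" using tot eq by linarith
    moreover have "v s y - e \<le> (\<integral>\<omega>. stopped \<rho> v h A K \<omega> \<partial>completion M)"
      if z: "\<forall>k<K. \<forall>\<omega>\<in>A k. generator lam \<rho> v d (\<xi> (h * real k) \<omega>) (Y (h * real k) \<omega>) = 0"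
    proof -
      have "(\<Sum>k<K. - (e' * h)) \<le> (\<Sum>k<K. ?J k)"
      proof (rule sum_mono)
        fix k assume "k \<in> {..<K}"
        then have k: "k < K" by simp
        then have "?g k \<omega> = 0" for \<omega> using z by (auto simp: indicator_def)
        then have "(\<integral>\<omega>. ?g k \<omega> \<partial>completion M) = 0" by (simp only: Bochner_Integration.integral_zero)
        then show "- (e' * h) \<le> ?J k" using J[OF k] by simp
      qed
      then show ?thesis using tot eq by (simp add: sum_negf)
    qed
    ultimately show ?thesis by blast
  qed
  with h0 show ?thesis by (intro exI[of _ h0]) blast
qed

end

section \<open>Upper and lower bounds for the value function\<close>

context telegraph_price
begin

text \<open>States are isolated, so right continuity makes the state eventually constant along the
  sequence; the price is nondecreasing and squeezed by its largest growth rate. Convergence from the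
  right is enough, since stopping times are rounded up to a grid.\<close>

lemma discounted_right_limit:
  assumes fs: "flow_smooth \<mu> \<sigma> L v d" and \<omega>: "\<omega> \<in> space M" and t: "0 \<le> t"
    and x: "x \<longlonglongrightarrow> t" "\<And>n. t \<le> x n"
  shows "(\<lambda>n. discounted \<rho> v (x n) \<omega>) \<longlonglongrightarrow> discounted \<rho> v t \<omega>"
proof -
  have "continuous (at t within {t..}) (\<lambda>t. \<xi> t \<omega>)"
    using rcont[OF \<omega> t] by (simp add: continuous_within at_within_Ici_at_right)
  then have xi_lim: "(\<lambda>n. \<xi> (x n) \<omega>) \<longlonglongrightarrow> \<xi> t \<omega>"
    by (rule continuous_within_tendsto_compose') (use x in simp_all)
  have state: "\<xi> t \<omega> \<in> {-1,1}" "\<xi> (x n) \<omega> \<in> {-1,1}" for n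
    using xi_state[OF \<omega>] t order_trans[OF t x(2)] by blast+
  have "\<forall>\<^sub>F n in sequentially. dist (\<xi> (x n) \<omega>) (\<xi> t \<omega>) < 1"
    using xi_lim by (intro tendstoD) auto
  then have ev: "\<forall>\<^sub>F n in sequentially. \<xi> (x n) \<omega> = \<xi> t \<omega>"
  proof eventually_elim
    case (elim n)
    have "\<xi> (x n) \<omega> = -1 \<or> \<xi> (x n) \<omega> = 1" "\<xi> t \<omega> = -1 \<or> \<xi> t \<omega> = 1" using state by blast+
    then show ?case using elim by (elim disjE) (simp_all add: dist_real_def)
  qed
  have Ylim: "(\<lambda>n. Y (x n) \<omega>) \<longlonglongrightarrow> Y t \<omega>"
  proof (rule real_tendsto_sandwich)
    have "Y t \<omega> \<le> Y (x n) \<omega> \<and> Y (x n) \<omega> \<le> Y t \<omega> * exp ((\<mu> + \<sigma>) * (x n - t))" for n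
    proof -
      have h: "0 \<le> x n - t" using x(2)[of n] by simp
      note b = exponent_bounds[OF \<omega> t h]
      have "Y t \<omega> * 1 \<le> Y (t + (x n - t)) \<omega>"
        unfolding Y_add[OF \<omega> t h] using b Y_nonneg by (intro mult_left_mono) auto
      moreover have "Y (t + (x n - t)) \<omega> \<le> Y t \<omega> * exp ((\<mu> + \<sigma>) * (x n - t))"
        unfolding Y_add[OF \<omega> t h] using b Y_nonneg by (intro mult_left_mono) auto
      ultimately show ?thesis by simp
    qed
    then show "\<forall>\<^sub>F n in sequentially. Y t \<omega> \<le> Y (x n) \<omega>"
      "\<forall>\<^sub>F n in sequentially. Y (x n) \<omega> \<le> Y t \<omega> * exp ((\<mu> + \<sigma>) * (x n - t))"
      by auto
    have "(\<lambda>n. Y t \<omega> * exp ((\<mu> + \<sigma>) * (x n - t))) \<longlonglongrightarrow> Y t \<omega> * exp ((\<mu> + \<sigma>) * (t - t))"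
      by (intro tendsto_intros x)
    then show "(\<lambda>n. Y t \<omega> * exp ((\<mu> + \<sigma>) * (x n - t))) \<longlonglongrightarrow> Y t \<omega>" by simp
  qed simp
  have "continuous (at (Y t \<omega>)) (\<lambda>z. v (\<xi> t \<omega>) (max 0 z))"
    using flow_smooth_continuous(1)[OF fs state(1)] by (simp add: continuous_on_eq_continuous_at)
  from isCont_tendsto_compose[OF this Ylim]
  have "(\<lambda>n. v (\<xi> t \<omega>) (Y (x n) \<omega>)) \<longlonglongrightarrow> v (\<xi> t \<omega>) (Y t \<omega>)"
    using Y_nonneg by (simp add: max_absorb2)
  then have "(\<lambda>n. exp (- \<rho> * x n) * v (\<xi> t \<omega>) (Y (x n) \<omega>)) \<longlonglongrightarrow> exp (- \<rho> * t) * v (\<xi> t \<omega>) (Y t \<omega>)"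
    by (intro tendsto_intros x)
  then show ?thesis
    unfolding discounted_def
    by (rule Lim_transform_eventually) (use ev in \<open>eventually_elim, simp\<close>)
qed

lemma discounted_nonneg:
  assumes "\<And>i x. i \<in> {-1,1} \<Longrightarrow> 0 \<le> x \<Longrightarrow> 0 \<le> v i x" "\<omega> \<in> space M" "0 \<le> t"
  shows "0 \<le> discounted \<rho> v t \<omega>"
  unfolding discounted_def using assms xi_state Y_nonneg by simp

text \<open>The stopping time is rounded up to a grid and cut off at a horizon. Horizon, mesh and
  error all depend on the one index \<open>T\<close>, so that a single limit with Fatou's lemma
  suffices. Nonnegativity of \<open>v\<close> justifies the value 0 where \<open>\<tau>\<close> is
  infinite.\<close>

lemma nn_integral_stopped_le:
  assumes fs: "flow_smooth \<mu> \<sigma> L v d" and \<rho>: "0 \<le> \<rho>"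
    and gen: "\<And>i x. i \<in> {-1,1} \<Longrightarrow> 0 \<le> x \<Longrightarrow> generator lam \<rho> v d i x \<le> 0"
    and v: "\<And>i x. i \<in> {-1,1} \<Longrightarrow> 0 \<le> x \<Longrightarrow> 0 \<le> v i x"
    and \<tau>: "stopping_time (completed_filtration M \<xi>) \<tau>"
  shows "(\<integral>\<^sup>+\<omega>. (if \<tau> \<omega> = \<infinity> then 0 else ennreal (discounted \<rho> v (enn2real (\<tau> \<omega>)) \<omega>)) \<partial>completion M) \<le> ennreal (v s y)"
proof -
  \<comment> \<open>With the strict inequality this is the complement of the event that
    \<open>\<tau>\<close> is at most \<open>h * k\<close>, hence known at that time.\<close>
  define A where "A h k = {\<omega> \<in> space M. ennreal (h * real k) < \<tau> \<omega>}" for h and k :: nat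
  have A: "A h k \<in> sets (FC (ennreal (h * real k)))" for h k
    using stopping_timeD2[OF \<tau>, of "ennreal (h * real k)"] by (simp add: pred_def A_def)
  \<comment> \<open>With mesh \<open>1 / N\<close>, exactly \<open>T * N\<close> steps reach the
    horizon, and \<open>T < N\<close> makes the mesh tend to 0 as \<open>T\<close> grows.\<close>
  have "\<exists>N. T < N \<and> (\<integral>\<omega>. stopped \<rho> v (1 / real N) (A (1 / real N)) (T * N) \<omega> \<partial>completion M) \<le> v s y + 1 / real (Suc T)" for T :: nat
  proof -
    obtain h0 where h0: "h0 > 0" and up: "\<And>h K A. 0 < h \<Longrightarrow> h < h0 \<Longrightarrow> h * real K \<le> real T \<Longrightarrow>
       (\<And>k. k < K \<Longrightarrow> A k \<in> sets (FC (ennreal (h * real k)))) \<Longrightarrow>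
       (\<integral>\<omega>. stopped \<rho> v h A K \<omega> \<partial>completion M) \<le> v s y + 1 / real (Suc T)"
      using stopped_expectation[OF fs \<rho>, of "1 / real (Suc T)" "real T"] gen by auto
    obtain N0 :: nat where N0: "1 / h0 < real N0" using reals_Archimedean2 by blast
    define N where "N = N0 + Suc T"
    have N: "0 < real N" "1 / h0 < real N" using N0 by (auto simp: N_def)
    then have "1 / real N < h0" using h0 by (simp add: field_simps)
    moreover have "1 / real N * real (T * N) \<le> real T" using N by simp
    moreover have "0 < 1 / real N" using N by simp
    ultimately have "(\<integral>\<omega>. stopped \<rho> v (1 / real N) (A (1 / real N)) (T * N) \<omega> \<partial>completion M) \<le> v s y + 1 / real (Suc T)"
      by (intro up A)
    moreover have "T < N" by (simp add: N_def)
    ultimately show ?thesis by blast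
  qed
  then obtain N where N: "\<And>T. T < N T"
    "\<And>T. (\<integral>\<omega>. stopped \<rho> v (1 / real (N T)) (A (1 / real (N T))) (T * N T) \<omega> \<partial>completion M) \<le> v s y + 1 / real (Suc T)"
    by metis
  define h where "h T = 1 / real (N T)" for T
  define K where "K T = T * N T" for T
  define R where "R T = stopped \<rho> v (h T) (A (h T)) (K T)" for T
  have h: "0 < h T" "h T * real (K T) = real T" for T using N(1)[of T] by (auto simp: h_def K_def)
  have h_le: "h T \<le> 1 / real (Suc T)" for T
    using N(1)[of T] unfolding h_def by (intro divide_left_mono) auto
  have h0: "h \<longlonglongrightarrow> 0"
    by (rule real_tendsto_sandwich[OF always_eventually always_eventually tendsto_const LIMSEQ_inverse_real_of_nat])
      (use h h_le in \<open>auto simp: less_imp_le inverse_eq_divide\<close>)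
  have R_int: "integrable (completion M) (R T)" for T
    unfolding R_def using h A by (intro stopped_completion(1)[OF fs \<rho>]) (auto simp: less_imp_le)
  \<comment> \<open>The index of the first grid point not before \<open>\<tau>\<close>, so that
    \<open>\<tau>\<close> is approached from the right.\<close>
  define \<kappa> where "\<kappa> T \<omega> = nat \<lceil>enn2real (\<tau> \<omega>) / h T\<rceil>" for T \<omega>
  have fin: "R T \<omega> = discounted \<rho> v (h T * real (min (\<kappa> T \<omega>) (K T))) \<omega>" if \<omega>: "\<omega> \<in> space M" "\<tau> \<omega> < \<infinity>" for T \<omega>
    unfolding R_def
  proof (rule stopped_eq)
    fix k
    obtain t where t: "0 \<le> t" "\<tau> \<omega> = ennreal t" using \<omega> by (cases "\<tau> \<omega>") auto
    have "ennreal (h T * real k) < ennreal t \<longleftrightarrow> h T * real k < t"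
      using h[of T] t by (intro ennreal_less_iff) (auto simp: less_imp_le)
    also have "\<dots> \<longleftrightarrow> real k < t / h T" using h(1)[of T] by (simp add: field_simps)
    also have "\<dots> \<longleftrightarrow> int k < \<lceil>t / h T\<rceil>" by (simp add: less_ceiling_iff)
    also have "\<dots> \<longleftrightarrow> k < nat \<lceil>t / h T\<rceil>" by linarith
    finally show "\<omega> \<in> A (h T) k \<longleftrightarrow> k < \<kappa> T \<omega>" using \<omega> t by (simp add: A_def \<kappa>_def)
  qed
  have inf: "R T \<omega> = discounted \<rho> v (h T * real (min (K T) (K T))) \<omega>" if \<omega>: "\<omega> \<in> space M" "\<tau> \<omega> = \<infinity>" for T \<omega>
    unfolding R_def by (rule stopped_eq) (use \<omega> in \<open>auto simp: A_def\<close>)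
  have R_nonneg: "0 \<le> R T \<omega>" if \<omega>: "\<omega> \<in> space M" for T \<omega>
  proof (cases "\<tau> \<omega> = \<infinity>")
    case True
    show ?thesis unfolding inf[OF \<omega> True] using h(1)[of T] by (intro discounted_nonneg[OF v \<omega>]) auto
  next
    case False
    then have "\<tau> \<omega> < \<infinity>" by (simp add: less_top)
    show ?thesis unfolding fin[OF \<omega> \<open>\<tau> \<omega> < \<infinity>\<close>] using h(1)[of T] by (intro discounted_nonneg[OF v \<omega>]) auto
  qed
  have conv: "(\<lambda>T. R T \<omega>) \<longlonglongrightarrow> discounted \<rho> v (enn2real (\<tau> \<omega>)) \<omega>" if \<omega>: "\<omega> \<in> space M" "\<tau> \<omega> < \<infinity>" for \<omega>
  proof -
    obtain t where t: "0 \<le> t" "\<tau> \<omega> = ennreal t" using \<omega> by (cases "\<tau> \<omega>") auto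
    have \<kappa>: "t \<le> h T * real (\<kappa> T \<omega>)" "h T * real (\<kappa> T \<omega>) \<le> t + h T" for T
    proof -
      have q: "0 \<le> t / h T" using t h(1)[of T] by (simp add: less_imp_le)
      have r: "real (\<kappa> T \<omega>) = of_int \<lceil>t / h T\<rceil>" using q t by (simp add: \<kappa>_def)
      have "h T * (t / h T) \<le> h T * of_int \<lceil>t / h T\<rceil>" "h T * of_int \<lceil>t / h T\<rceil> \<le> h T * (t / h T + 1)"
        using h(1)[of T] by (intro mult_left_mono; linarith)+
      then show "t \<le> h T * real (\<kappa> T \<omega>)" "h T * real (\<kappa> T \<omega>) \<le> t + h T"
        unfolding r using h(1)[of T] by (auto simp: distrib_left)
    qed
    have "(\<lambda>T. t + h T) \<longlonglongrightarrow> t + 0" by (intro tendsto_intros h0)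
    then have up: "(\<lambda>T. t + h T) \<longlonglongrightarrow> t" by simp
    have "(\<lambda>T. h T * real (\<kappa> T \<omega>)) \<longlonglongrightarrow> t"
      by (rule real_tendsto_sandwich[OF always_eventually always_eventually tendsto_const up]) (use \<kappa> in auto)
    from discounted_right_limit[OF fs \<omega>(1) t(1) this \<kappa>(1)]
    have lim: "(\<lambda>T. discounted \<rho> v (h T * real (\<kappa> T \<omega>)) \<omega>) \<longlonglongrightarrow> discounted \<rho> v t \<omega>" .
    \<comment> \<open>Once the horizon exceeds \<open>t\<close>, the cut-off at \<open>K T\<close>
      is inactive.\<close>
    have "\<forall>\<^sub>F T in sequentially. discounted \<rho> v (h T * real (\<kappa> T \<omega>)) \<omega> = R T \<omega>"
    proof (rule eventually_mono[OF eventually_ge_at_top[of "nat \<lceil>t\<rceil>"]])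
      fix T assume "nat \<lceil>t\<rceil> \<le> T"
      then have "t \<le> real T" by linarith
      then have "t / h T \<le> real (K T)" using h[of T] by (simp add: field_simps)
      then have "\<kappa> T \<omega> \<le> K T" using t by (simp add: \<kappa>_def ceiling_le_iff nat_le_iff)
      then show "discounted \<rho> v (h T * real (\<kappa> T \<omega>)) \<omega> = R T \<omega>" unfolding fin[OF \<omega>] by (simp add: min_absorb1)
    qed
    from Lim_transform_eventually[OF lim this] show ?thesis using t by simp
  qed
  have "(\<integral>\<^sup>+\<omega>. (if \<tau> \<omega> = \<infinity> then 0 else ennreal (discounted \<rho> v (enn2real (\<tau> \<omega>)) \<omega>)) \<partial>completion M)
      \<le> (\<integral>\<^sup>+\<omega>. liminf (\<lambda>T. ennreal (R T \<omega>)) \<partial>completion M)"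
  proof (rule nn_integral_mono)
    fix \<omega> assume "\<omega> \<in> space (completion M)"
    then have \<omega>: "\<omega> \<in> space M" by simp
    show "(if \<tau> \<omega> = \<infinity> then 0 else ennreal (discounted \<rho> v (enn2real (\<tau> \<omega>)) \<omega>)) \<le> liminf (\<lambda>T. ennreal (R T \<omega>))"
    proof (cases "\<tau> \<omega> = \<infinity>")
      case False
      then have f: "\<tau> \<omega> < \<infinity>" by (simp add: less_top)
      have "(\<lambda>T. ennreal (R T \<omega>)) \<longlonglongrightarrow> ennreal (discounted \<rho> v (enn2real (\<tau> \<omega>)) \<omega>)"
        by (intro tendsto_ennrealI conv \<omega> f)
      then show ?thesis using False by (simp add: lim_imp_Liminf)
    qed simp
  qed
  also have "\<dots> \<le> liminf (\<lambda>T. \<integral>\<^sup>+\<omega>. ennreal (R T \<omega>) \<partial>completion M)"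
    using R_int by (intro nn_integral_liminf) (auto dest: borel_measurable_integrable)
  also have "\<dots> \<le> liminf (\<lambda>T. ennreal (v s y + 1 / real (Suc T)))"
  proof (rule Liminf_mono[OF always_eventually], rule allI)
    fix T
    have "(\<integral>\<^sup>+\<omega>. ennreal (R T \<omega>) \<partial>completion M) = ennreal (\<integral>\<omega>. R T \<omega> \<partial>completion M)"
      using R_nonneg by (intro nn_integral_eq_integral R_int AE_I2) auto
    also have "\<dots> \<le> ennreal (v s y + 1 / real (Suc T))"
      using N(2)[of T] unfolding R_def h_def K_def by (rule ennreal_leI)
    finally show "(\<integral>\<^sup>+\<omega>. ennreal (R T \<omega>) \<partial>completion M) \<le> ennreal (v s y + 1 / real (Suc T))" .
  qed
  also have "liminf (\<lambda>T. ennreal (v s y + 1 / real (Suc T))) = ennreal (v s y)"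
  proof (rule lim_imp_Liminf)
    have "(\<lambda>T. v s y + inverse (real (Suc T))) \<longlonglongrightarrow> v s y + 0"
      by (intro tendsto_add tendsto_const LIMSEQ_inverse_real_of_nat)
    then show "(\<lambda>T. ennreal (v s y + 1 / real (Suc T))) \<longlonglongrightarrow> ennreal (v s y)"
      by (intro tendsto_ennrealI) (simp add: inverse_eq_divide)
  qed simp
  finally show ?thesis .
qed

text \<open>Domination of the payoff bounds the positive part of the reward by the discounted
  \<open>v\<close> at the stopping time; the negative part is subtracted in
  \<open>ext_expectation\<close> and only lowers the value.\<close>

lemma value_function_le:
  assumes fs: "flow_smooth \<mu> \<sigma> L v d" and \<rho>: "0 \<le> \<rho>"
    and gen: "\<And>i x. i \<in> {-1,1} \<Longrightarrow> 0 \<le> x \<Longrightarrow> generator lam \<rho> v d i x \<le> 0"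
    and v: "\<And>i x. i \<in> {-1,1} \<Longrightarrow> 0 \<le> x \<Longrightarrow> 0 \<le> v i x"
    and dom: "\<And>i x. i \<in> {-1,1} \<Longrightarrow> 0 \<le> x \<Longrightarrow> x - a \<le> v i x"
    and s: "s \<in> {-1,1}"
  shows "value_function M \<xi> \<mu> \<sigma> a \<rho> y \<le> ereal (v s y)"
  unfolding value_function_def
proof (rule SUP_least)
  fix \<tau> assume "\<tau> \<in> {\<tau>. stopping_time (completed_filtration M \<xi>) \<tau>}"
  then have \<tau>: "stopping_time (completed_filtration M \<xi>) \<tau>" by simp
  let ?X = "\<lambda>\<omega>. reward \<xi> \<mu> \<sigma> a \<rho> y (\<tau> \<omega>) \<omega>"
  have "(\<integral>\<^sup>+\<omega>. ennreal (?X \<omega>) \<partial>completion M)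
      \<le> (\<integral>\<^sup>+\<omega>. (if \<tau> \<omega> = \<infinity> then 0 else ennreal (discounted \<rho> v (enn2real (\<tau> \<omega>)) \<omega>)) \<partial>completion M)"
  proof (rule nn_integral_mono)
    fix \<omega> assume "\<omega> \<in> space (completion M)"
    then have "Y (enn2real (\<tau> \<omega>)) \<omega> - a \<le> v (\<xi> (enn2real (\<tau> \<omega>)) \<omega>) (Y (enn2real (\<tau> \<omega>)) \<omega>)"
      by (intro dom xi_state Y_nonneg) auto
    then show "ennreal (?X \<omega>) \<le> (if \<tau> \<omega> = \<infinity> then 0 else ennreal (discounted \<rho> v (enn2real (\<tau> \<omega>)) \<omega>))"
      unfolding reward_def discounted_def by (auto intro!: ennreal_leI mult_left_mono)
  qed
  also have "\<dots> \<le> ennreal (v s y)" by (rule nn_integral_stopped_le[OF fs \<rho> gen v \<tau>])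
  finally have "enn2ereal (\<integral>\<^sup>+\<omega>. ennreal (?X \<omega>) \<partial>completion M) \<le> enn2ereal (ennreal (v s y))"
    by (simp add: less_eq_ennreal.rep_eq)
  also have "\<dots> = ereal (v s y)" using v[OF s y_nonneg] by (simp add: enn2ereal_ennreal)
  finally have "enn2ereal (\<integral>\<^sup>+\<omega>. ennreal (?X \<omega>) \<partial>completion M) \<le> ereal (v s y)" .
  from ereal_minus_mono[OF this enn2ereal_nonneg]
  show "ext_expectation (completion M) ?X \<le> ereal (v s y)"
    unfolding ext_expectation_def by simp
qed

text \<open>The hypothesis \<open>gen\<close> says that the linear function with weights
  \<open>c\<close> is superharmonic at the smaller rate \<open>\<rho>'\<close>, so its discounted
  mean stays bounded. Since \<open>v\<close> grows at most linearly in the price, the excess rate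
  \<open>\<rho> - \<rho>'\<close> yields exponential decay.\<close>

lemma expectation_tends_to_zero:
  assumes fs: "flow_smooth \<mu> \<sigma> L v d"
    and \<rho>': "0 \<le> \<rho>'" "\<rho>' < \<rho>"
    and c: "\<And>i. i \<in> {-1,1} \<Longrightarrow> 0 < c i"
    and gen: "\<And>i. i \<in> {-1,1} \<Longrightarrow> (\<mu> + \<sigma> * i) * c i + lam * (c (- i) - c i) - \<rho>' * c i \<le> 0"
  shows "(\<lambda>T::nat. \<integral>\<omega>. discounted \<rho> v (real T) \<omega> \<partial>completion M) \<longlonglongrightarrow> 0"
proof -
  define w where "w i x = c i * x" for i x :: real
  define dw where "dw i x = (\<mu> + \<sigma> * i) * c i * x" for i x :: real
  define L' where "L' = (\<Sum>i\<in>{-1,1}. \<bar>c i\<bar> + \<bar>(\<mu> + \<sigma> * i) * c i\<bar>)"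
  have L': "0 \<le> L'" "\<bar>c i\<bar> \<le> L'" "\<bar>(\<mu> + \<sigma> * i) * c i\<bar> \<le> L'" if "i \<in> {-1,1}" for i
    using that unfolding L'_def by auto
  have m: "0 < \<mu> + \<sigma> * i" if "i \<in> {-1,1}" for i using that sigma_nonneg sigma_less by auto
  have fw: "flow_smooth \<mu> \<sigma> L' w dw"
    unfolding flow_smooth_def
  proof (intro conjI ballI allI impI)
    show "0 \<le> L'" using L'(1)[of 1] by simp
  next
    fix i :: real assume i: "i \<in> {-1,1}"
    show "w i 0 = 0" "dw i 0 = 0" by (simp_all add: w_def dw_def)
    fix x z :: real
    have "\<bar>c i\<bar> * \<bar>x - z\<bar> \<le> L' * \<bar>x - z\<bar>" "\<bar>(\<mu> + \<sigma> * i) * c i\<bar> * \<bar>x - z\<bar> \<le> L' * \<bar>x - z\<bar>"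
      using L'[OF i] by (intro mult_right_mono; simp)+
    then show "\<bar>w i x - w i z\<bar> \<le> L' * \<bar>x - z\<bar>" "\<bar>dw i x - dw i z\<bar> \<le> L' * \<bar>x - z\<bar>"
      unfolding w_def dw_def right_diff_distrib[symmetric] abs_mult by simp_all
  next
    fix i x :: real assume i: "i \<in> {-1,1}" and x: "0 < x"
    have "dw i x / ((\<mu> + \<sigma> * i) * x) = c i" using m[OF i] x by (simp add: dw_def)
    then show "(w i has_real_derivative dw i x / ((\<mu> + \<sigma> * i) * x)) (at x)"
      unfolding w_def[abs_def] by (auto intro!: derivative_eq_intros)
  qed
  have gw: "generator lam \<rho>' w dw i x \<le> 0" if "i \<in> {-1,1}" "0 \<le> x" for i x
  proof -
    have "generator lam \<rho>' w dw i x = ((\<mu> + \<sigma> * i) * c i + lam * (c (- i) - c i) - \<rho>' * c i) * x"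
      unfolding generator_def w_def dw_def by (simp add: algebra_simps)
    then show ?thesis using gen[OF that(1)] that(2) by (simp add: mult_nonpos_nonneg)
  qed
  have Ew: "(\<integral>\<omega>. discounted \<rho>' w (real T) \<omega> \<partial>completion M) \<le> w s y + 1" for T :: nat
  proof -
    obtain h0 where h0: "h0 > 0" and up: "\<And>h K A. 0 < h \<Longrightarrow> h < h0 \<Longrightarrow> h * real K \<le> real T \<Longrightarrow>
       (\<And>k. k < K \<Longrightarrow> A k \<in> sets (FC (ennreal (h * real k)))) \<Longrightarrow>
       (\<integral>\<omega>. stopped \<rho>' w h A K \<omega> \<partial>completion M) \<le> w s y + 1"
      using stopped_expectation[OF fw \<rho>'(1), of 1 "real T"] gw by auto
    obtain N0 :: nat where N0: "1 / h0 < real N0" using reals_Archimedean2 by blast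
    define N where "N = Suc N0"
    have N: "0 < real N" "1 / h0 < real N" using N0 by (auto simp: N_def)
    then have hN: "0 < 1 / real N" "1 / real N < h0" using h0 by (simp_all add: field_simps)
    have TN: "1 / real N * real (T * N) = real T" using N by simp
    \<comment> \<open>With every \<open>A k\<close> the whole space nothing is ever stopped, and
      \<open>stopped\<close> is the value at the horizon.\<close>
    have S: "space M \<in> sets (FC t)" for t using sets.top[of "FC t"] by simp
    have "(\<integral>\<omega>. stopped \<rho>' w (1 / real N) (\<lambda>_. space M) (T * N) \<omega> \<partial>completion M) \<le> w s y + 1"
      by (rule up[OF hN]) (use TN S in auto)
    also have "(\<integral>\<omega>. stopped \<rho>' w (1 / real N) (\<lambda>_. space M) (T * N) \<omega> \<partial>completion M) = (\<integral>\<omega>. discounted \<rho>' w (real T) \<omega> \<partial>completion M)"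
    proof (rule Bochner_Integration.integral_cong)
      fix \<omega> assume "\<omega> \<in> space (completion M)"
      then have "stopped \<rho>' w (1 / real N) (\<lambda>_. space M) (T * N) \<omega> = discounted \<rho>' w (1 / real N * real (min (T * N) (T * N))) \<omega>"
        by (intro stopped_eq) auto
      then show "stopped \<rho>' w (1 / real N) (\<lambda>_. space M) (T * N) \<omega> = discounted \<rho>' w (real T) \<omega>"
        unfolding min.idem TN .
    qed simp
    finally show ?thesis .
  qed
  define c0 where "c0 = min (c (-1)) (c 1)"
  have c0: "0 < c0" "c0 \<le> c i" if "i \<in> {-1,1}" for i using c[of 1] c[of "-1"] that by (auto simp: c0_def)
  have L: "0 \<le> L" using fs unfolding flow_smooth_def by blast
  define D where "D = L / c0"
  have D: "0 \<le> D" using L c0(1)[of 1] by (simp add: D_def)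
  have pt: "\<bar>discounted \<rho> v (real T) \<omega>\<bar> \<le> D * exp (- (\<rho> - \<rho>') * real T) * discounted \<rho>' w (real T) \<omega>"
    if \<omega>: "\<omega> \<in> space M" for T :: nat and \<omega>
  proof -
    let ?i = "\<xi> (real T) \<omega>" and ?y = "Y (real T) \<omega>"
    have i: "?i \<in> {-1,1}" using \<omega> by (intro xi_state) auto
    have "\<bar>v ?i ?y\<bar> \<le> L * ?y" by (rule flow_smooth_abs(1)[OF fs i Y_nonneg])
    also have "\<dots> = D * (c0 * ?y)" using c0(1)[OF i] by (simp add: D_def)
    also have "\<dots> \<le> D * (c ?i * ?y)" using c0(2)[OF i] D Y_nonneg by (intro mult_left_mono mult_right_mono) auto
    finally have "\<bar>v ?i ?y\<bar> \<le> D * (c ?i * ?y)" .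
    then have "exp (- \<rho> * real T) * \<bar>v ?i ?y\<bar> \<le> exp (- \<rho> * real T) * (D * (c ?i * ?y))"
      by (intro mult_left_mono) auto
    moreover have "exp (- \<rho> * real T) = exp (- (\<rho> - \<rho>') * real T) * exp (- \<rho>' * real T)"
      by (simp add: algebra_simps flip: exp_add)
    ultimately show ?thesis
      unfolding discounted_def w_def abs_mult abs_exp_cancel by (simp only: mult_ac)
  qed
  have int_v: "integrable (completion M) (discounted \<rho> v (real T))" for T
    using discounted_integrable[OF fs, of "real T" \<rho>] discounted_M[OF fs, of "real T"] \<rho>' by (simp add: integrable_completion)
  have int_w: "integrable (completion M) (discounted \<rho>' w (real T))" for T
    using discounted_integrable[OF fw, of "real T" \<rho>'] discounted_M[OF fw, of "real T"] \<rho>' by (simp add: integrable_completion)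
  have bound: "\<bar>\<integral>\<omega>. discounted \<rho> v (real T) \<omega> \<partial>completion M\<bar> \<le> D * (w s y + 1) * exp (- (\<rho> - \<rho>') * real T)" for T :: nat
  proof -
    have "\<bar>\<integral>\<omega>. discounted \<rho> v (real T) \<omega> \<partial>completion M\<bar> \<le> (\<integral>\<omega>. \<bar>discounted \<rho> v (real T) \<omega>\<bar> \<partial>completion M)"
      by (rule integral_abs_bound)
    also have "\<dots> \<le> (\<integral>\<omega>. D * exp (- (\<rho> - \<rho>') * real T) * discounted \<rho>' w (real T) \<omega> \<partial>completion M)"
      using int_v int_w pt by (intro integral_mono) auto
    also have "\<dots> = D * exp (- (\<rho> - \<rho>') * real T) * (\<integral>\<omega>. discounted \<rho>' w (real T) \<omega> \<partial>completion M)" by simp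
    also have "\<dots> \<le> D * exp (- (\<rho> - \<rho>') * real T) * (w s y + 1)"
      using D Ew by (intro mult_left_mono mult_nonneg_nonneg) auto
    finally show ?thesis by (simp add: mult_ac)
  qed
  have "(\<lambda>T. exp (- (\<rho> - \<rho>') * real T)) \<longlonglongrightarrow> 0"
  proof -
    have "(\<lambda>T. exp (- (\<rho> - \<rho>')) ^ T) \<longlonglongrightarrow> 0" using \<rho>' by (intro LIMSEQ_realpow_zero) auto
    then show ?thesis by (simp only: exp_of_nat2_mult[symmetric])
  qed
  then have "(\<lambda>T. D * (w s y + 1) * exp (- (\<rho> - \<rho>') * real T)) \<longlonglongrightarrow> D * (w s y + 1) * 0"
    by (intro tendsto_intros)
  then have z: "(\<lambda>T. D * (w s y + 1) * exp (- (\<rho> - \<rho>') * real T)) \<longlonglongrightarrow> 0" by simp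
  show ?thesis by (rule Lim_null_comparison[OF always_eventually z]) (use bound in simp)
qed

text \<open>The competitor stops at the first grid point where the chain is down and the price is at
  least \<open>u\<close>. Before that the generator vanishes, so only the discretisation error is
  lost; paths not stopped by the horizon cost at most the mean of the discounted \<open>v\<close>
  there, which \<open>decay\<close> makes small.\<close>

lemma value_function_ge:
  assumes fs: "flow_smooth \<mu> \<sigma> L v d" and \<rho>: "0 \<le> \<rho>"
    and gen: "\<And>i x. i \<in> {-1,1} \<Longrightarrow> 0 \<le> x \<Longrightarrow> generator lam \<rho> v d i x \<le> 0"
    and gen0: "\<And>i x. i \<in> {-1,1} \<Longrightarrow> 0 \<le> x \<Longrightarrow> \<not> (i = -1 \<and> u \<le> x) \<Longrightarrow> generator lam \<rho> v d i x = 0"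
    and v: "\<And>i x. i \<in> {-1,1} \<Longrightarrow> 0 \<le> x \<Longrightarrow> 0 \<le> v i x"
    and stop: "\<And>x. u \<le> x \<Longrightarrow> v (-1) x = x - a" and u: "0 \<le> a" "a \<le> u"
    and decay: "(\<lambda>T::nat. \<integral>\<omega>. discounted \<rho> v (real T) \<omega> \<partial>completion M) \<longlonglongrightarrow> 0"
  shows "ereal (v s y) \<le> value_function M \<xi> \<mu> \<sigma> a \<rho> y"
proof (rule ereal_le_epsilon2)
  fix e :: real assume e: "0 < e"
  have "\<forall>\<^sub>F T in sequentially. (\<integral>\<omega>. discounted \<rho> v (real T) \<omega> \<partial>completion M) < e / 2"
    using e by (intro order_tendstoD[OF decay]) auto
  then obtain T :: nat where T: "(\<integral>\<omega>. discounted \<rho> v (real T) \<omega> \<partial>completion M) < e / 2"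
    by (auto simp: eventually_sequentially)
  obtain h0 where h0: "h0 > 0" and lo: "\<And>h K A. 0 < h \<Longrightarrow> h < h0 \<Longrightarrow> h * real K \<le> real T \<Longrightarrow>
     (\<And>k. k < K \<Longrightarrow> A k \<in> sets (FC (ennreal (h * real k)))) \<Longrightarrow>
     (\<And>k \<omega>. k < K \<Longrightarrow> \<omega> \<in> A k \<Longrightarrow> generator lam \<rho> v d (\<xi> (h * real k) \<omega>) (Y (h * real k) \<omega>) = 0) \<Longrightarrow>
     v s y - e / 2 \<le> (\<integral>\<omega>. stopped \<rho> v h A K \<omega> \<partial>completion M)"
    using stopped_expectation[OF fs \<rho>, of "e / 2" "real T"] gen e by auto
  obtain N0 :: nat where N0: "1 / h0 < real N0" using reals_Archimedean2 by blast
  define h where "h = 1 / real (Suc N0)"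
  define K where "K = T * Suc N0"
  have "1 / h0 < real (Suc N0)" using N0 by simp
  then have h: "0 < h" "h < h0" using h0 by (simp_all add: h_def field_simps)
  have hK: "h * real K = real T" unfolding h_def K_def of_nat_mult by simp
  define St where "St k \<omega> \<longleftrightarrow> \<xi> (h * real k) \<omega> = -1 \<and> u \<le> Y (h * real k) \<omega>" for k \<omega>
  \<comment> \<open>The index \<open>k\<close> itself is included, so the generator vanishes at time
    \<open>h * k\<close> on \<open>A k\<close>.\<close>
  define A where "A k = {\<omega> \<in> space M. \<forall>j\<le>k. \<not> St j \<omega>}" for k
  define n where "n \<omega> = (LEAST k. St k \<omega>)" for \<omega>
  define \<tau> where "\<tau> \<omega> = (if \<exists>k. St k \<omega> then ennreal (h * real (n \<omega>)) else \<infinity>)" for \<omega>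
  have St_sets: "{\<omega> \<in> space M. St k \<omega>} \<in> sets (FC t)" if "ennreal (h * real k) \<le> t" for k t
  proof -
    have [measurable]: "\<xi> (h * real k) \<in> borel_measurable (F (h * real k))" "Y (h * real k) \<in> borel_measurable (F (h * real k))"
      using h by (auto intro: xi_F Y_F)
    have "{\<omega> \<in> space (F (h * real k)). St k \<omega>} \<in> sets (F (h * real k))"
      unfolding St_def by measurable
    then show ?thesis using sets_F_FC sets_FC_mono[OF that] by auto
  qed
  have A: "A k \<in> sets (FC (ennreal (h * real k)))" for k
  proof -
    have "(\<Union>j\<le>k. {\<omega> \<in> space M. St j \<omega>}) \<in> sets (FC (ennreal (h * real k)))"
      using h by (intro sets.finite_UN St_sets ennreal_leI) auto
    from sets.compl_sets[OF this] show ?thesis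
      by (rule back_subst[of "\<lambda>X. X \<in> sets (FC (ennreal (h * real k)))"]) (auto simp: A_def)
  qed
  have \<tau>_le: "\<tau> \<omega> \<le> t \<longleftrightarrow> (\<exists>k. ennreal (h * real k) \<le> t \<and> St k \<omega>)" if t: "t < \<infinity>" for \<omega> t
  proof
    assume "\<tau> \<omega> \<le> t"
    then have ex: "\<exists>k. St k \<omega>" using t by (auto simp: \<tau>_def top_unique split: if_splits)
    have "St (n \<omega>) \<omega>" unfolding n_def using ex by (rule LeastI_ex)
    moreover have "ennreal (h * real (n \<omega>)) \<le> t" using \<open>\<tau> \<omega> \<le> t\<close> ex by (simp add: \<tau>_def)
    ultimately show "\<exists>k. ennreal (h * real k) \<le> t \<and> St k \<omega>" by blast
  next
    assume "\<exists>k. ennreal (h * real k) \<le> t \<and> St k \<omega>"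
    then obtain k where k: "ennreal (h * real k) \<le> t" "St k \<omega>" by blast
    have "n \<omega> \<le> k" unfolding n_def by (rule Least_le) (rule k)
    then have "ennreal (h * real (n \<omega>)) \<le> ennreal (h * real k)" using h by (intro ennreal_leI mult_left_mono) auto
    with k show "\<tau> \<omega> \<le> t" unfolding \<tau>_def by auto
  qed
  have \<tau>: "stopping_time (completed_filtration M \<xi>) \<tau>"
  proof
    fix t
    show "Measurable.pred (FC t) (\<lambda>\<omega>. \<tau> \<omega> \<le> t)"
    proof (cases "t = \<infinity>")
      case True then show ?thesis by simp
    next
      case False
      then have t: "t < \<infinity>" by (simp add: less_top)
      have "{\<omega> \<in> space (FC t). \<tau> \<omega> \<le> t} = (\<Union>k\<in>{k. ennreal (h * real k) \<le> t}. {\<omega> \<in> space M. St k \<omega>})"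
        unfolding \<tau>_le[OF t] by auto
      also have "\<dots> \<in> sets (FC t)" using St_sets by (intro sets.countable_UN'') auto
      finally show ?thesis by (simp add: pred_def)
    qed
  qed
  have nSt: "k < n \<omega> \<longleftrightarrow> (\<forall>j\<le>k. \<not> St j \<omega>)" if "\<exists>k. St k \<omega>" for k \<omega>
    unfolding n_def using LeastI_ex[OF that] not_less_Least[of _ "\<lambda>k. St k \<omega>"]
    by (meson le_less_trans not_less)
  let ?X = "\<lambda>\<omega>. reward \<xi> \<mu> \<sigma> a \<rho> y (\<tau> \<omega>) \<omega>"
  \<comment> \<open>If no stop occurs by the horizon, \<open>?f\<close> is 0 and the reward is still
    nonnegative because \<open>a \<le> u\<close>. Otherwise \<open>stopped\<close> is the reward
    itself and the subtracted term is nonnegative.\<close>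
  let ?f = "\<lambda>\<omega>. stopped \<rho> v h A K \<omega> - discounted \<rho> v (real T) \<omega>"
  have X: "0 \<le> ?X \<omega>" "?f \<omega> \<le> ?X \<omega>" if \<omega>: "\<omega> \<in> space M" for \<omega>
  proof -
    have Z: "0 \<le> discounted \<rho> v (real T) \<omega>" by (rule discounted_nonneg[OF v \<omega>]) auto
    have "0 \<le> ?X \<omega> \<and> ?f \<omega> \<le> ?X \<omega>"
    proof (cases "\<exists>k. St k \<omega>")
      case True
      have St: "St (n \<omega>) \<omega>" unfolding n_def by (rule LeastI_ex) (rule True)
      have hn: "0 \<le> h * real (n \<omega>)" using h by simp
      have Xeq: "?X \<omega> = exp (- \<rho> * (h * real (n \<omega>))) * (Y (h * real (n \<omega>)) \<omega> - a)"
        using True hn by (simp add: reward_def \<tau>_def)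
      have "?X \<omega> = discounted \<rho> v (h * real (n \<omega>)) \<omega>"
        unfolding Xeq discounted_def using St stop unfolding St_def by simp
      moreover have X0: "0 \<le> ?X \<omega>" unfolding Xeq using St u unfolding St_def by simp
      moreover have "stopped \<rho> v h A K \<omega> = discounted \<rho> v (h * real (min (n \<omega>) K)) \<omega>"
        by (rule stopped_eq) (use \<omega> nSt[OF True] in \<open>simp add: A_def\<close>)
      ultimately show ?thesis using Z hK by (cases "n \<omega> \<le> K") (simp_all add: min_absorb1 min_absorb2)
    next
      case False
      have "stopped \<rho> v h A K \<omega> = discounted \<rho> v (h * real (min K K)) \<omega>"
        by (rule stopped_eq) (use \<omega> False in \<open>simp add: A_def\<close>)
      moreover have "?X \<omega> = 0" using False by (simp add: reward_def \<tau>_def)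
      ultimately show ?thesis using hK by simp
    qed
    then show "0 \<le> ?X \<omega>" "?f \<omega> \<le> ?X \<omega>" by blast+
  qed
  have int: "integrable (completion M) (stopped \<rho> v h A K)" "integrable (completion M) (discounted \<rho> v (real T))"
    using stopped_completion(1)[OF fs \<rho> less_imp_le[OF h(1)] A] discounted_integrable[OF fs, of "real T" \<rho>] discounted_M[OF fs, of "real T"] \<rho>
    by (simp_all add: integrable_completion)
  have g0: "generator lam \<rho> v d (\<xi> (h * real k) \<omega>) (Y (h * real k) \<omega>) = 0" if "\<omega> \<in> A k" for k \<omega>
    using that h by (intro gen0 xi_state Y_nonneg) (auto simp: A_def St_def)
  have "v s y - e / 2 \<le> (\<integral>\<omega>. stopped \<rho> v h A K \<omega> \<partial>completion M)"
    by (rule lo[OF h]) (use hK A g0 in auto)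
  then have "v s y - e \<le> (\<integral>\<omega>. ?f \<omega> \<partial>completion M)" using T int by simp
  also have "\<dots> \<le> enn2real (\<integral>\<^sup>+\<omega>. ennreal (?f \<omega>) \<partial>completion M)"
    using int by (subst real_lebesgue_integral_def) auto
  finally have "ereal (v s y - e) \<le> ereal (enn2real (\<integral>\<^sup>+\<omega>. ennreal (?f \<omega>) \<partial>completion M))" by simp
  also have "\<dots> \<le> enn2ereal (\<integral>\<^sup>+\<omega>. ennreal (?f \<omega>) \<partial>completion M)"
    by (cases "\<integral>\<^sup>+\<omega>. ennreal (?f \<omega>) \<partial>completion M") (simp_all add: enn2ereal_ennreal)
  also have "\<dots> \<le> enn2ereal (\<integral>\<^sup>+\<omega>. ennreal (?X \<omega>) \<partial>completion M)"
    unfolding less_eq_ennreal.rep_eq[symmetric] using X by (intro nn_integral_mono ennreal_leI) simp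
  also have "\<dots> = ext_expectation (completion M) ?X"
  proof -
    have "(\<integral>\<^sup>+\<omega>. ennreal (- ?X \<omega>) \<partial>completion M) = (\<integral>\<^sup>+\<omega>. 0 \<partial>completion M)"
      using X(1) by (intro nn_integral_cong) (simp add: ennreal_neg)
    then show ?thesis unfolding ext_expectation_def by (simp add: zero_ennreal.rep_eq)
  qed
  also have "\<dots> \<le> value_function M \<xi> \<mu> \<sigma> a \<rho> y"
    unfolding value_function_def using \<tau> by (intro SUP_upper) simp
  finally have "ereal (v s y - e) + ereal e \<le> value_function M \<xi> \<mu> \<sigma> a \<rho> y + ereal e"
    by (intro add_right_mono)
  then show "ereal (v s y) \<le> value_function M \<xi> \<mu> \<sigma> a \<rho> y + ereal e" by simp
qed

end

section \<open>The explicit solution\<close>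

lemma DERIV_powr_pos: "0 < x \<Longrightarrow> ((\<lambda>x. x powr r) has_real_derivative r * x powr r / x) (at x)" for x r :: real
  using has_real_derivative_powr[of x r] by (simp add: powr_diff powr_one)

text \<open>The mean value theorem asks for differentiability only inside the interval, so the left
  end may be 0.\<close>

lemma powr_increment:
  fixes x z r :: real
  assumes "0 \<le> x" "x < z" "0 < r"
  shows "\<exists>c. x < c \<and> c < z \<and> z powr r - x powr r = (z - x) * (r * c powr (r - 1))"
proof -
  have "continuous_on {x..z} (\<lambda>x. x powr r)" using assms by (intro continuous_on_powr' continuous_intros) auto
  moreover have "(\<lambda>x. x powr r) differentiable at c" if "x < c" "c < z" for c
    using has_real_derivative_powr[of c r] that assms unfolding real_differentiable_def by auto
  ultimately obtain l c where c: "x < c" "c < z" "DERIV (\<lambda>x. x powr r) c :> l" "z powr r - x powr r = (z - x) * l"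
    using MVT[OF assms(2), of "\<lambda>x. x powr r"] by blast
  have "l = r * c powr (r - 1)"
    using c assms by (intro DERIV_unique[OF c(3) has_real_derivative_powr]) auto
  with c show ?thesis by blast
qed

text \<open>For \<open>r > 1\<close> the slope increases in the argument, so on
  \<open>{0..u}\<close> it is bounded by its value at \<open>u\<close>; an exponent below 1 would
  have unbounded slope near 0.\<close>

lemma powr_lipschitz:
  fixes r u :: real
  assumes r: "1 < r" and u: "0 \<le> u"
  shows "(r * u powr (r - 1))-lipschitz_on {0..u} (\<lambda>x. x powr r)"
proof (rule lipschitz_onI)
  have *: "\<bar>x powr r - z powr r\<bar> \<le> r * u powr (r - 1) * \<bar>x - z\<bar>" if xz: "0 \<le> x" "x < z" "z \<le> u" for x z
  proof -
    obtain c where c: "x < c" "c < z" "z powr r - x powr r = (z - x) * (r * c powr (r - 1))"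
      using powr_increment[OF xz(1,2), of r] r by auto
    have "c powr (r - 1) \<le> u powr (r - 1)" using c xz r by (intro powr_mono2) auto
    then have "(z - x) * (r * c powr (r - 1)) \<le> (z - x) * (r * u powr (r - 1))"
      using xz r by (intro mult_left_mono) auto
    moreover have "0 \<le> (z - x) * (r * c powr (r - 1))" using xz r by simp
    moreover have "\<bar>x - z\<bar> = z - x" "\<bar>x powr r - z powr r\<bar> = \<bar>z powr r - x powr r\<bar>" using xz by auto
    ultimately show ?thesis using c(3) by (simp add: mult_ac)
  qed
  fix x z assume "x \<in> {0..u}" "z \<in> {0..u}"
  then show "dist (x powr r) (z powr r) \<le> r * u powr (r - 1) * dist x z"
    unfolding dist_real_def using *[of x z] *[of z x] r
    by (cases x z rule: linorder_cases) (auto simp: abs_minus_commute)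
qed (use r in simp)

text \<open>Strict convexity. The slope is written \<open>r * u powr r / u\<close> so that a
  combination of tangents can be read off the smooth-fit identities.\<close>

lemma powr_above_tangent:
  fixes r u y :: real
  assumes "1 < r" "0 \<le> y" "y < u"
  shows "u powr r + r * u powr r / u * (y - u) < y powr r"
proof -
  obtain c where c: "y < c" "c < u" "u powr r - y powr r = (u - y) * (r * c powr (r - 1))"
    using powr_increment[OF assms(2,3), of r] assms by auto
  have "c powr (r - 1) < u powr (r - 1)" using c assms by (intro powr_less_mono2) auto
  then have "(u - y) * (r * c powr (r - 1)) < (u - y) * (r * u powr (r - 1))"
    using assms by (intro mult_strict_left_mono) auto
  moreover have "u powr (r - 1) = u powr r / u" using assms by (simp add: powr_diff)
  moreover have "r * u powr r / u * (y - u) = - ((u - y) * (r * (u powr r / u)))"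
    by (simp add: algebra_simps diff_divide_distrib)
  ultimately show ?thesis using c(3) by simp
qed

text \<open>After \<open>y powr r1\<close> is factored out, the rest is nonincreasing in
  \<open>y\<close> because \<open>e \<le> 0\<close>, so its sign at \<open>u\<close> decides the
  whole interval.\<close>

lemma powr_combination_nonneg:
  fixes c e r1 r2 u y :: real
  assumes "e \<le> 0" "r1 \<le> r2" "0 \<le> y" "y \<le> u" "0 < u" and end_nonneg: "0 \<le> c * u powr r1 + e * u powr r2"
  shows "0 \<le> c * y powr r1 + e * y powr r2"
proof -
  have "0 \<le> u powr r1 * (c + e * u powr (r2 - r1))"
    using end_nonneg assms(5) by (simp add: algebra_simps flip: powr_add)
  then have "0 \<le> c + e * u powr (r2 - r1)" using assms(5) by (simp add: zero_le_mult_iff)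
  also have "\<dots> \<le> c + e * y powr (r2 - r1)"
    using assms by (intro add_left_mono mult_left_mono_neg powr_mono2) auto
  finally have "0 \<le> y powr r1 * (c + e * y powr (r2 - r1))" by simp
  also have "\<dots> = c * y powr r1 + e * y powr r2"
    by (cases "y = 0") (auto simp: algebra_simps simp flip: powr_add)
  finally show ?thesis .
qed

text \<open>One shape serves value and slope: under smooth fit, \<open>x\<close> times the
  derivative is again of this form, with each coefficient multiplied by its exponent and
  \<open>q = 0\<close>.\<close>

definition spliced :: "real \<Rightarrow> real \<Rightarrow> real \<Rightarrow> real \<Rightarrow> real \<Rightarrow> real \<Rightarrow> real \<Rightarrow> real \<Rightarrow> real" where
  "spliced u r1 r2 c1 c2 k q x = (if x \<le> u then c1 * x powr r1 + c2 * x powr r2 else k * x + q)"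

lemma spliced_lipschitz:
  assumes r: "1 < r1" "1 < r2" and u: "0 < u" and cont: "c1 * u powr r1 + c2 * u powr r2 = k * u + q"
  shows "\<exists>L\<ge>0. \<forall>x\<ge>0. \<forall>z\<ge>0. \<bar>spliced u r1 r2 c1 c2 k q x - spliced u r1 r2 c1 c2 k q z\<bar> \<le> L * \<bar>x - z\<bar>"
proof -
  let ?f = "\<lambda>x. c1 * x powr r1 + c2 * x powr r2" and ?g = "\<lambda>x. k * x + q"
  define L1 where "L1 = \<bar>c1\<bar> * (r1 * u powr (r1 - 1)) + \<bar>c2\<bar> * (r2 * u powr (r2 - 1))"
  define L where "L = max L1 \<bar>k\<bar>"
  have "L1-lipschitz_on {0..u} ?f"
    unfolding L1_def using u r
    by (intro lipschitz_on_add lipschitz_on_cmult_real powr_lipschitz) auto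
  then have f: "L-lipschitz_on {0..u} ?f" by (rule lipschitz_on_mono) (auto simp: L_def)
  have g: "L-lipschitz_on {u..B} ?g" for B
  proof (rule lipschitz_onI)
    fix x z
    have "\<bar>k\<bar> * \<bar>x - z\<bar> \<le> L * \<bar>x - z\<bar>" by (intro mult_right_mono) (auto simp: L_def)
    then show "dist (?g x) (?g z) \<le> L * dist x z"
      by (simp add: dist_real_def abs_mult flip: right_diff_distrib)
  qed (auto simp: L_def)
  have "\<bar>spliced u r1 r2 c1 c2 k q x - spliced u r1 r2 c1 c2 k q z\<bar> \<le> L * \<bar>x - z\<bar>" if "0 \<le> x" "0 \<le> z" for x z
  proof -
    have "L-lipschitz_on {0..max u (max x z)} (\<lambda>x. if x \<le> u then ?f x else ?g x)"
      by (rule lipschitz_on_concat[OF f g cont])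
    from lipschitz_onD[OF this, of x z] show ?thesis
      using that u by (simp add: dist_real_def spliced_def)
  qed
  moreover have "0 \<le> L" by (auto simp: L_def)
  ultimately show ?thesis by blast
qed

text \<open>The only delicate point is \<open>u\<close>: \<open>cont\<close> lets the affine branch
  be used from the right, and \<open>smooth\<close> gives the power branch the same slope
  \<open>k\<close> from the left.\<close>

lemma spliced_derivative:
  assumes u: "0 < u" and cont: "c1 * u powr r1 + c2 * u powr r2 = k * u + q"
    and smooth: "c1 * r1 * u powr r1 + c2 * r2 * u powr r2 = k * u" and x: "0 < x"
  shows "(spliced u r1 r2 c1 c2 k q has_real_derivative spliced u r1 r2 (c1 * r1) (c2 * r2) k 0 x / x) (at x)"
proof -
  let ?f = "\<lambda>x. c1 * x powr r1 + c2 * x powr r2" and ?g = "\<lambda>x. k * x + q"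
  have f: "(?f has_real_derivative (c1 * r1 * z powr r1 + c2 * r2 * z powr r2) / z) (at z)" if "0 < z" for z
  proof -
    have "(?f has_real_derivative c1 * (r1 * z powr r1 / z) + c2 * (r2 * z powr r2 / z)) (at z)"
      by (intro DERIV_add DERIV_cmult DERIV_powr_pos that)
    then show ?thesis by (simp only: add_divide_distrib mult.assoc times_divide_eq_right)
  qed
  have g: "(?g has_real_derivative k) (at z)" for z by (auto intro!: derivative_eq_intros)
  consider "x < u" | "x > u" | "x = u" by linarith
  then show ?thesis
  proof cases
    case 1
    have "(spliced u r1 r2 c1 c2 k q has_real_derivative (c1 * r1 * x powr r1 + c2 * r2 * x powr r2) / x) (at x)"
      by (rule has_field_derivative_transform_within_open[OF f[OF x], of "{..<u}"]) (use 1 in \<open>auto simp: spliced_def\<close>)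
    then show ?thesis using 1 by (simp add: spliced_def)
  next
    case 2
    have "(spliced u r1 r2 c1 c2 k q has_real_derivative k) (at x)"
      by (rule has_field_derivative_transform_within_open[OF g, of "{u<..}"]) (use 2 in \<open>auto simp: spliced_def\<close>)
    then show ?thesis using 2 x by (simp add: spliced_def)
  next
    case 3
    have fu: "(?f has_real_derivative k) (at u)" using f[OF u] smooth u by simp
    have "(spliced u r1 r2 c1 c2 k q has_real_derivative k) (at u within {..u})"
      by (rule has_field_derivative_transform_within[OF has_field_derivative_at_within[OF fu], of 1]) (auto simp: spliced_def)
    moreover have "(spliced u r1 r2 c1 c2 k q has_real_derivative k) (at u within {u..})"
      by (rule has_field_derivative_transform_within[OF has_field_derivative_at_within[OF g], of 1])
        (use cont in \<open>auto simp: spliced_def\<close>)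
    ultimately have "(spliced u r1 r2 c1 c2 k q has_real_derivative k) (at u within {..u} \<union> {u..})"
      by (simp add: has_field_derivative_iff Lim_within_Un)
    moreover have "{..u} \<union> {u..} = UNIV" by auto
    ultimately show ?thesis using 3 u smooth by (simp add: spliced_def)
  qed
qed

text \<open>The second inequality says that the determinant of \<open>\<rho>\<close> minus the
  matrix of the mean price dynamics is positive, as it is for a rate beyond the larger eigenvalue.
  The rate is arbitrary here because the decay argument uses a smaller one than that of the
  problem.\<close>

lemma discount_bounds:
  fixes lam \<mu> \<sigma> \<rho> :: real
  assumes "\<sigma> > 0" "\<rho> > \<mu> - lam + sqrt (\<sigma>\<^sup>2 + lam\<^sup>2)"
  shows "0 < lam + \<rho> - (\<mu> + \<sigma>)" "lam\<^sup>2 < (lam + \<rho> - (\<mu> + \<sigma>)) * (lam + \<rho> - (\<mu> - \<sigma>))"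
proof -
  have "\<sigma> \<le> sqrt (\<sigma>\<^sup>2 + lam\<^sup>2)" by (rule real_le_rsqrt) simp
  then show "0 < lam + \<rho> - (\<mu> + \<sigma>)" using assms by linarith
  have "(sqrt (\<sigma>\<^sup>2 + lam\<^sup>2))\<^sup>2 < (lam + \<rho> - \<mu>)\<^sup>2"
    using assms by (intro power_strict_mono) auto
  then have "\<sigma>\<^sup>2 + lam\<^sup>2 < (lam + \<rho> - \<mu>)\<^sup>2" by simp
  then show "lam\<^sup>2 < (lam + \<rho> - (\<mu> + \<sigma>)) * (lam + \<rho> - (\<mu> - \<sigma>))"
    by (simp add: power2_eq_square algebra_simps)
qed

section \<open>The candidate: exponents, coefficients, fit at the threshold and generator\<close>

locale stopping_problem =
  fixes lam \<mu> \<sigma> a \<rho> :: real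
  assumes lam: "lam > 0" and mu: "\<mu> > 0" and sigma: "\<sigma> > 0" and a: "a > 0" and rho: "\<rho> > 0"
    and discount: "\<rho> > \<mu> - lam + sqrt (\<sigma>\<^sup>2 + lam\<^sup>2)" and rho_le: "\<rho> \<le> \<mu> + \<sigma>" and drift: "\<mu> - \<sigma> > 0"
begin

abbreviation "\<Lambda> \<equiv> lam + \<rho>"
abbreviation "mp \<equiv> \<mu> + \<sigma>"
abbreviation "mm \<equiv> \<mu> - \<sigma>"

definition "b = lam / (\<Lambda> - mp)"
definition "\<Omega>p = ((lam + \<rho>) * \<mu> + sqrt (lam\<^sup>2 * \<mu>\<^sup>2 + \<sigma>\<^sup>2 * (\<rho>\<^sup>2 + 2 * lam * \<rho>))) / (\<mu>\<^sup>2 - \<sigma>\<^sup>2)"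
definition "\<Omega>m = ((lam + \<rho>) * \<mu> - sqrt (lam\<^sup>2 * \<mu>\<^sup>2 + \<sigma>\<^sup>2 * (\<rho>\<^sup>2 + 2 * lam * \<rho>))) / (\<mu>\<^sup>2 - \<sigma>\<^sup>2)"
definition "\<omega>p = 1 + \<rho> / lam - (\<mu> + \<sigma>) / lam * \<Omega>p"
definition "\<omega>m = 1 + \<rho> / lam - (\<mu> + \<sigma>) / lam * \<Omega>m"

text \<open>The point where the generator applied to the payoff in the down state changes sign.\<close>
definition "u = a * ((\<Lambda>\<^sup>2 - lam\<^sup>2) * (\<Lambda> - mp)) / (\<Lambda> * ((\<Lambda> - mp) * (\<Lambda> - mm) - lam\<^sup>2))"
text \<open>\<open>\<alpha>\<close> and \<open>\<beta>\<close> are \<open>Cm * \<omega>m\<close> and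
  \<open>Cp * \<omega>p\<close> of the theorem: they solve the two linear equations that give the
  down state the value \<open>u - a\<close> and the slope 1 at \<open>u\<close>.\<close>

definition "\<alpha> = u powr (- \<Omega>m) * ((u * (\<Omega>p - 1) - a * \<Omega>p) / (\<Omega>p - \<Omega>m))"
definition "\<beta> = u powr (- \<Omega>p) * ((a * \<Omega>m - u * (\<Omega>m - 1)) / (\<Omega>p - \<Omega>m))"

definition "v i = (if i = 1 then spliced u \<Omega>m \<Omega>p (\<alpha> / \<omega>m) (\<beta> / \<omega>p) b (- (a * lam / \<Lambda>))
   else spliced u \<Omega>m \<Omega>p \<alpha> \<beta> 1 (- a))" for i :: real
definition "d i x = (\<mu> + \<sigma> * i) * (if i = 1 then spliced u \<Omega>m \<Omega>p (\<alpha> / \<omega>m * \<Omega>m) (\<beta> / \<omega>p * \<Omega>p) b 0 x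
   else spliced u \<Omega>m \<Omega>p (\<alpha> * \<Omega>m) (\<beta> * \<Omega>p) 1 0 x)" for i x :: real

lemma pos: "0 < \<Lambda>" "0 < mp" "0 < mm" "0 < \<Lambda> - mp" "lam\<^sup>2 < (\<Lambda> - mp) * (\<Lambda> - mm)" "0 < \<Lambda>\<^sup>2 - lam\<^sup>2"
proof -
  show "0 < \<Lambda>" "0 < mp" "0 < mm" using lam rho mu sigma drift by auto
  show "0 < \<Lambda> - mp" "lam\<^sup>2 < (\<Lambda> - mp) * (\<Lambda> - mm)" using discount_bounds[OF sigma discount] by auto
  have "lam\<^sup>2 < \<Lambda>\<^sup>2" using lam rho by (intro power_strict_mono) auto
  then show "0 < \<Lambda>\<^sup>2 - lam\<^sup>2" by simp
qed

lemma mpmm: "\<mu>\<^sup>2 - \<sigma>\<^sup>2 = mp * mm"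
  by (simp add: power2_eq_square algebra_simps)

text \<open>Sum and product of the roots of \<open>mp * mm * x\<^sup>2 - 2 * \<Lambda> * \<mu> * x +
  \<Lambda>\<^sup>2 - lam\<^sup>2\<close>; the quantity under the square root is a quarter of its
  discriminant.\<close>

lemma vieta: "mp * mm * (\<Omega>p + \<Omega>m) = 2 * \<Lambda> * \<mu>" "mp * mm * (\<Omega>p * \<Omega>m) = \<Lambda>\<^sup>2 - lam\<^sup>2"
proof -
  let ?S = "sqrt (lam\<^sup>2 * \<mu>\<^sup>2 + \<sigma>\<^sup>2 * (\<rho>\<^sup>2 + 2 * lam * \<rho>))"
  have S: "?S\<^sup>2 = lam\<^sup>2 * \<mu>\<^sup>2 + \<sigma>\<^sup>2 * (\<rho>\<^sup>2 + 2 * lam * \<rho>)"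
    using lam rho by (intro real_sqrt_pow2) auto
  have nz: "mp * mm \<noteq> 0" using pos by simp
  have p: "mp * mm * \<Omega>p = \<Lambda> * \<mu> + ?S" and m: "mp * mm * \<Omega>m = \<Lambda> * \<mu> - ?S"
    unfolding \<Omega>p_def \<Omega>m_def mpmm using nz by simp_all
  have "mp * mm * (\<Omega>p + \<Omega>m) = (\<Lambda> * \<mu> + ?S) + (\<Lambda> * \<mu> - ?S)"
    unfolding p[symmetric] m[symmetric] by (rule distrib_left)
  then show "mp * mm * (\<Omega>p + \<Omega>m) = 2 * \<Lambda> * \<mu>" by simp
  have "(mp * mm) * (mp * mm * (\<Omega>p * \<Omega>m)) = (mp * mm * \<Omega>p) * (mp * mm * \<Omega>m)" by (simp only: mult_ac)
  also have "\<dots> = (\<Lambda> * \<mu>)\<^sup>2 - ?S\<^sup>2" unfolding p m by (simp add: power2_eq_square algebra_simps)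
  also have "\<dots> = (mp * mm) * (\<Lambda>\<^sup>2 - lam\<^sup>2)" unfolding S mpmm[symmetric] by (simp add: power2_eq_square algebra_simps)
  finally show "mp * mm * (\<Omega>p * \<Omega>m) = \<Lambda>\<^sup>2 - lam\<^sup>2" using nz by simp
qed

text \<open>The powers \<open>\<omega> * y powr x\<close> (down) and \<open>y powr x\<close> (up)
  satisfy both generator equations iff \<open>\<Lambda> - mp * x = lam * \<omega>\<close> and
  \<open>(\<Lambda> - mm * x) * \<omega> = lam\<close>. Eliminating \<open>\<omega>\<close> makes
  the left side vanish, so the exponents are its zeros.\<close>

lemma characteristic: "(\<Lambda> - mp * x) * (\<Lambda> - mm * x) - lam\<^sup>2 = mp * mm * ((x - \<Omega>m) * (x - \<Omega>p))"
proof -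
  have "mp * mm * ((x - \<Omega>m) * (x - \<Omega>p)) = mp * mm * x\<^sup>2 - mp * mm * (\<Omega>p + \<Omega>m) * x + mp * mm * (\<Omega>p * \<Omega>m)"
    by (simp add: power2_eq_square algebra_simps)
  then show ?thesis unfolding vieta by (simp add: power2_eq_square algebra_simps)
qed

text \<open>Signs of the characteristic polynomial: it is \<open>- lam\<^sup>2\<close> at
  \<open>\<Lambda> / mp\<close>, which therefore separates the roots, and positive at 1 by the bound
  on \<open>\<rho>\<close>. Since \<open>1 < \<Lambda> / mp\<close>, the point 1 lies below both
  roots.\<close>

lemma Omega_order: "1 < \<Omega>m" "mp * \<Omega>m < \<Lambda>" "\<Lambda> < mp * \<Omega>p" "\<Omega>m < \<Omega>p"
proof -
  let ?t = "\<Lambda> / mp"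
  have "\<Omega>m \<le> \<Omega>p" unfolding \<Omega>m_def \<Omega>p_def mpmm
    using pos lam rho by (intro divide_right_mono) (auto intro!: add_nonneg_nonneg mult_nonneg_nonneg)
  have "mp * mm * ((?t - \<Omega>m) * (?t - \<Omega>p)) = - lam\<^sup>2"
    unfolding characteristic[symmetric] using pos by simp
  then have "mp * mm * ((?t - \<Omega>m) * (?t - \<Omega>p)) < 0" using lam by simp
  then have neg: "(?t - \<Omega>m) * (?t - \<Omega>p) < 0" using pos by (simp add: mult_less_0_iff)
  then have t: "\<Omega>m < ?t" "?t < \<Omega>p" using \<open>\<Omega>m \<le> \<Omega>p\<close> by (auto simp: mult_less_0_iff)
  then show "\<Omega>m < \<Omega>p" by (rule less_trans)
  show "mp * \<Omega>m < \<Lambda>" "\<Lambda> < mp * \<Omega>p" using t pos by (auto simp: field_simps)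
  have "0 < mp * mm * ((1 - \<Omega>m) * (1 - \<Omega>p))"
    unfolding characteristic[symmetric] using pos by simp
  then have "0 < (1 - \<Omega>m) * (1 - \<Omega>p)" by (rule zero_less_mult_pos) (use pos in simp)
  moreover have "1 < ?t" using pos by simp
  ultimately show "1 < \<Omega>m" using t by (auto simp: zero_less_mult_iff)
qed

lemma omega_eq: "lam * \<omega>p = \<Lambda> - mp * \<Omega>p" "lam * \<omega>m = \<Lambda> - mp * \<Omega>m"
  "(\<Lambda> - mm * \<Omega>p) * \<omega>p = lam" "(\<Lambda> - mm * \<Omega>m) * \<omega>m = lam"
proof -
  show 1: "lam * \<omega>p = \<Lambda> - mp * \<Omega>p" "lam * \<omega>m = \<Lambda> - mp * \<Omega>m"
    unfolding \<omega>p_def \<omega>m_def using lam by (simp_all add: field_simps)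
  have "lam * ((\<Lambda> - mm * \<Omega>p) * \<omega>p) = (\<Lambda> - mm * \<Omega>p) * (lam * \<omega>p)"
    "lam * ((\<Lambda> - mm * \<Omega>m) * \<omega>m) = (\<Lambda> - mm * \<Omega>m) * (lam * \<omega>m)"
    by (rule mult.left_commute)+
  moreover have "(\<Lambda> - mm * \<Omega>p) * (lam * \<omega>p) = lam * lam" "(\<Lambda> - mm * \<Omega>m) * (lam * \<omega>m) = lam * lam"
    unfolding 1 using characteristic[of \<Omega>p] characteristic[of \<Omega>m] by (simp_all add: mult.commute power2_eq_square)
  ultimately have "lam * ((\<Lambda> - mm * \<Omega>p) * \<omega>p) = lam * lam" "lam * ((\<Lambda> - mm * \<Omega>m) * \<omega>m) = lam * lam"
    by (simp_all only:)
  then show "(\<Lambda> - mm * \<Omega>p) * \<omega>p = lam" "(\<Lambda> - mm * \<Omega>m) * \<omega>m = lam"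
    using lam by (simp_all only: mult_cancel_left less_irrefl simp_thms) simp_all
qed

lemma omega_sign: "\<omega>p < 0" "0 < \<omega>m"
proof -
  have "lam * \<omega>p < 0" "0 < lam * \<omega>m" unfolding omega_eq using Omega_order by simp_all
  then show "\<omega>p < 0" "0 < \<omega>m" using lam by (simp_all add: mult_less_0_iff zero_less_mult_iff)
qed

lemma inverse_omega: "lam / \<omega>p = \<Lambda> - mm * \<Omega>p" "lam / \<omega>m = \<Lambda> - mm * \<Omega>m"
  using omega_eq(3,4) omega_sign by (simp_all add: field_simps)

text \<open>\<open>1 \<le> b\<close> is \<open>\<rho> \<le> \<mu> + \<sigma>\<close> in another
  form: in the up state the price grows at least as fast as it is discounted.\<close>

lemma b: "b * (\<Lambda> - mp) = lam" "1 \<le> b"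
  using pos rho_le by (simp_all add: b_def)

lemma u_pos: "0 < u"
  unfolding u_def using a pos by (intro divide_pos_pos mult_pos_pos) auto

text \<open>The down-state equation at \<open>u\<close>, with the payoff in the down state and the
  affine branch in the up state. It is what makes the up state continuous at
  \<open>u\<close>.\<close>

lemma u_matching: "lam * (b * u - a * lam / \<Lambda>) = \<Lambda> * (u - a) - mm * u"
proof -
  let ?P = "(\<Lambda> - mp) * (\<Lambda> - mm) - lam\<^sup>2"
  have u: "u * (\<Lambda> * ?P) = a * ((\<Lambda>\<^sup>2 - lam\<^sup>2) * (\<Lambda> - mp))" unfolding u_def using pos by simp
  have "(\<Lambda> * (\<Lambda> - mp)) * (\<Lambda> * (u - a) - mm * u - lam * (b * u - a * lam / \<Lambda>))
      = \<Lambda> * (\<Lambda> - mp) * (\<Lambda> * (u - a) - mm * u) - lam * \<Lambda> * (b * (\<Lambda> - mp)) * u + lam * (\<Lambda> - mp) * a * lam"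
    using pos by (simp add: field_simps)
  also have "\<dots> = u * (\<Lambda> * ?P) - a * ((\<Lambda>\<^sup>2 - lam\<^sup>2) * (\<Lambda> - mp))"
    unfolding b by (simp add: power2_eq_square algebra_simps)
  finally show ?thesis using u pos by simp
qed

text \<open>In the definition of \<open>u\<close>, \<open>\<Lambda>\<^sup>2 - lam\<^sup>2\<close>
  and \<open>(\<Lambda> - mp) * (\<Lambda> - mm) - lam\<^sup>2\<close> are the characteristic
  polynomial at 0 and at 1, hence products in the exponents.\<close>

lemma u_Omega: "u * ((\<Omega>m - 1) * (\<Omega>p - 1)) * \<Lambda> = a * (\<Omega>m * \<Omega>p) * (\<Lambda> - mp)"
proof -
  let ?P = "(\<Lambda> - mp) * (\<Lambda> - mm) - lam\<^sup>2"
  have u: "u * (\<Lambda> * ?P) = a * ((\<Lambda>\<^sup>2 - lam\<^sup>2) * (\<Lambda> - mp))" unfolding u_def using pos by simp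
  have P: "?P = mp * mm * ((\<Omega>m - 1) * (\<Omega>p - 1))" using characteristic[of 1] by (simp add: algebra_simps)
  have "(mp * mm) * (u * ((\<Omega>m - 1) * (\<Omega>p - 1)) * \<Lambda>) = (mp * mm) * (a * (\<Omega>m * \<Omega>p) * (\<Lambda> - mp))"
    using u unfolding P vieta(2)[symmetric] by (simp only: mult_ac)
  then show ?thesis using pos by simp
qed

text \<open>By \<open>u_Omega\<close> both inequalities reduce to \<open>\<Lambda> / mp\<close>
  lying strictly between the exponents. They make both power coefficients positive, on which
  convexity of the down-state value rests.\<close>

lemma u_between: "a * \<Omega>p < u * (\<Omega>p - 1)" "u * (\<Omega>m - 1) < a * \<Omega>m"
proof -
  note o = Omega_order
  have "(u * (\<Omega>p - 1) - a * \<Omega>p) * ((\<Omega>m - 1) * \<Lambda>) = a * \<Omega>p * (\<Lambda> - mp * \<Omega>m)"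
    using u_Omega by (simp add: algebra_simps)
  moreover have "0 < a * \<Omega>p * (\<Lambda> - mp * \<Omega>m)" using o a by simp
  ultimately have "0 < (u * (\<Omega>p - 1) - a * \<Omega>p) * ((\<Omega>m - 1) * \<Lambda>)" by simp
  then have "0 < u * (\<Omega>p - 1) - a * \<Omega>p" by (rule zero_less_mult_pos2) (use o pos in simp)
  then show "a * \<Omega>p < u * (\<Omega>p - 1)" by simp
  have "(a * \<Omega>m - u * (\<Omega>m - 1)) * ((\<Omega>p - 1) * \<Lambda>) = a * \<Omega>m * (mp * \<Omega>p - \<Lambda>)"
    using u_Omega by (simp add: algebra_simps)
  moreover have "0 < a * \<Omega>m * (mp * \<Omega>p - \<Lambda>)" using o a by simp
  ultimately have "0 < (a * \<Omega>m - u * (\<Omega>m - 1)) * ((\<Omega>p - 1) * \<Lambda>)" by simp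
  then have "0 < a * \<Omega>m - u * (\<Omega>m - 1)" by (rule zero_less_mult_pos2) (use o pos in simp)
  then show "u * (\<Omega>m - 1) < a * \<Omega>m" by simp
qed

lemma coefficients_pos: "0 < \<alpha>" "0 < \<beta>"
  unfolding \<alpha>_def \<beta>_def using u_between Omega_order u_pos by simp_all

lemma coefficients_at_u:
  "\<alpha> * u powr \<Omega>m = (u * (\<Omega>p - 1) - a * \<Omega>p) / (\<Omega>p - \<Omega>m)"
  "\<beta> * u powr \<Omega>p = (a * \<Omega>m - u * (\<Omega>m - 1)) / (\<Omega>p - \<Omega>m)"
proof -
  have "u powr (- r) * u powr r = 1" for r using u_pos by (simp flip: powr_add)
  then have "u powr (- r) * c * u powr r = c" for r c by (metis mult.assoc mult.commute mult.right_neutral)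
  then show "\<alpha> * u powr \<Omega>m = (u * (\<Omega>p - 1) - a * \<Omega>p) / (\<Omega>p - \<Omega>m)"
    "\<beta> * u powr \<Omega>p = (a * \<Omega>m - u * (\<Omega>m - 1)) / (\<Omega>p - \<Omega>m)"
    unfolding \<alpha>_def \<beta>_def by blast+
qed

lemma fit_down:
  "\<alpha> * u powr \<Omega>m + \<beta> * u powr \<Omega>p = 1 * u + - a"
  "\<alpha> * \<Omega>m * u powr \<Omega>m + \<beta> * \<Omega>p * u powr \<Omega>p = 1 * u"
proof -
  have nz: "\<Omega>p - \<Omega>m \<noteq> 0" using Omega_order by simp
  show "\<alpha> * u powr \<Omega>m + \<beta> * u powr \<Omega>p = 1 * u + - a"
    unfolding coefficients_at_u add_divide_distrib[symmetric] nonzero_divide_eq_eq[OF nz] by (simp add: algebra_simps)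
  have "\<alpha> * \<Omega>m * u powr \<Omega>m + \<beta> * \<Omega>p * u powr \<Omega>p = \<Omega>m * (\<alpha> * u powr \<Omega>m) + \<Omega>p * (\<beta> * u powr \<Omega>p)"
    by simp
  also have "\<dots> = u"
    unfolding coefficients_at_u times_divide_eq_right add_divide_distrib[symmetric] nonzero_divide_eq_eq[OF nz]
    by (simp add: algebra_simps)
  finally show "\<alpha> * \<Omega>m * u powr \<Omega>m + \<beta> * \<Omega>p * u powr \<Omega>p = 1 * u" by simp
qed

text \<open>No free constant is left here. The down-state equation expresses the up value at
  \<open>u\<close> through value and slope of the down state, and \<open>u_matching\<close>
  identifies it; the up-state equation, valid on both branches, then forces equal slopes.\<close>

lemma fit_up:
  "\<alpha> / \<omega>m * u powr \<Omega>m + \<beta> / \<omega>p * u powr \<Omega>p = b * u + - (a * lam / \<Lambda>)"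
  "\<alpha> / \<omega>m * \<Omega>m * u powr \<Omega>m + \<beta> / \<omega>p * \<Omega>p * u powr \<Omega>p = b * u"
proof -
  let ?x = "\<alpha> * u powr \<Omega>m" and ?z = "\<beta> * u powr \<Omega>p"
  have f: "?x + ?z = u - a" "\<Omega>m * ?x + \<Omega>p * ?z = u" using fit_down by (simp_all add: mult_ac)
  have "lam * (\<alpha> / \<omega>m * u powr \<Omega>m + \<beta> / \<omega>p * u powr \<Omega>p) = lam / \<omega>m * ?x + lam / \<omega>p * ?z"
    by (simp add: distrib_left)
  also have "\<dots> = \<Lambda> * (?x + ?z) - mm * (\<Omega>m * ?x + \<Omega>p * ?z)"
    unfolding inverse_omega by (simp add: algebra_simps)
  also have "\<dots> = lam * (b * u - a * lam / \<Lambda>)" unfolding f u_matching ..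
  finally show 1: "\<alpha> / \<omega>m * u powr \<Omega>m + \<beta> / \<omega>p * u powr \<Omega>p = b * u + - (a * lam / \<Lambda>)" using lam by simp
  have w: "mp * \<Omega>m / \<omega>m = \<Lambda> / \<omega>m - lam" "mp * \<Omega>p / \<omega>p = \<Lambda> / \<omega>p - lam"
    using omega_eq(1,2) omega_sign by (simp_all add: field_simps)
  have "mp * (\<alpha> / \<omega>m * \<Omega>m * u powr \<Omega>m + \<beta> / \<omega>p * \<Omega>p * u powr \<Omega>p) = mp * \<Omega>m / \<omega>m * ?x + mp * \<Omega>p / \<omega>p * ?z"
    unfolding distrib_left[of mp] by (simp add: mult_ac)
  also have "\<dots> = \<Lambda> * (\<alpha> / \<omega>m * u powr \<Omega>m + \<beta> / \<omega>p * u powr \<Omega>p) - lam * (?x + ?z)"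
    unfolding w by (simp add: algebra_simps)
  also have "\<dots> = (\<Lambda> * b - lam) * u" unfolding 1 f using pos by (simp add: field_simps)
  also have "\<Lambda> * b - lam = mp * b" using b(1) by (simp add: algebra_simps)
  finally show "\<alpha> / \<omega>m * \<Omega>m * u powr \<Omega>m + \<beta> / \<omega>p * \<Omega>p * u powr \<Omega>p = b * u" using pos by simp
qed

text \<open>In each state \<open>d\<close> is the drift times another \<open>spliced\<close>
  function, whose continuity at \<open>u\<close> is exactly the smooth fit of
  \<open>v\<close>.\<close>

lemma flow_smooth_v: "\<exists>L. flow_smooth \<mu> \<sigma> L v d"
proof -
  have O: "1 < \<Omega>m" "1 < \<Omega>p" using Omega_order by auto
  have fd: "\<alpha> * \<Omega>m * u powr \<Omega>m + \<beta> * \<Omega>p * u powr \<Omega>p = 1 * u + 0"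
    and fu: "\<alpha> / \<omega>m * \<Omega>m * u powr \<Omega>m + \<beta> / \<omega>p * \<Omega>p * u powr \<Omega>p = b * u + 0"
    using fit_down(2) fit_up(2) by simp_all
  have lip: "\<exists>L\<ge>0. \<forall>x\<ge>0. \<forall>z\<ge>0. \<bar>v i x - v i z\<bar> \<le> L * \<bar>x - z\<bar> \<and> \<bar>d i x - d i z\<bar> \<le> L * \<bar>x - z\<bar>" if i: "i \<in> {-1,1}" for i
  proof -
    define D where "D = (if i = 1 then spliced u \<Omega>m \<Omega>p (\<alpha> / \<omega>m * \<Omega>m) (\<beta> / \<omega>p * \<Omega>p) b 0
      else spliced u \<Omega>m \<Omega>p (\<alpha> * \<Omega>m) (\<beta> * \<Omega>p) 1 0)"
    have d: "d i x = (\<mu> + \<sigma> * i) * D x" for x by (simp add: d_def D_def)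
    obtain L1 where L1: "L1 \<ge> 0" "\<And>x z. x \<ge> 0 \<Longrightarrow> z \<ge> 0 \<Longrightarrow> \<bar>v i x - v i z\<bar> \<le> L1 * \<bar>x - z\<bar>"
      unfolding v_def using spliced_lipschitz[OF O u_pos fit_up(1)] spliced_lipschitz[OF O u_pos fit_down(1)]
      by (cases "i = 1") auto
    obtain L2 where L2: "L2 \<ge> 0" "\<And>x z. x \<ge> 0 \<Longrightarrow> z \<ge> 0 \<Longrightarrow> \<bar>D x - D z\<bar> \<le> L2 * \<bar>x - z\<bar>"
      unfolding D_def using spliced_lipschitz[OF O u_pos fu] spliced_lipschitz[OF O u_pos fd]
      by (cases "i = 1") auto
    define L where "L = max L1 (\<bar>\<mu> + \<sigma> * i\<bar> * L2)"
    have "\<bar>v i x - v i z\<bar> \<le> L * \<bar>x - z\<bar> \<and> \<bar>d i x - d i z\<bar> \<le> L * \<bar>x - z\<bar>" if "x \<ge> 0" "z \<ge> 0" for x z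
    proof
      have "L1 * \<bar>x - z\<bar> \<le> L * \<bar>x - z\<bar>" by (intro mult_right_mono) (auto simp: L_def)
      with L1(2)[OF that] show "\<bar>v i x - v i z\<bar> \<le> L * \<bar>x - z\<bar>" by linarith
      have "\<bar>d i x - d i z\<bar> = \<bar>\<mu> + \<sigma> * i\<bar> * \<bar>D x - D z\<bar>" unfolding d by (simp add: abs_mult flip: right_diff_distrib)
      also have "\<dots> \<le> \<bar>\<mu> + \<sigma> * i\<bar> * (L2 * \<bar>x - z\<bar>)" using L2(2)[OF that] by (intro mult_left_mono) auto
      also have "\<dots> \<le> L * \<bar>x - z\<bar>" unfolding mult.assoc[symmetric] by (intro mult_right_mono) (auto simp: L_def)
      finally show "\<bar>d i x - d i z\<bar> \<le> L * \<bar>x - z\<bar>" .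
    qed
    moreover have "0 \<le> L" using L1(1) by (simp add: L_def)
    ultimately show ?thesis by blast
  qed
  obtain Lm where Lm: "0 \<le> Lm" "\<And>x z. x \<ge> 0 \<Longrightarrow> z \<ge> 0 \<Longrightarrow> \<bar>v (-1) x - v (-1) z\<bar> \<le> Lm * \<bar>x - z\<bar> \<and> \<bar>d (-1) x - d (-1) z\<bar> \<le> Lm * \<bar>x - z\<bar>"
    using lip[of "-1"] by blast
  obtain Lp where Lp: "0 \<le> Lp" "\<And>x z. x \<ge> 0 \<Longrightarrow> z \<ge> 0 \<Longrightarrow> \<bar>v 1 x - v 1 z\<bar> \<le> Lp * \<bar>x - z\<bar> \<and> \<bar>d 1 x - d 1 z\<bar> \<le> Lp * \<bar>x - z\<bar>"
    using lip[of 1] by blast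
  have "flow_smooth \<mu> \<sigma> (Lm + Lp) v d"
    unfolding flow_smooth_def
  proof (intro conjI ballI allI impI)
    show "0 \<le> Lm + Lp" using Lm Lp by simp
  next
    fix i :: real assume "i \<in> {-1,1}"
    show "v i 0 = 0" "d i 0 = 0" using u_pos by (simp_all add: v_def d_def spliced_def)
  next
    fix i x z :: real assume "i \<in> {-1,1}" and xz: "x \<ge> 0" "z \<ge> 0"
    then have i: "i = -1 \<or> i = 1" by blast
    have "Lm * \<bar>x - z\<bar> \<le> (Lm + Lp) * \<bar>x - z\<bar>" "Lp * \<bar>x - z\<bar> \<le> (Lm + Lp) * \<bar>x - z\<bar>"
      using Lm(1) Lp(1) by (intro mult_right_mono; simp)+
    then show "\<bar>v i x - v i z\<bar> \<le> (Lm + Lp) * \<bar>x - z\<bar>" "\<bar>d i x - d i z\<bar> \<le> (Lm + Lp) * \<bar>x - z\<bar>"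
      using i Lm(2)[OF xz] Lp(2)[OF xz] by (elim disjE; simp only:; linarith)+
  next
    fix i x :: real assume i: "i \<in> {-1,1}" and x: "0 < x"
    have m: "\<mu> + \<sigma> * i \<noteq> 0" using i pos by auto
    show "(v i has_real_derivative d i x / ((\<mu> + \<sigma> * i) * x)) (at x)"
      unfolding v_def d_def using spliced_derivative[OF u_pos fit_up x] spliced_derivative[OF u_pos fit_down x] m
      by (cases "i = 1") (simp_all add: mult.assoc)
  qed
  then show ?thesis ..
qed

text \<open>Below \<open>u\<close> the power pairs solve both equations by the choice of exponents
  and weights; above it the affine branch solves the up-state one. What remains is affine in the
  price, vanishes at \<open>u\<close> by \<open>u_matching\<close>, and has negative slope by the
  bound on \<open>\<rho>\<close>.\<close>

lemma generator_v:
  assumes i: "i \<in> {-1,1}"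
  shows "generator lam \<rho> v d i x = (if i = -1 \<and> u < x then - (((\<Lambda> - mp) * (\<Lambda> - mm) - lam\<^sup>2) / (\<Lambda> - mp)) * (x - u) else 0)"
proof -
  let ?X = "x powr \<Omega>m" and ?Z = "x powr \<Omega>p"
  have i': "i = -1 \<or> i = 1" using i by blast
  have w: "mp * \<Omega>m / \<omega>m = \<Lambda> / \<omega>m - lam" "mp * \<Omega>p / \<omega>p = \<Lambda> / \<omega>p - lam"
    using omega_eq(1,2) omega_sign by (simp_all add: field_simps)
  show ?thesis
  proof (cases "x \<le> u")
    case True
    have "generator lam \<rho> v d (-1) x = \<alpha> * ?X * (mm * \<Omega>m + lam / \<omega>m - \<Lambda>) + \<beta> * ?Z * (mm * \<Omega>p + lam / \<omega>p - \<Lambda>)"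
      using True unfolding generator_def v_def d_def spliced_def by (simp add: algebra_simps)
    then have 1: "generator lam \<rho> v d (-1) x = 0" unfolding inverse_omega by simp
    have "generator lam \<rho> v d 1 x = \<alpha> * ?X * (mp * \<Omega>m / \<omega>m + lam - \<Lambda> / \<omega>m) + \<beta> * ?Z * (mp * \<Omega>p / \<omega>p + lam - \<Lambda> / \<omega>p)"
      using True unfolding generator_def v_def d_def spliced_def by (simp add: algebra_simps add_divide_distrib)
    then have "generator lam \<rho> v d 1 x = 0" unfolding w by simp
    with 1 i' True show ?thesis by auto
  next
    case False
    have "generator lam \<rho> v d 1 x = (mp * b + lam - \<Lambda> * b) * x + (\<Lambda> * (a * lam / \<Lambda>) - lam * a)"
      using False unfolding generator_def v_def d_def spliced_def by (simp add: algebra_simps add_divide_distrib)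
    moreover have "mp * b + lam - \<Lambda> * b = 0" using b(1) by (simp add: algebra_simps)
    moreover have "\<Lambda> * (a * lam / \<Lambda>) - lam * a = 0" using pos by (simp add: mult.commute)
    ultimately have 1: "generator lam \<rho> v d 1 x = 0" by simp
    have "generator lam \<rho> v d (-1) x = mm * x + lam * (b * x - a * lam / \<Lambda>) - \<Lambda> * (x - a)"
      using False unfolding generator_def v_def d_def spliced_def by (simp add: algebra_simps)
    also have "\<dots> = (mm + lam * b - \<Lambda>) * (x - u) + (mm * u + lam * (b * u - a * lam / \<Lambda>) - \<Lambda> * (u - a))"
      by (simp add: algebra_simps)
    also have "\<dots> = (mm + lam * b - \<Lambda>) * (x - u)" unfolding u_matching by simp
    also have "mm + lam * b - \<Lambda> = - (((\<Lambda> - mp) * (\<Lambda> - mm) - lam\<^sup>2) / (\<Lambda> - mp))"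
      using pos by (simp add: b_def power2_eq_square field_simps)
    finally show ?thesis using 1 i' False by auto
  qed
qed

lemma generator_v_nonpos: "i \<in> {-1,1} \<Longrightarrow> generator lam \<rho> v d i x \<le> 0"
proof -
  assume i: "i \<in> {-1,1}"
  have "0 \<le> ((\<Lambda> - mp) * (\<Lambda> - mm) - lam\<^sup>2) / (\<Lambda> - mp)" using pos by simp
  then have "- (((\<Lambda> - mp) * (\<Lambda> - mm) - lam\<^sup>2) / (\<Lambda> - mp)) * (x - u) \<le> 0" if "u < x"
    using that by (intro mult_nonpos_nonneg) auto
  then show ?thesis unfolding generator_v[OF i] by simp
qed

lemma v_down_ge: "u \<le> x \<Longrightarrow> v (-1) x = x - a"
  using fit_down(1) by (cases "x = u") (simp_all add: v_def spliced_def)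

lemma v_up_ge: "u \<le> x \<Longrightarrow> v 1 x = b * x - a * (lam / \<Lambda>)"
  using fit_up(1) by (cases "x = u") (simp_all add: v_def spliced_def)

lemma a_less_u: "a < u"
proof -
  have "0 < \<alpha> * u powr \<Omega>m + \<beta> * u powr \<Omega>p"
    using coefficients_pos u_pos by (intro add_pos_pos mult_pos_pos) auto
  then show ?thesis unfolding fit_down by simp
qed

lemma v_down_nonneg: "0 \<le> x \<Longrightarrow> 0 \<le> v (-1) x"
  using coefficients_pos a_less_u v_down_ge[of x] by (cases "x \<le> u") (simp_all add: v_def spliced_def)

text \<open>A positive combination of strictly convex powers lies above its tangent at
  \<open>u\<close>, and by the fit of value and slope that tangent is the payoff line.\<close>

lemma v_down_greater:
  assumes "0 \<le> x" "x < u"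
  shows "x - a < v (-1) x"
proof -
  let ?t = "\<lambda>r. u powr r + r * u powr r / u * (x - u)"
  have "\<alpha> * ?t \<Omega>m + \<beta> * ?t \<Omega>p < \<alpha> * x powr \<Omega>m + \<beta> * x powr \<Omega>p"
    using coefficients_pos Omega_order assms
    by (intro add_strict_mono mult_strict_left_mono powr_above_tangent) auto
  moreover have "\<alpha> * ?t \<Omega>m + \<beta> * ?t \<Omega>p = (\<alpha> * u powr \<Omega>m + \<beta> * u powr \<Omega>p)
      + (\<alpha> * \<Omega>m * u powr \<Omega>m + \<beta> * \<Omega>p * u powr \<Omega>p) / u * (x - u)"
    by (simp add: algebra_simps add_divide_distrib diff_divide_distrib)
  ultimately show ?thesis using assms u_pos unfolding fit_down by (simp add: v_def spliced_def)
qed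

text \<open>Below \<open>u\<close> the difference has a nonpositive coefficient at the larger
  exponent because \<open>\<omega>p < 0\<close>, so only its sign at \<open>u\<close> matters; there
  and beyond, \<open>1 \<le> b\<close> and \<open>lam / \<Lambda> \<le> 1\<close> decide.\<close>

lemma v_down_le_up: "0 \<le> x \<Longrightarrow> v (-1) x \<le> v 1 x"
proof -
  assume x: "0 \<le> x"
  have lb: "lam / \<Lambda> \<le> 1" using lam rho by simp
  have tail: "z - a \<le> b * z - a * lam / \<Lambda>" if "0 \<le> z" for z
  proof -
    have "a * (lam / \<Lambda>) \<le> a * 1" using a lb by (intro mult_left_mono) auto
    moreover have "1 * z \<le> b * z" using b that by (intro mult_right_mono) auto
    ultimately show ?thesis by simp
  qed
  show ?thesis
  proof (cases "x \<le> u")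
    case True
    have "0 \<le> \<alpha> * (1 / \<omega>m - 1) * x powr \<Omega>m + \<beta> * (1 / \<omega>p - 1) * x powr \<Omega>p"
    proof (rule powr_combination_nonneg[OF _ _ x True u_pos])
      have "1 / \<omega>p < 0" using omega_sign by simp
      then show "\<beta> * (1 / \<omega>p - 1) \<le> 0" using coefficients_pos by (intro mult_nonneg_nonpos) auto
      have "\<alpha> * (1 / \<omega>m - 1) * u powr \<Omega>m + \<beta> * (1 / \<omega>p - 1) * u powr \<Omega>p
         = (\<alpha> / \<omega>m * u powr \<Omega>m + \<beta> / \<omega>p * u powr \<Omega>p) - (\<alpha> * u powr \<Omega>m + \<beta> * u powr \<Omega>p)"
        by (simp add: algebra_simps)
      then show "0 \<le> \<alpha> * (1 / \<omega>m - 1) * u powr \<Omega>m + \<beta> * (1 / \<omega>p - 1) * u powr \<Omega>p"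
        unfolding fit_up fit_down using tail[of u] u_pos by simp
    qed (use Omega_order in simp)
    then show ?thesis using True by (simp add: v_def spliced_def algebra_simps)
  next
    case False
    then show ?thesis using tail[OF x] by (simp add: v_def spliced_def)
  qed
qed

text \<open>Strictness at every price is what makes the up-state threshold infinite. Beyond
  \<open>u\<close> it comes from \<open>lam / \<Lambda> < 1\<close>.\<close>

lemma v_up_greater:
  assumes "0 \<le> x"
  shows "x - a < v 1 x"
proof (cases "x < u")
  case True
  then show ?thesis using v_down_greater[OF assms] v_down_le_up[OF assms] by linarith
next
  case False
  have "a * (lam / \<Lambda>) < a * 1" using a lam rho by (intro mult_strict_left_mono) auto
  moreover have "1 * x \<le> b * x" using b assms by (intro mult_right_mono) auto
  ultimately show ?thesis using False v_up_ge[of x] by simp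
qed

lemma v_nonneg: "i \<in> {-1,1} \<Longrightarrow> 0 \<le> x \<Longrightarrow> 0 \<le> v i x"
  using v_down_nonneg[of x] v_down_le_up[of x] by auto

lemma v_ge_payoff: "i \<in> {-1,1} \<Longrightarrow> 0 \<le> x \<Longrightarrow> x - a \<le> v i x"
  using v_down_greater[of x] v_down_ge[of x] v_up_greater[of x] by (cases "x < u") auto

text \<open>Continuity of the up state at \<open>u\<close>, cleared of denominators, is the linear
  equation \<open>u * D = a * N\<close>. The remaining work is \<open>D \<noteq> 0\<close>.\<close>

lemma u_quotient:
  defines "N \<equiv> \<omega>p * \<Omega>p - \<omega>m * \<Omega>m - lam * \<omega>p * \<omega>m / (lam + \<rho>) * (\<Omega>p - \<Omega>m)"
    and "D \<equiv> \<omega>p * (\<Omega>p - 1) - \<omega>m * (\<Omega>m - 1) - lam * \<omega>p * \<omega>m / (lam + \<rho> - \<mu> - \<sigma>) * (\<Omega>p - \<Omega>m)"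
  shows "u = a * (N / D)"
proof -
  let ?w = "\<omega>p * \<omega>m * (\<Omega>p - \<Omega>m)"
  have nz: "\<omega>p \<noteq> 0" "\<omega>m \<noteq> 0" "\<Omega>p - \<Omega>m \<noteq> 0" using omega_sign Omega_order by auto
  have Lmp: "lam + \<rho> - \<mu> - \<sigma> = \<Lambda> - mp" by simp
  have D: "D = \<omega>p * (\<Omega>p - 1) - \<omega>m * (\<Omega>m - 1) - b * ?w"
    unfolding D_def Lmp b_def by simp
  have N: "N = \<omega>p * \<Omega>p - \<omega>m * \<Omega>m - lam / \<Lambda> * ?w" unfolding N_def by simp
  have "?w * (b * u - a * lam / \<Lambda>) = ?w * (\<alpha> * u powr \<Omega>m / \<omega>m + \<beta> * u powr \<Omega>p / \<omega>p)"
    using fit_up(1) by simp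
  also have "\<dots> = \<omega>p * (u * (\<Omega>p - 1) - a * \<Omega>p) + \<omega>m * (a * \<Omega>m - u * (\<Omega>m - 1))"
    unfolding coefficients_at_u using nz by (simp add: distrib_left)
  finally have eq: "u * D = a * N" unfolding D N by (simp add: algebra_simps)
  \<comment> \<open>Vieta's relations give \<open>\<omega>p * \<omega>m = - mp / mm\<close>, which
    removes the product of the weights from \<open>D\<close>.\<close>
  have ww: "mm * (lam\<^sup>2 * (\<omega>p * \<omega>m)) = - (mp * lam\<^sup>2)"
  proof -
    have "mm * (lam\<^sup>2 * (\<omega>p * \<omega>m)) = mm * ((lam * \<omega>p) * (lam * \<omega>m))" by (simp add: power2_eq_square)
    also have "\<dots> = mm * \<Lambda>\<^sup>2 - \<Lambda> * (mp * mm * (\<Omega>p + \<Omega>m)) + mp * (mp * mm * (\<Omega>p * \<Omega>m))"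
      unfolding omega_eq by (simp add: power2_eq_square algebra_simps)
    also have "\<dots> = - (mp * lam\<^sup>2)" unfolding vieta by (simp add: power2_eq_square algebra_simps)
    finally show ?thesis .
  qed
  have ww': "mm * (\<omega>p * \<omega>m) = - mp"
  proof -
    have "lam\<^sup>2 * (mm * (\<omega>p * \<omega>m)) = mm * (lam\<^sup>2 * (\<omega>p * \<omega>m))" by (rule mult.left_commute)
    also have "\<dots> = lam\<^sup>2 * (- mp)" unfolding ww by (simp only: mult_minus_right mult.commute)
    finally show ?thesis using lam by (simp only: mult_cancel_left) simp
  qed
  \<comment> \<open>Up to nonzero factors \<open>D\<close> is the polynomial
    \<open>(\<Lambda> - mp * x) * (\<Lambda> - mm * x) - lam\<^sup>2\<close> at
    \<open>x = 1\<close>, which is positive by the bound on \<open>\<rho>\<close>.\<close>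
  have "lam * mm * (\<Lambda> - mp) * D = mm * (\<Lambda> - mp) * ((lam * \<omega>p) * (\<Omega>p - 1) - (lam * \<omega>m) * (\<Omega>m - 1))
      - lam * (b * (\<Lambda> - mp)) * (mm * (\<omega>p * \<omega>m)) * (\<Omega>p - \<Omega>m)"
    unfolding D by (simp add: algebra_simps)
  also have "\<dots> = (\<Omega>p - \<Omega>m) * ((\<Lambda> - mp) * (mm * (\<Lambda> + mp) - mp * mm * (\<Omega>p + \<Omega>m)) + lam\<^sup>2 * mp)"
    unfolding omega_eq b ww' by (simp add: power2_eq_square algebra_simps)
  also have "\<dots> = (\<Omega>p - \<Omega>m) * (- (mp * ((\<Lambda> - mp) * (\<Lambda> - mm) - lam\<^sup>2)))"
    unfolding vieta by (simp add: power2_eq_square algebra_simps)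
  finally have "lam * mm * (\<Lambda> - mp) * D \<noteq> 0" using pos nz by simp
  then have "D \<noteq> 0" by simp
  with eq show ?thesis by (simp add: field_simps)
qed

end

section \<open>Verification for the candidate, and the thresholds\<close>

lemma (in stopping_problem) value_function_eq:
  assumes T: "telegraph M \<xi> lam s p" and s: "s \<in> {-1,1}" and y: "0 \<le> y"
  shows "value_function M \<xi> \<mu> \<sigma> a \<rho> y = ereal (v s y)"
proof -
  interpret T: telegraph_price M \<xi> lam s p \<mu> \<sigma> y
    by (intro telegraph_price.intro T telegraph_price_axioms.intro) (use sigma drift y in auto)
  obtain L where fs: "flow_smooth \<mu> \<sigma> L v d" using flow_smooth_v by blast
  \<comment> \<open>The midpoint between the growth rate of the mean price and
    \<open>\<rho>\<close>: still large enough for \<open>discount_bounds\<close>, yet smaller than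
    \<open>\<rho>\<close>.\<close>
  define \<rho>' where "\<rho>' = (\<rho> + (\<mu> - lam + sqrt (\<sigma>\<^sup>2 + lam\<^sup>2))) / 2"
  have "lam \<le> sqrt (\<sigma>\<^sup>2 + lam\<^sup>2)" by (rule real_le_rsqrt) simp
  then have "0 < \<mu> - lam + sqrt (\<sigma>\<^sup>2 + lam\<^sup>2)" using mu by linarith
  then have \<rho>': "0 \<le> \<rho>'" "\<rho>' < \<rho>" "\<rho>' > \<mu> - lam + sqrt (\<sigma>\<^sup>2 + lam\<^sup>2)"
    using discount rho by (simp_all add: \<rho>'_def field_simps)
  note db = discount_bounds[OF sigma \<rho>'(3)]
  \<comment> \<open>Chosen to make the up-state condition an equality; the down-state condition is
    then the determinant inequality in \<open>db\<close>.\<close>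
  define c where "c i = (if i = 1 then lam / (lam + \<rho>' - mp) else 1)" for i :: real
  have c: "0 < c i" for i using db lam by (simp add: c_def)
  have c1: "c 1 * (lam + \<rho>' - mp) = lam" "c (-1) = 1" using db by (simp_all add: c_def)
  have up: "(\<mu> + \<sigma> * 1) * c 1 + lam * (c (- 1) - c 1) - \<rho>' * c 1 = 0"
    using c1 by (simp add: algebra_simps)
  have "(lam + \<rho>' - mp) * (lam * c 1) \<le> (lam + \<rho>' - mp) * (lam + \<rho>' - mm)"
    using db(2) c1(1) by (simp add: power2_eq_square mult_ac)
  then have "lam * c 1 \<le> lam + \<rho>' - mm" using db(1) by (rule mult_left_le_imp_le)
  then have down: "(\<mu> + \<sigma> * (-1)) * c (-1) + lam * (c (- (-1)) - c (-1)) - \<rho>' * c (-1) \<le> 0"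
    using c1 by (simp add: algebra_simps)
  have "(\<mu> + \<sigma> * i) * c i + lam * (c (- i) - c i) - \<rho>' * c i \<le> 0" if "i \<in> {-1,1}" for i
    using that up down by auto
  then have decay: "(\<lambda>T::nat. \<integral>\<omega>. T.discounted \<rho> v (real T) \<omega> \<partial>completion M) \<longlonglongrightarrow> 0"
    by (intro T.expectation_tends_to_zero[OF fs \<rho>'(1,2) c])
  have r0: "0 \<le> \<rho>" using rho by simp
  have z: "generator lam \<rho> v d i x = 0" if "i \<in> {-1,1}" "\<not> (i = -1 \<and> u \<le> x)" for i x
    using that generator_v[OF that(1), of x] by auto
  show ?thesis
  proof (rule antisym)
    show "value_function M \<xi> \<mu> \<sigma> a \<rho> y \<le> ereal (v s y)"
      using T.value_function_le[OF fs r0 generator_v_nonpos v_nonneg v_ge_payoff s] .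
    show "ereal (v s y) \<le> value_function M \<xi> \<mu> \<sigma> a \<rho> y"
      using T.value_function_ge[OF fs r0 generator_v_nonpos z v_nonneg v_down_ge less_imp_le[OF a] less_imp_le[OF a_less_u] decay] .
  qed
qed

text \<open>The description is unique because a half-line of nonnegative reals determines its
  endpoint, as testing membership at both candidate endpoints shows.\<close>

lemma stopping_threshold_finite:
  assumes "0 \<le> r" and iff: "\<And>y. 0 \<le> y \<Longrightarrow> g y = ereal (y - a) \<longleftrightarrow> r \<le> y"
  shows "stopping_threshold g a = ereal r"
  unfolding stopping_threshold_def
proof (rule the_equality)
  show "0 \<le> ereal r \<and> {y. 0 \<le> y \<and> g y = ereal (y - a)} = {y. 0 \<le> y \<and> ereal r \<le> ereal y}"
    using assms by auto
  fix w assume w: "0 \<le> w \<and> {y. 0 \<le> y \<and> g y = ereal (y - a)} = {y. 0 \<le> y \<and> w \<le> ereal y}"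
  then have *: "r \<le> y \<longleftrightarrow> w \<le> ereal y" if "0 \<le> y" for y using that iff by blast
  show "w = ereal r"
  proof (cases w)
    case (real x)
    then have "0 \<le> x" using w by simp
    then show ?thesis using *[of x] *[of r] assms(1) real by simp
  qed (use w *[of r] assms(1) in auto)
qed

lemma stopping_threshold_infinite:
  assumes ne: "\<And>y. 0 \<le> y \<Longrightarrow> g y \<noteq> ereal (y - a)"
  shows "stopping_threshold g a = \<infinity>"
  unfolding stopping_threshold_def
proof (rule the_equality)
  show "0 \<le> (\<infinity>::ereal) \<and> {y. 0 \<le> y \<and> g y = ereal (y - a)} = {y. 0 \<le> y \<and> \<infinity> \<le> ereal y}"
    using ne by auto
  fix w assume w: "0 \<le> w \<and> {y. 0 \<le> y \<and> g y = ereal (y - a)} = {y. 0 \<le> y \<and> w \<le> ereal y}"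
  then have *: "\<not> w \<le> ereal y" if "0 \<le> y" for y using that ne by blast
  show "w = \<infinity>"
  proof (cases w)
    case (real x)
    then show ?thesis using *[of x] w by simp
  qed (use w in auto)
qed

theorem theorem14:
  fixes lam \<mu> \<sigma> a \<rho> :: real
    and P :: "real \<Rightarrow> 'w measure"
    and \<xi> :: "real \<Rightarrow> 'w \<Rightarrow> real"
    and g :: "real \<Rightarrow> real \<Rightarrow> ereal"
    and u :: "real \<Rightarrow> ereal"
    and b \<Omega>p \<Omega>m \<omega>p \<omega>m N D um Cp Cm :: real
  assumes "lam > 0" "\<mu> > 0" "\<sigma> > 0" "a > 0" "\<rho> > 0"
    and chain: "\<And>s. s \<in> {-1, 1} \<Longrightarrow> markov_chain {-1, 1} (flip_generator lam) s (P s) \<xi>"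
    and g_def: "\<And>y s. g y s = value_function (P s) \<xi> \<mu> \<sigma> a \<rho> y"
    and u_def: "\<And>s. u s = stopping_threshold (\<lambda>y. g y s) a"
    and b_def: "b = lam / (lam + \<rho> - \<mu> - \<sigma>)"
    and Omega_p_def: "\<Omega>p = ((lam + \<rho>) * \<mu> + sqrt (lam\<^sup>2 * \<mu>\<^sup>2 + \<sigma>\<^sup>2 * (\<rho>\<^sup>2 + 2 * lam * \<rho>))) / (\<mu>\<^sup>2 - \<sigma>\<^sup>2)"
    and Omega_m_def: "\<Omega>m = ((lam + \<rho>) * \<mu> - sqrt (lam\<^sup>2 * \<mu>\<^sup>2 + \<sigma>\<^sup>2 * (\<rho>\<^sup>2 + 2 * lam * \<rho>))) / (\<mu>\<^sup>2 - \<sigma>\<^sup>2)"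
    and omega_p_def: "\<omega>p = 1 + \<rho> / lam - (\<mu> + \<sigma>) / lam * \<Omega>p"
    and omega_m_def: "\<omega>m = 1 + \<rho> / lam - (\<mu> + \<sigma>) / lam * \<Omega>m"
    and N_def: "N = \<omega>p * \<Omega>p - \<omega>m * \<Omega>m - lam * \<omega>p * \<omega>m / (lam + \<rho>) * (\<Omega>p - \<Omega>m)"
    and D_def: "D = \<omega>p * (\<Omega>p - 1) - \<omega>m * (\<Omega>m - 1)
                    - lam * \<omega>p * \<omega>m / (lam + \<rho> - \<mu> - \<sigma>) * (\<Omega>p - \<Omega>m)"
    and um_def: "um = real_of_ereal (u (-1))"
    and Cp_def: "Cp = um powr (- \<Omega>p) * ((um * (\<Omega>m - 1) - a * \<Omega>m) / (\<omega>p * (\<Omega>m - \<Omega>p)))"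
    and Cm_def: "Cm = um powr (- \<Omega>m) * ((um * (\<Omega>p - 1) - a * \<Omega>p) / (\<omega>m * (\<Omega>p - \<Omega>m)))"
    and "\<rho> > \<mu> - lam + sqrt (\<sigma>\<^sup>2 + lam\<^sup>2)"
    and "\<rho> \<le> \<mu> + \<sigma>" and "\<mu> - \<sigma> > 0"
  shows "u 1 = \<infinity>
     \<and> u (-1) = ereal (a * (N / D))
     \<and> (\<forall>y. 0 \<le> y \<and> y \<le> um \<longrightarrow>
           g y (-1) = ereal (Cm * \<omega>m * y powr \<Omega>m + Cp * \<omega>p * y powr \<Omega>p))
     \<and> (\<forall>y\<ge>um. g y (-1) = ereal (y - a))
     \<and> (\<forall>y. 0 \<le> y \<and> y \<le> um \<longrightarrow>
           g y 1 = ereal (Cm * y powr \<Omega>m + Cp * y powr \<Omega>p))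
     \<and> (\<forall>y\<ge>um. g y 1 = ereal (b * y - a * (lam / (lam + \<rho>))))"
proof -
  interpret S: stopping_problem lam \<mu> \<sigma> a \<rho>
    by unfold_locales fact+
  have names: "b = S.b" "\<Omega>p = S.\<Omega>p" "\<Omega>m = S.\<Omega>m"
    by (simp_all add: b_def S.b_def Omega_p_def S.\<Omega>p_def Omega_m_def S.\<Omega>m_def algebra_simps)
  have names': "\<omega>p = S.\<omega>p" "\<omega>m = S.\<omega>m"
    by (simp_all add: omega_p_def S.\<omega>p_def omega_m_def S.\<omega>m_def names)
  have val: "g y s = ereal (S.v s y)" if s: "s \<in> {-1, 1}" and y: "0 \<le> y" for s y
  proof -
    obtain p where "telegraph (P s) \<xi> lam s p"
      using markov_chain_telegraph[OF \<open>lam > 0\<close> chain[OF s]] by blast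
    from S.value_function_eq[OF this s y] show ?thesis by (simp add: g_def)
  qed
  have iff: "g y (-1) = ereal (y - a) \<longleftrightarrow> S.u \<le> y" if "0 \<le> y" for y
    using S.v_down_greater[OF that] S.v_down_ge[of y] val[of "-1", OF _ that] by (cases "S.u \<le> y") auto
  have u_down: "u (-1) = ereal S.u"
    unfolding u_def using S.u_pos iff by (intro stopping_threshold_finite) auto
  have "g y 1 \<noteq> ereal (y - a)" if "0 \<le> y" for y
    using S.v_up_greater[OF that] val[of 1, OF _ that] by auto
  then have u_up: "u 1 = \<infinity>"
    unfolding u_def by (rule stopping_threshold_infinite)
  have um: "um = S.u" unfolding um_def u_down by simp
  have quot: "S.u = a * (N / D)"
    using S.u_quotient unfolding N_def D_def names names' .
  have nz: "\<omega>p \<noteq> 0" "\<omega>m \<noteq> 0" "\<Omega>p - \<Omega>m \<noteq> 0" "\<Omega>m - \<Omega>p \<noteq> 0"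
    using S.omega_sign S.Omega_order unfolding names names' by auto
  have Cm: "Cm = S.\<alpha> / \<omega>m"
    unfolding Cm_def um S.\<alpha>_def names[symmetric] using nz by (simp add: field_simps)
  \<comment> \<open>Compared with \<open>\<beta>\<close>, numerator and denominator of
    \<open>Cp\<close> both carry the opposite sign.\<close>
  have "(um * (\<Omega>m - 1) - a * \<Omega>m) / (\<Omega>m - \<Omega>p) = (a * \<Omega>m - um * (\<Omega>m - 1)) / (\<Omega>p - \<Omega>m)"
    using minus_divide_divide[of "um * (\<Omega>m - 1) - a * \<Omega>m" "\<Omega>m - \<Omega>p"] by simp
  moreover have "(um * (\<Omega>m - 1) - a * \<Omega>m) / (\<omega>p * (\<Omega>m - \<Omega>p)) = (um * (\<Omega>m - 1) - a * \<Omega>m) / (\<Omega>m - \<Omega>p) / \<omega>p"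
    unfolding divide_divide_eq_left by (simp only: mult.commute)
  ultimately have Cp: "Cp = S.\<beta> / \<omega>p"
    unfolding Cp_def S.\<beta>_def names[symmetric] um by (simp only: times_divide_eq_right)
  have C: "Cm * \<omega>m = S.\<alpha>" "Cp * \<omega>p = S.\<beta>" using nz Cm Cp by simp_all
  show ?thesis
  proof (intro conjI allI impI)
    show "u 1 = \<infinity>" by (rule u_up)
    show "u (-1) = ereal (a * (N / D))" unfolding u_down quot ..
  next
    fix y assume "0 \<le> y \<and> y \<le> um"
    then have y: "0 \<le> y" "y \<le> S.u" by (auto simp: um)
    show "g y (-1) = ereal (Cm * \<omega>m * y powr \<Omega>m + Cp * \<omega>p * y powr \<Omega>p)"
      using val[of "-1" y] y unfolding C by (simp add: S.v_def spliced_def names)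
    show "g y 1 = ereal (Cm * y powr \<Omega>m + Cp * y powr \<Omega>p)"
      using val[of 1 y] y unfolding Cm Cp by (simp add: S.v_def spliced_def names names')
  next
    fix y assume "um \<le> y"
    then have y: "S.u \<le> y" "0 \<le> y" using S.u_pos by (auto simp: um)
    show "g y (-1) = ereal (y - a)" using iff[OF y(2)] y by simp
    show "g y 1 = ereal (b * y - a * (lam / (lam + \<rho>)))"
      using val[of 1 y] y by (simp add: S.v_up_ge names)
  qed
qed

end
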